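(* Let $\Omega\subset\mathbb{C}^n$ be a bounded domain with Bergman kernel $\mathcal{B}$, and let $\Phi:\Omega\to\mathcal{P}(\Omega,dV)$ be given by $\Phi(z)=\frac{|\mathcal{B}(z,\xi)|^2}{\mathcal{B}(z,z)}\,dV(\xi)$. Then $\Phi$ is an injective immersion.
   Context: $\mathcal{B}$ is the reproducing kernel of the space of $L^2$ holomorphic functions on $\Omega$ with respect to Lebesgue measure $dV$. $\mathcal{P}(\Omega,dV)$ is the set of probability measures $\phi\,dV$ with $\phi\in L^1(\Omega,dV)$, $\phi>0$ a.e., regarded as a subset of the Banach space $\{\phi\,dV:\phi\in L^1(\Omega,dV)\}$ with total variation norm. The map $\Phi$ is Fréchet $C^1$ with derivative $d\Phi_z(V)=\partial_VP(z,\cdot)\,dV$, where $P(z,\xi)=|\mathcal{B}(z,\xi)|^2/\mathcal{B}(z,z)$; immersion means $d\Phi_z$ is injective on the tangent space for every $z\in\Omega$. *)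

theory Defs
  imports "HOL-Analysis.Analysis" "HOL-Library.Disjoint_Sets"
begin

section \<open>Absolutely continuous signed measures with the total variation norm\<close>

text \<open>
  The signed measure \<open>\<phi> dV\<close> is represented by its values on Borel sets, so that two densities
  give the same measure iff they agree almost everywhere. Set functions are \<open>0\<close> off the Borel sets.
\<close>

definition indef_integral :: "('a::euclidean_space \<Rightarrow> real) \<Rightarrow> 'a set \<Rightarrow> real" where
  "indef_integral \<phi> A = (if A \<in> sets borel then LINT x:A|lborel. \<phi> x else 0)"

definition borel_families :: "'a::topological_space set set set" where
  "borel_families = {P. finite P \<and> disjoint P \<and> P \<subseteq> sets borel}"

definition total_variation :: "('a::topological_space set \<Rightarrow> real) \<Rightarrow> real" where
  "total_variation \<mu> = (SUP P\<in>borel_families. \<Sum>A\<in>P. \<bar>\<mu> A\<bar>)"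

typedef (overloaded) 'a ac_measure =
  "{indef_integral \<phi> |\<phi> :: 'a::euclidean_space \<Rightarrow> real. integrable lborel \<phi>}"
  by (intro exI[of _ "indef_integral (\<lambda>_. 0)"]) auto

lemma integrable_times_indicator:
  fixes \<phi> :: "'a::euclidean_space \<Rightarrow> real"
  assumes "integrable lborel \<phi>" "A \<in> sets borel"
  shows "set_integrable lborel A \<phi>"
  unfolding set_integrable_def using assms by (intro integrable_mult_indicator) auto

lemma total_variation_indef_integral:
  fixes \<phi> :: "'a::euclidean_space \<Rightarrow> real"
  assumes i: "integrable lborel \<phi>"
  shows "total_variation (indef_integral \<phi>) = (LINT x|lborel. \<bar>\<phi> x\<bar>)"
  unfolding total_variation_def
proof (rule cSup_eq_maximum)
  have m [measurable]: "\<phi> \<in> borel_measurable borel" using i by auto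
  define A where "A = {x. \<phi> x \<ge> 0}"
  define B where "B = {x. \<phi> x < 0}"
  have AB: "A \<in> sets borel" "B \<in> sets borel" "A \<inter> B = {}" "A \<union> B = UNIV"
    unfolding A_def B_def by (measurable, measurable) auto
  then have ne: "A \<noteq> B" by auto
  have "(LINT x|lborel. \<bar>\<phi> x\<bar>) = (LINT x:A \<union> B|lborel. \<bar>\<phi> x\<bar>)"
    by (simp add: AB set_lebesgue_integral_def)
  also have "\<dots> = (LINT x:A|lborel. \<bar>\<phi> x\<bar>) + (LINT x:B|lborel. \<bar>\<phi> x\<bar>)"
    using AB i by (intro set_integral_Un integrable_times_indicator integrable_abs) auto
  also have "(LINT x:A|lborel. \<bar>\<phi> x\<bar>) = (LINT x:A|lborel. \<phi> x)"
    by (rule set_lebesgue_integral_cong) (use AB in \<open>auto simp: A_def\<close>)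
  also have "(LINT x:B|lborel. \<bar>\<phi> x\<bar>) = (LINT x:B|lborel. - \<phi> x)"
    by (rule set_lebesgue_integral_cong) (use AB in \<open>auto simp: B_def\<close>)
  also have "(LINT x:B|lborel. - \<phi> x) = - (LINT x:B|lborel. \<phi> x)"
    by (simp add: set_lebesgue_integral_def)
  finally have e: "(LINT x|lborel. \<bar>\<phi> x\<bar>) = (LINT x:A|lborel. \<phi> x) + - (LINT x:B|lborel. \<phi> x)" .
  moreover have "(LINT x:A|lborel. \<phi> x) \<ge> 0"
    unfolding set_lebesgue_integral_def
    by (rule integral_nonneg_AE) (auto simp: A_def indicator_def)
  moreover have "(LINT x:B|lborel. - \<phi> x) \<ge> 0"
    unfolding set_lebesgue_integral_def
    by (rule integral_nonneg_AE) (auto simp: B_def indicator_def)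
  then have "- (LINT x:B|lborel. \<phi> x) \<ge> 0"
    by (simp add: set_lebesgue_integral_def)
  ultimately have "(LINT x|lborel. \<bar>\<phi> x\<bar>) = (\<Sum>C\<in>{A,B}. \<bar>indef_integral \<phi> C\<bar>)"
    using ne AB by (simp add: indef_integral_def)
  moreover have "{A,B} \<in> borel_families"
    using AB by (auto simp: borel_families_def disjoint_def)
  ultimately show "(LINT x|lborel. \<bar>\<phi> x\<bar>) \<in>
      (\<lambda>P. \<Sum>A\<in>P. \<bar>indef_integral \<phi> A\<bar>) ` borel_families" by blast
next
  fix y assume "y \<in> (\<lambda>P. \<Sum>A\<in>P. \<bar>indef_integral \<phi> A\<bar>) ` borel_families"
  then obtain P where P: "finite P" "disjoint P" "P \<subseteq> sets borel"
    and y: "y = (\<Sum>A\<in>P. \<bar>indef_integral \<phi> A\<bar>)" by (auto simp: borel_families_def)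
  have "\<bar>indef_integral \<phi> A\<bar> \<le> (LINT x:A|lborel. \<bar>\<phi> x\<bar>)" if "A \<in> P" for A
  proof -
    have "\<bar>LINT x:A|lborel. \<phi> x\<bar> \<le> (LINT x|lborel. \<bar>indicator A x *\<^sub>R \<phi> x\<bar>)"
      unfolding set_lebesgue_integral_def by (rule integral_abs_bound)
    then show ?thesis
      using that P by (auto simp: indef_integral_def set_lebesgue_integral_def abs_mult)
  qed
  then have "y \<le> (\<Sum>A\<in>P. LINT x:A|lborel. \<bar>\<phi> x\<bar>)" unfolding y by (intro sum_mono)
  also have "\<dots> = (LINT x|lborel. (\<Sum>A\<in>P. indicator A x *\<^sub>R \<bar>\<phi> x\<bar>))"
    unfolding set_lebesgue_integral_def
  proof (rule Bochner_Integration.integral_sum[symmetric])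
    fix A assume "A \<in> P"
    with P i show "integrable lborel (\<lambda>x. indicator A x *\<^sub>R \<bar>\<phi> x\<bar>)"
      by (intro integrable_mult_indicator integrable_abs) auto
  qed
  also have "\<dots> \<le> (LINT x|lborel. \<bar>\<phi> x\<bar>)"
  proof (rule integral_mono)
    show "integrable lborel (\<lambda>x. \<Sum>A\<in>P. indicator A x *\<^sub>R \<bar>\<phi> x\<bar>)"
    proof (rule Bochner_Integration.integrable_sum)
      fix A assume "A \<in> P"
      with P i show "integrable lborel (\<lambda>x. indicator A x *\<^sub>R \<bar>\<phi> x\<bar>)"
        by (intro integrable_mult_indicator integrable_abs) auto
    qed
    show "integrable lborel (\<lambda>x. \<bar>\<phi> x\<bar>)" using i by simp
    fix x
    have "(\<Sum>A\<in>P. indicator A x :: real) = indicator (\<Union>P) x"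
      using P by (subst indicator_UN_disjoint[of P id, simplified, symmetric])
        (auto simp: disjoint_family_on_def disjoint_def)
    then have "(\<Sum>A\<in>P. indicator A x *\<^sub>R \<bar>\<phi> x\<bar>) = indicator (\<Union>P) x * \<bar>\<phi> x\<bar>"
      by (simp add: sum_distrib_right[symmetric])
    also have "\<dots> \<le> \<bar>\<phi> x\<bar>" by (auto simp: indicator_def)
    finally show "(\<Sum>A\<in>P. indicator A x *\<^sub>R \<bar>\<phi> x\<bar>) \<le> \<bar>\<phi> x\<bar>" .
  qed
  finally show "y \<le> (LINT x|lborel. \<bar>\<phi> x\<bar>)" .
qed

lemma indef_integral_add:
  assumes "integrable lborel \<phi>" "integrable lborel \<psi>"
  shows "indef_integral (\<lambda>x. \<phi> x + \<psi> x) = (\<lambda>A. indef_integral \<phi> A + indef_integral \<psi> A)"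
  using assms
  by (auto simp: indef_integral_def fun_eq_iff intro!: set_integral_add integrable_times_indicator)

lemma indef_integral_cmult:
  "indef_integral (\<lambda>x. c * \<phi> x) = (\<lambda>A. c * indef_integral \<phi> A)"
  by (auto simp: indef_integral_def fun_eq_iff)

lemma ac_measure_cases:
  fixes \<mu> :: "'a::euclidean_space ac_measure"
  obtains \<phi> where "integrable lborel \<phi>" "\<mu> = Abs_ac_measure (indef_integral \<phi>)"
  by (cases \<mu>) auto

lemma Rep_ac_measure_indef [simp]:
  "integrable lborel \<phi> \<Longrightarrow> Rep_ac_measure (Abs_ac_measure (indef_integral \<phi>)) = indef_integral \<phi>"
  by (rule Abs_ac_measure_inverse) auto

instantiation ac_measure :: (euclidean_space) real_normed_vector
begin

definition zero_ac_measure :: "'a ac_measure" where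
  "zero_ac_measure = Abs_ac_measure (\<lambda>_. 0)"

definition plus_ac_measure :: "'a ac_measure \<Rightarrow> 'a ac_measure \<Rightarrow> 'a ac_measure" where
  "plus_ac_measure \<mu> \<nu> = Abs_ac_measure (\<lambda>A. Rep_ac_measure \<mu> A + Rep_ac_measure \<nu> A)"

definition scaleR_ac_measure :: "real \<Rightarrow> 'a ac_measure \<Rightarrow> 'a ac_measure" where
  "scaleR_ac_measure c \<mu> = Abs_ac_measure (\<lambda>A. c * Rep_ac_measure \<mu> A)"

definition uminus_ac_measure :: "'a ac_measure \<Rightarrow> 'a ac_measure" where
  "uminus_ac_measure \<mu> = (-1) *\<^sub>R \<mu>"

definition minus_ac_measure :: "'a ac_measure \<Rightarrow> 'a ac_measure \<Rightarrow> 'a ac_measure" where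
  "minus_ac_measure \<mu> \<nu> = \<mu> + - \<nu>"

definition norm_ac_measure :: "'a ac_measure \<Rightarrow> real" where
  "norm_ac_measure \<mu> = total_variation (Rep_ac_measure \<mu>)"

definition sgn_ac_measure :: "'a ac_measure \<Rightarrow> 'a ac_measure" where
  "sgn_ac_measure \<mu> = inverse (norm \<mu>) *\<^sub>R \<mu>"

definition dist_ac_measure :: "'a ac_measure \<Rightarrow> 'a ac_measure \<Rightarrow> real" where
  "dist_ac_measure \<mu> \<nu> = norm (\<mu> - \<nu>)"

definition uniformity_ac_measure :: "('a ac_measure \<times> 'a ac_measure) filter" where
  "uniformity_ac_measure = (INF e\<in>{0<..}. principal {(\<mu>, \<nu>). dist \<mu> \<nu> < e})"

definition open_ac_measure :: "'a ac_measure set \<Rightarrow> bool" where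
  "open_ac_measure U \<longleftrightarrow> (\<forall>\<mu>\<in>U. eventually (\<lambda>(\<mu>', \<nu>). \<mu>' = \<mu> \<longrightarrow> \<nu> \<in> U) uniformity)"

lemma plus_Abs:
  assumes "integrable lborel \<phi>" "integrable lborel \<psi>"
  shows "Abs_ac_measure (indef_integral \<phi>) + Abs_ac_measure (indef_integral \<psi>)
     = (Abs_ac_measure (indef_integral (\<lambda>x. \<phi> x + \<psi> x)) :: 'a ac_measure)"
  using assms by (simp add: plus_ac_measure_def indef_integral_add)

lemma scaleR_Abs:
  assumes "integrable lborel \<phi>"
  shows "c *\<^sub>R Abs_ac_measure (indef_integral \<phi>)
     = (Abs_ac_measure (indef_integral (\<lambda>x. c * \<phi> x)) :: 'a ac_measure)"
  using assms by (simp add: scaleR_ac_measure_def indef_integral_cmult)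

lemma zero_Abs: "(0 :: 'a ac_measure) = Abs_ac_measure (indef_integral (\<lambda>_. 0))"
proof -
  have "indef_integral (\<lambda>_. 0) = (\<lambda>_::'a set. 0)" by (auto simp: indef_integral_def)
  then show ?thesis by (simp add: zero_ac_measure_def)
qed

lemma norm_Abs:
  "integrable lborel \<phi> \<Longrightarrow>
    norm (Abs_ac_measure (indef_integral \<phi>) :: 'a ac_measure) = (LINT x|lborel. \<bar>\<phi> x\<bar>)"
  by (simp add: norm_ac_measure_def total_variation_indef_integral)

lemma Rep_plus: "Rep_ac_measure (\<mu> + \<nu>) A = Rep_ac_measure \<mu> A + Rep_ac_measure (\<nu> :: 'a ac_measure) A"
  by (cases \<mu> rule: ac_measure_cases; cases \<nu> rule: ac_measure_cases)
    (simp add: plus_Abs, simp add: indef_integral_add)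

lemma Rep_scaleR: "Rep_ac_measure (c *\<^sub>R \<mu>) A = c * Rep_ac_measure (\<mu> :: 'a ac_measure) A"
  by (cases \<mu> rule: ac_measure_cases)
    (simp add: scaleR_Abs, simp add: indef_integral_cmult)

lemma Rep_zero: "Rep_ac_measure (0 :: 'a ac_measure) A = 0"
  by (simp add: zero_Abs) (simp add: indef_integral_def)

lemma ac_measure_eqI: "(\<And>A. Rep_ac_measure \<mu> A = Rep_ac_measure \<nu> A) \<Longrightarrow> \<mu> = (\<nu> :: 'a ac_measure)"
  by (simp add: Rep_ac_measure_inject[symmetric] fun_eq_iff)

instance
proof
  fix \<mu> \<nu> \<kappa> :: "'a ac_measure" and a b :: real and U :: "'a ac_measure set"
  show "\<mu> - \<nu> = \<mu> + - \<nu>" by (simp add: minus_ac_measure_def)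
  show "\<mu> + \<nu> + \<kappa> = \<mu> + (\<nu> + \<kappa>)" by (rule ac_measure_eqI) (simp add: Rep_plus)
  show "\<mu> + \<nu> = \<nu> + \<mu>" by (rule ac_measure_eqI) (simp add: Rep_plus)
  show "0 + \<mu> = \<mu>" by (rule ac_measure_eqI) (simp add: Rep_plus Rep_zero)
  show "- \<mu> + \<mu> = 0"
    by (rule ac_measure_eqI) (simp add: Rep_plus Rep_zero Rep_scaleR uminus_ac_measure_def)
  show "a *\<^sub>R (\<mu> + \<nu>) = a *\<^sub>R \<mu> + a *\<^sub>R \<nu>"
    by (rule ac_measure_eqI) (simp add: Rep_plus Rep_scaleR algebra_simps)
  show "(a + b) *\<^sub>R \<mu> = a *\<^sub>R \<mu> + b *\<^sub>R \<mu>"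
    by (rule ac_measure_eqI) (simp add: Rep_plus Rep_scaleR algebra_simps)
  show "a *\<^sub>R b *\<^sub>R \<mu> = (a * b) *\<^sub>R \<mu>"
    by (rule ac_measure_eqI) (simp add: Rep_scaleR)
  show "1 *\<^sub>R \<mu> = \<mu>" by (rule ac_measure_eqI) (simp add: Rep_scaleR)
  show "dist \<mu> \<nu> = norm (\<mu> - \<nu>)" by (rule dist_ac_measure_def)
  show "sgn \<mu> = inverse (norm \<mu>) *\<^sub>R \<mu>" by (rule sgn_ac_measure_def)
  show "uniformity = (INF e\<in>{0<..}. principal {(\<mu>, \<nu>). dist \<mu> (\<nu> :: 'a ac_measure) < e})"
    by (rule uniformity_ac_measure_def)
  show "open U = (\<forall>\<mu>\<in>U. \<forall>\<^sub>F (\<mu>', \<nu>) in uniformity. \<mu>' = \<mu> \<longrightarrow> \<nu> \<in> U)"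
    by (rule open_ac_measure_def)
  obtain \<phi> where \<phi>: "integrable lborel \<phi>" "\<mu> = Abs_ac_measure (indef_integral \<phi>)"
    by (rule ac_measure_cases)
  obtain \<psi> where \<psi>: "integrable lborel \<psi>" "\<nu> = Abs_ac_measure (indef_integral \<psi>)"
    by (rule ac_measure_cases)
  show "norm (\<mu> + \<nu>) \<le> norm \<mu> + norm \<nu>"
  proof -
    have "(LINT x|lborel. \<bar>\<phi> x + \<psi> x\<bar>) \<le> (LINT x|lborel. \<bar>\<phi> x\<bar> + \<bar>\<psi> x\<bar>)"
      using \<phi> \<psi> by (intro integral_mono) auto
    then show ?thesis using \<phi> \<psi> by (simp add: plus_Abs norm_Abs)
  qed
  show "norm (a *\<^sub>R \<mu>) = \<bar>a\<bar> * norm \<mu>"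
    using \<phi> by (simp add: scaleR_Abs norm_Abs abs_mult)
  show "(norm \<mu> = 0) = (\<mu> = 0)"
  proof
    assume "norm \<mu> = 0"
    then have "(LINT x|lborel. \<bar>\<phi> x\<bar>) = 0" using \<phi> by (simp add: norm_Abs)
    then have ae: "AE x in lborel. \<phi> x = 0"
      using \<phi> by (subst (asm) integral_nonneg_eq_0_iff_AE) auto
    have "indef_integral \<phi> A = 0" for A
      unfolding indef_integral_def set_lebesgue_integral_def
      using ae by (auto intro!: integral_eq_zero_AE)
    then show "\<mu> = 0" using \<phi> by (intro ac_measure_eqI) (simp add: Rep_zero)
  next
    assume "\<mu> = 0"
    then show "norm \<mu> = 0" by (simp add: zero_Abs norm_Abs)
  qed
qed

end

text \<open>
  \<open>density_measure \<Omega> \<phi>\<close> is the measure \<open>\<phi> dV\<close> on \<open>\<Omega>\<close>, extended by zero to the whole space; it is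
  meaningful when \<open>\<phi>\<close> is integrable over \<open>\<Omega>\<close>. In this way \<open>L\<^sup>1(\<Omega>, dV)\<close> is a closed subspace of
  \<^typ>\<open>'a ac_measure\<close>, isometrically.
\<close>

definition density_measure :: "'a set \<Rightarrow> ('a \<Rightarrow> real) \<Rightarrow> 'a::euclidean_space ac_measure" where
  "density_measure \<Omega> \<phi> = Abs_ac_measure (indef_integral (\<lambda>x. indicator \<Omega> x *\<^sub>R \<phi> x))"

lemma Rep_density_measure:
  assumes "set_integrable lborel \<Omega> \<phi>" "A \<in> sets borel"
  shows "Rep_ac_measure (density_measure \<Omega> \<phi>) A = (LINT x:A \<inter> \<Omega>|lborel. \<phi> x)"
  using assms unfolding set_integrable_def
  by (simp add: density_measure_def) (simp add: indef_integral_def set_lebesgue_integral_def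
      indicator_inter_arith mult.assoc)

lemma norm_density_measure:
  assumes "set_integrable lborel \<Omega> \<phi>"
  shows "norm (density_measure \<Omega> \<phi>) = (LINT x:\<Omega>|lborel. \<bar>\<phi> x\<bar>)"
  using assms unfolding set_integrable_def
  by (simp add: density_measure_def norm_Abs set_lebesgue_integral_def abs_mult)

definition prob_densities :: "'a set \<Rightarrow> 'a::euclidean_space ac_measure set" where
  "prob_densities \<Omega> = {density_measure \<Omega> \<phi> |\<phi>.
     set_integrable lborel \<Omega> \<phi> \<and> (AE x in lborel. x \<in> \<Omega> \<longrightarrow> \<phi> x > 0) \<and> (LINT x:\<Omega>|lborel. \<phi> x) = 1}"


section \<open>The Bergman kernel\<close>

definition holomorphic_several :: "(complex^'n \<Rightarrow> complex) \<Rightarrow> (complex^'n) set \<Rightarrow> bool" where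
  "holomorphic_several f \<Omega> \<longleftrightarrow>
     (\<forall>z\<in>\<Omega>. \<exists>D. (f has_derivative D) (at z) \<and> (\<forall>c v. D (c *s v) = c * D v))"

definition bergman_space :: "(complex^'n) set \<Rightarrow> (complex^'n \<Rightarrow> complex) set" where
  "bergman_space \<Omega> =
     {f. holomorphic_several f \<Omega> \<and> set_integrable lborel \<Omega> (\<lambda>\<zeta>. (cmod (f \<zeta>))\<^sup>2)}"

definition is_bergman_kernel ::
  "(complex^'n) set \<Rightarrow> (complex^'n \<Rightarrow> complex^'n \<Rightarrow> complex) \<Rightarrow> bool" where
  "is_bergman_kernel \<Omega> K \<longleftrightarrow> (\<forall>w\<in>\<Omega>.
     (\<lambda>\<zeta>. K \<zeta> w) \<in> bergman_space \<Omega> \<and>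
     (\<forall>f\<in>bergman_space \<Omega>. f w = (LINT \<zeta>:\<Omega>|lborel. f \<zeta> * cnj (K \<zeta> w))))"

text \<open>
  The reproducing property determines \<open>K z w\<close> for \<open>z, w \<in> \<Omega>\<close>; the values elsewhere are irrelevant,
  hence the choice operator.
\<close>

definition bergman_kernel :: "(complex^'n) set \<Rightarrow> complex^'n \<Rightarrow> complex^'n \<Rightarrow> complex" where
  "bergman_kernel \<Omega> = (SOME K. is_bergman_kernel \<Omega> K)"

text \<open>The diagonal values \<open>\<B>(z, z)\<close> are real, being squared norms; \<^const>\<open>Re\<close> only changes the type.\<close>

definition bergman_density :: "(complex^'n) set \<Rightarrow> complex^'n \<Rightarrow> complex^'n \<Rightarrow> real" where
  "bergman_density \<Omega> z \<xi> = (cmod (bergman_kernel \<Omega> z \<xi>))\<^sup>2 / Re (bergman_kernel \<Omega> z z)"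

definition bergman_map :: "(complex^'n) set \<Rightarrow> complex^'n \<Rightarrow> (complex^'n) ac_measure" where
  "bergman_map \<Omega> z = density_measure \<Omega> (bergman_density \<Omega> z)"


section \<open>Immersions of open sets into normed spaces\<close>

definition immersion_on ::
  "('a::real_normed_vector \<Rightarrow> 'b::real_normed_vector) \<Rightarrow> 'a set \<Rightarrow> bool" where
  "immersion_on F S \<longleftrightarrow> (\<exists>F' :: 'a \<Rightarrow> 'a \<Rightarrow>\<^sub>L 'b.
     (\<forall>z\<in>S. (F has_derivative blinfun_apply (F' z)) (at z)) \<and>
     continuous_on S F' \<and>
     (\<forall>z\<in>S. inj (blinfun_apply (F' z))))"

end

theory Submission
  imports Defs "HOL-Complex_Analysis.Complex_Analysis"
begin

text \<open>
  Write \<open>k\<^sub>z = \<B>(\<cdot>, z)\<close>, so that \<open>\<Phi>(z) = |k\<^sub>z|\<^sup>2 dV / \<parallel>k\<^sub>z\<parallel>\<^sup>2\<close>. Averaging the one-variable mean value property over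
  rotations gives \<open>f = f * \<chi>\<close> for every radial bump \<open>\<chi>\<close> of mass one, whenever the ball of its radius fits into
  \<open>\<Omega>\<close>. Hence \<open>f(z)\<close>, \<open>\<partial>\<^sub>vf(z)\<close> and the second-order Taylor remainder are bounded by the \<open>L\<^sup>2\<close> norm of \<open>f\<close>, so that the
  Bergman space is complete, the kernel exists, and by duality \<open>z \<mapsto> k\<^sub>z\<close> is \<open>C\<^sup>1\<close> into \<open>L\<^sup>2\<close>. The quadratic map
  \<open>f \<mapsto> |f|\<^sup>2 dV\<close> into \<open>L\<^sup>1\<close> carries this over to \<open>\<Phi>\<close>. The same rotation average shows that zero sets are null.

  If \<open>\<Phi>(z) = \<Phi>(w)\<close>, then \<open>k\<^sub>z / k\<^sub>w\<close> has constant modulus, so \<open>k\<^sub>z = c k\<^sub>w\<close> and \<open>f(z) = cnj c f(w)\<close> for all \<open>f\<close>; if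
  \<open>d\<Phi>\<^sub>z(v) = 0\<close>, then \<open>\<partial>\<^sub>vk\<^sub>z / k\<^sub>z\<close> has constant real part, so \<open>\<partial>\<^sub>vf(z) = cnj c f(z)\<close> for all \<open>f\<close>. Since \<open>\<Omega>\<close> is
  bounded, \<open>f\<close> may be \<open>1\<close> or a coordinate function, which gives \<open>z = w\<close> and \<open>v = 0\<close>.
\<close>

subsection \<open>Circle averages\<close>

lemma nn_integral_lborel_translate:
  fixes c :: "'a::euclidean_space"
  assumes [measurable]: "F \<in> borel_measurable borel"
  shows "(\<integral>\<^sup>+x. F (c + x) \<partial>lborel) = (\<integral>\<^sup>+x. F x \<partial>lborel)"
proof -
  have "(\<integral>\<^sup>+x. F x \<partial>lborel) = (\<integral>\<^sup>+x. F x \<partial>(distr lborel borel ((+) c)))"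
    by (simp add: lborel_distr_plus)
  then show ?thesis by (simp add: nn_integral_distr)
qed

text \<open>The uniqueness argument for Haar measure, run with a ball as test set.\<close>

lemma nn_integral_lborel_orthogonal:
  fixes f :: "'a::euclidean_space \<Rightarrow> 'a"
  assumes f: "orthogonal_transformation f" and [measurable]: "F \<in> borel_measurable borel"
  shows "(\<integral>\<^sup>+x. F (f x) \<partial>lborel) = (\<integral>\<^sup>+x. F x \<partial>lborel)"
proof -
  have lin: "linear f" and nrm: "norm (f x) = norm x" for x
    using f by (auto simp: orthogonal_transformation_linear orthogonal_transformation_norm)
  have [measurable]: "f \<in> borel_measurable borel"
    using lin by (intro borel_measurable_continuous_onI linear_continuous_on) (simp add: linear_conv_bounded_linear)
  let ?B = "ball (0::'a) 1"
  have [measurable]: "Measurable.pred borel (\<lambda>x. h x \<in> ?B)" if [measurable]: "h \<in> borel_measurable borel" for h :: "_ \<Rightarrow> 'a"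
    unfolding mem_ball by measurable
  obtain g where g: "f (g y) = y" for y
    using orthogonal_transformation_surj[OF f] by (metis surjD)
  have 1: "(\<integral>\<^sup>+x. F (f x + y) \<partial>lborel) = (\<integral>\<^sup>+x. F (f x) \<partial>lborel)" for y
    using nn_integral_lborel_translate[of "\<lambda>x. F (f x)" "g y"]
    by (simp add: linear_add[OF lin] g add.commute)
  have 2: "(\<integral>\<^sup>+x. indicator ?B (y - f x) \<partial>lborel) = emeasure lborel ?B" for y
  proof -
    have "(\<integral>\<^sup>+x. indicator ?B (y - f x) \<partial>lborel) = (\<integral>\<^sup>+x. indicator ?B (y - f (g y + x)) \<partial>lborel)"
      by (rule nn_integral_lborel_translate[symmetric]) simp
    also have "\<dots> = (\<integral>\<^sup>+x. indicator ?B x \<partial>lborel)"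
      by (rule nn_integral_cong) (simp add: linear_add[OF lin] g indicator_def nrm)
    finally show ?thesis by simp
  qed
  have "(\<integral>\<^sup>+x. F (f x) \<partial>lborel) * emeasure lborel ?B
      = (\<integral>\<^sup>+y. (\<integral>\<^sup>+x. F (f x) \<partial>lborel) * indicator ?B y \<partial>lborel)"
    by (subst nn_integral_cmult) auto
  also have "\<dots> = (\<integral>\<^sup>+y. (\<integral>\<^sup>+x. F (f x + y) * indicator ?B y \<partial>lborel) \<partial>lborel)"
    by (subst nn_integral_multc) (auto simp: 1)
  also have "\<dots> = (\<integral>\<^sup>+x. (\<integral>\<^sup>+y. F (f x + y) * indicator ?B y \<partial>lborel) \<partial>lborel)"
    by (rule lborel_pair.Fubini') measurable
  also have "\<dots> = (\<integral>\<^sup>+x. (\<integral>\<^sup>+y. F y * indicator ?B (y - f x) \<partial>lborel) \<partial>lborel)"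
  proof (rule nn_integral_cong)
    fix x
    show "(\<integral>\<^sup>+y. F (f x + y) * indicator ?B y \<partial>lborel) = (\<integral>\<^sup>+y. F y * indicator ?B (y - f x) \<partial>lborel)"
      using nn_integral_lborel_translate[of "\<lambda>y. F y * indicator ?B (y - f x)" "f x"] by simp
  qed
  also have "\<dots> = (\<integral>\<^sup>+y. (\<integral>\<^sup>+x. F y * indicator ?B (y - f x) \<partial>lborel) \<partial>lborel)"
    by (rule lborel_pair.Fubini') measurable
  also have "\<dots> = (\<integral>\<^sup>+y. F y * emeasure lborel ?B \<partial>lborel)"
    by (subst nn_integral_cmult) (auto simp: 2)
  also have "\<dots> = (\<integral>\<^sup>+y. F y \<partial>lborel) * emeasure lborel ?B"
    by (rule nn_integral_multc) auto
  finally have eq: "(\<integral>\<^sup>+x. F (f x) \<partial>lborel) * emeasure lborel ?B = (\<integral>\<^sup>+y. F y \<partial>lborel) * emeasure lborel ?B" .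
  have "emeasure lborel ?B \<noteq> 0"
    using open_not_negligible[of ?B] by (auto simp: negligible_iff_null_sets null_sets_def emeasure_completion)
  moreover have "emeasure lborel ?B \<noteq> top"
    using emeasure_lborel_ball_finite[of "0::'a" 1] by (simp add: less_top)
  ultimately show ?thesis
    using eq by (metis ennreal_mult_divide_eq)
qed

lemma distr_lborel_orthogonal:
  fixes f :: "'a::euclidean_space \<Rightarrow> 'a"
  assumes f: "orthogonal_transformation f"
  shows "distr lborel borel f = lborel"
proof (rule measure_eqI)
  have [measurable]: "f \<in> borel_measurable borel"
    using f by (intro borel_measurable_continuous_onI linear_continuous_on)
      (simp add: linear_conv_bounded_linear[symmetric] orthogonal_transformation_linear)
  fix A assume "A \<in> sets (distr lborel borel f)"
  then have [measurable]: "A \<in> sets borel" by simp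
  have "emeasure (distr lborel borel f) A = (\<integral>\<^sup>+x. indicator A (f x) \<partial>lborel)"
    by (simp add: nn_integral_distr flip: nn_integral_indicator)
  also have "\<dots> = emeasure lborel A"
    by (subst nn_integral_lborel_orthogonal[OF f]) auto
  finally show "emeasure (distr lborel borel f) A = emeasure lborel A" .
qed simp

definition rot :: "real \<Rightarrow> complex^'n \<Rightarrow> complex^'n" where
  "rot t v = exp (2 * of_real pi * \<i> * of_real t) *s v"

lemma norm_vector_smult: "norm (c *s v) = cmod c * norm (v :: complex^'n)"
  by (simp add: norm_vec_def norm_mult L2_set_right_distrib)

lemma norm_rot [simp]: "norm (rot t v) = norm v"
  by (simp add: rot_def norm_vector_smult)

lemma linear_vector_smult: "linear (\<lambda>v :: complex^'n. c *s v)"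
  by (rule linearI) (auto simp: vec_eq_iff algebra_simps)

lemma orthogonal_transformation_rot: "orthogonal_transformation (rot t :: complex^'n \<Rightarrow> complex^'n)"
  unfolding orthogonal_transformation using linear_vector_smult[where 'n='n]
  by (simp add: rot_def[abs_def] norm_vector_smult)

lemma continuous_vector_smult [continuous_intros]:
  assumes "continuous_on S f" "continuous_on S g"
  shows "continuous_on S (\<lambda>x. f x *s (g x :: complex^'n))"
  unfolding vector_scalar_mult_def using assms by (intro continuous_intros)

lemma measurable_rot' [measurable]: "rot t \<in> borel_measurable borel"
  unfolding rot_def by (intro borel_measurable_continuous_onI continuous_intros)

abbreviation unit_interval_measure :: "real measure" where
  "unit_interval_measure \<equiv> restrict_space lborel {0..1}"

lemma prob_unit_interval: "emeasure unit_interval_measure (space unit_interval_measure) = 1"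
  by (simp add: space_restrict_space emeasure_restrict_space)

interpretation unit_interval: finite_measure unit_interval_measure
  by standard (simp add: space_restrict_space emeasure_restrict_space)

lemma measurable_rot_pair [measurable]:
  "(\<lambda>p. rot (fst p) (snd p :: complex^'n)) \<in> borel_measurable (unit_interval_measure \<Otimes>\<^sub>M lborel)"
proof -
  have 1: "(\<lambda>p. rot (fst p) (snd p :: complex^'n)) \<in> borel_measurable (borel \<Otimes>\<^sub>M borel)"
    unfolding borel_prod rot_def by (intro borel_measurable_continuous_onI continuous_intros)
  have 2: "fst \<in> borel_measurable (unit_interval_measure \<Otimes>\<^sub>M (lborel :: (complex^'n) measure))"
    by (rule measurable_compose[OF measurable_fst]) (simp add: measurable_restrict_space1)
  have "(\<lambda>p. (fst p, snd p)) \<in> unit_interval_measure \<Otimes>\<^sub>M (lborel :: (complex^'n) measure) \<rightarrow>\<^sub>M borel \<Otimes>\<^sub>M borel"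
    using 2 measurable_snd[of unit_interval_measure "lborel :: (complex^'n) measure"]
    by (intro measurable_Pair) auto
  from measurable_compose[OF this 1] show ?thesis by simp
qed

lemma nn_integral_circle_average:
  fixes F :: "complex^'n \<Rightarrow> ennreal"
  assumes [measurable]: "F \<in> borel_measurable borel"
  shows "(\<integral>\<^sup>+v. F v \<partial>lborel) = (\<integral>\<^sup>+v. (\<integral>\<^sup>+t. F (rot t v) \<partial>unit_interval_measure) \<partial>lborel)"
proof -
  interpret P: pair_sigma_finite unit_interval_measure "lborel :: (complex^'n) measure"
    by (simp add: pair_sigma_finite_def unit_interval.sigma_finite_measure_axioms sigma_finite_lborel)
  have "(\<integral>\<^sup>+v. (\<integral>\<^sup>+t. F (rot t v) \<partial>unit_interval_measure) \<partial>lborel)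
      = (\<integral>\<^sup>+t. (\<integral>\<^sup>+v. F (rot t v) \<partial>lborel) \<partial>unit_interval_measure)"
    by (rule P.Fubini') (simp add: case_prod_unfold measurable_compose[OF measurable_rot_pair assms])
  also have "\<dots> = (\<integral>\<^sup>+t. (\<integral>\<^sup>+v. F v \<partial>lborel) \<partial>unit_interval_measure)"
    by (simp add: nn_integral_lborel_orthogonal orthogonal_transformation_rot)
  also have "\<dots> = (\<integral>\<^sup>+v. F v \<partial>lborel)"
    using prob_unit_interval by simp
  finally show ?thesis by simp
qed

lemma integral_circle_average:
  fixes F :: "complex^'n \<Rightarrow> 'b::{banach, second_countable_topology}"
  assumes F: "integrable lborel F"
  shows "integral\<^sup>L lborel F = (LINT v|lborel. LINT t|unit_interval_measure. F (rot t v))"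
proof -
  interpret P: pair_sigma_finite unit_interval_measure "lborel :: (complex^'n) measure"
    by (simp add: pair_sigma_finite_def unit_interval.sigma_finite_measure_axioms sigma_finite_lborel)
  have F_meas[measurable]: "F \<in> borel_measurable borel" using F by auto
  have int: "integrable lborel (\<lambda>v. G (rot t v))"
    and eq: "(LINT v|lborel. G (rot t v)) = integral\<^sup>L lborel G"
    if "integrable lborel G" for G :: "complex^'n \<Rightarrow> 'c::{banach, second_countable_topology}" and t
  proof -
    have [measurable]: "G \<in> borel_measurable borel" using that by auto
    have d: "distr lborel borel (rot t) = (lborel :: (complex^'n) measure)"
      by (rule distr_lborel_orthogonal[OF orthogonal_transformation_rot])
    show "integrable lborel (\<lambda>v. G (rot t v))"
      using that by (subst (asm) d[symmetric], subst (asm) integrable_distr_eq) simp_all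
    show "(LINT v|lborel. G (rot t v)) = integral\<^sup>L lborel G"
      by (subst (2) d[symmetric], subst integral_distr) simp_all
  qed
  have "integrable (unit_interval_measure \<Otimes>\<^sub>M lborel) (\<lambda>(t, v). F (rot t v))"
  proof (rule P.Fubini_integrable)
    show "(\<lambda>(t, v). F (rot t v)) \<in> borel_measurable (unit_interval_measure \<Otimes>\<^sub>M lborel)"
      by (simp add: case_prod_unfold measurable_compose[OF measurable_rot_pair F_meas])
    have "(LINT v|lborel. norm (F (rot t v))) = (LINT v|lborel. norm (F v))" for t
      using F by (intro eq) simp
    then show "integrable unit_interval_measure (\<lambda>x. LINT y|lborel. norm (case (x, y) of (t, v) \<Rightarrow> F (rot t v)))"
      by simp
    show "AE x in unit_interval_measure. integrable lborel (\<lambda>y. case (x, y) of (t, v) \<Rightarrow> F (rot t v))"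
      using int[OF F] by simp
  qed
  then have "(LINT v|lborel. LINT t|unit_interval_measure. F (rot t v))
      = (LINT t|unit_interval_measure. LINT v|lborel. F (rot t v))"
    by (rule P.Fubini_integral)
  also have "\<dots> = integral\<^sup>L lborel F"
    using prob_unit_interval by (simp add: eq[OF F] measure_def)
  finally show ?thesis by simp
qed

subsection \<open>Mean values and zeros of holomorphic functions of several variables\<close>

lemma holomorphic_severalD:
  assumes "holomorphic_several f \<Omega>" "z \<in> \<Omega>"
  obtains D where "(f has_derivative D) (at z)" "\<And>c v. D (c *s v) = c * D v"
  using assms unfolding holomorphic_several_def by blast

lemma holomorphic_several_imp_continuous_on:
  "holomorphic_several f \<Omega> \<Longrightarrow> continuous_on \<Omega> f"
  by (meson continuous_at_imp_continuous_on has_derivative_continuous holomorphic_severalD)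

lemma holomorphic_several_subset:
  "holomorphic_several f \<Omega> \<Longrightarrow> S \<subseteq> \<Omega> \<Longrightarrow> holomorphic_several f S"
  by (auto simp: holomorphic_several_def)

lemma has_derivative_vector_smult:
  "((\<lambda>c. a + c *s (v :: complex^'n)) has_derivative (\<lambda>c. c *s v)) F"
proof -
  have "bounded_linear (\<lambda>c. c *s v)"
    by (simp add: linear_conv_bounded_linear[symmetric])
      (rule linearI; auto simp: vec_eq_iff algebra_simps)
  then show ?thesis
    by (auto intro!: derivative_eq_intros bounded_linear_imp_has_derivative)
qed

lemma holomorphic_several_line:
  assumes f: "holomorphic_several f \<Omega>" and S: "\<And>c. c \<in> S \<Longrightarrow> a + c *s v \<in> \<Omega>"
  shows "(\<lambda>c. f (a + c *s v)) holomorphic_on S"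
proof (rule holomorphic_onI)
  fix c assume "c \<in> S"
  then obtain D where D: "(f has_derivative D) (at (a + c *s v))" "\<And>c v. D (c *s v) = c * D v"
    using S f holomorphic_severalD by metis
  have "((\<lambda>c. f (a + c *s v)) has_derivative (\<lambda>c. D (c *s v))) (at c within S)"
    by (rule has_derivative_compose[OF has_derivative_vector_smult D(1)])
  then have "((\<lambda>c. f (a + c *s v)) has_field_derivative D v) (at c within S)"
    by (simp add: has_field_derivative_def D(2) mult.commute[of _ "D v"] cong: if_cong)
  then show "(\<lambda>c. f (a + c *s v)) field_differentiable at c within S"
    by (auto simp: field_differentiable_def)
qed

lemma circle_mean_value:
  assumes h: "h holomorphic_on cball 0 1"
  shows "(LINT t|unit_interval_measure. h (exp (2 * of_real pi * \<i> * of_real t))) = h 0"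
proof -
  let ?e = "\<lambda>t::real. exp (2 * of_real pi * \<i> * of_real t)"
  have "((\<lambda>u. h u / (u - 0)) has_contour_integral (2 * of_real pi * \<i> * h 0)) (circlepath 0 1)"
    using h by (intro Cauchy_integral_circlepath_simple) auto
  then have "((\<lambda>t. (2 * of_real pi * \<i>) * h (?e t)) has_integral (2 * of_real pi * \<i> * h 0)) {0..1}"
    unfolding has_contour_integral
    by (rule has_integral_eq[rotated]) (simp only: vector_derivative_circlepath, simp add: circlepath)
  then have 1: "((\<lambda>t. h (?e t)) has_integral h 0) {0..1}"
    by (subst (asm) has_integral_mult_right_iff) simp_all
  have "continuous_on {0..1} (\<lambda>t. h (?e t))"
    by (rule continuous_on_compose2[OF holomorphic_on_imp_continuous_on[OF h]])
      (auto intro!: continuous_intros)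
  then have "set_integrable lborel {0..1} (\<lambda>t. h (?e t))"
    unfolding set_integrable_def by (rule borel_integrable_compact[OF compact_Icc])
  then have "(LINT t:{0..1}|lborel. h (?e t)) = integral {0..1} (\<lambda>t. h (?e t))"
    by (rule set_borel_integral_eq_integral)
  with 1 show ?thesis
    by (simp add: integral_restrict_space set_lebesgue_integral_def integral_unique)
qed

lemma inj_on_exp_circle: "inj_on (\<lambda>t::real. exp (2 * of_real pi * \<i> * of_real t)) {0..<1}"
proof (rule inj_onI)
  fix s t :: real
  assume st: "s \<in> {0..<1}" "t \<in> {0..<1}"
    and "exp (2 * complex_of_real pi * \<i> * of_real s) = exp (2 * of_real pi * \<i> * of_real t)"
  then obtain n :: int where
    "2 * complex_of_real pi * \<i> * of_real s = 2 * of_real pi * \<i> * of_real t + (of_int (2 * n) * pi) * \<i>"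
    by (auto simp: exp_eq)
  then have "2 * pi * s = 2 * pi * t + 2 * pi * n"
    by (simp add: complex_eq_iff algebra_simps)
  then have "2 * pi * s = 2 * pi * (t + n)" by (simp add: algebra_simps)
  then have "s = t + n" by (metis mult_cancel_left pi_neq_zero mult_eq_0_iff zero_neq_numeral)
  moreover from this have "n < 1" "n > -1" using st by auto
  ultimately show "s = t" by simp
qed

lemma AE_circle_nonzero:
  assumes h: "h holomorphic_on S" and S: "open S" "connected S" "cball 0 1 \<subseteq> S" and "h 0 \<noteq> 0"
  shows "AE t in unit_interval_measure. h (exp (2 * of_real pi * \<i> * of_real t)) \<noteq> 0"
proof -
  let ?e = "\<lambda>t::real. exp (2 * of_real pi * \<i> * of_real t)"
  have fin: "finite {z \<in> cball 0 1. h z = 0}"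
  proof (cases "h constant_on S")
    case True
    then obtain k where k: "\<And>x. x \<in> S \<Longrightarrow> h x = k" by (auto simp: constant_on_def)
    moreover have "0 \<in> S" using S by auto
    ultimately have "{z \<in> cball 0 1. h z = 0} = {}" using S \<open>h 0 \<noteq> 0\<close> by auto
    then show ?thesis by (metis finite.emptyI)
  next
    case False
    with h S show ?thesis by (intro holomorphic_compact_finite_zeros) auto
  qed
  have "finite (?e -` {z \<in> cball 0 1. h z = 0} \<inter> {0..<1})"
    by (rule finite_vimage_IntI[OF fin inj_on_exp_circle])
  then have "finite (insert 1 (?e -` {z \<in> cball 0 1. h z = 0} \<inter> {0..<1}))" by simp
  then have "AE t in lborel. t \<notin> insert 1 (?e -` {z \<in> cball 0 1. h z = 0} \<inter> {0..<1})"
    by (intro AE_not_in finite_imp_null_set_lborel)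
  then have "AE t in lborel. t \<in> {0..1} \<longrightarrow> h (?e t) \<noteq> 0"
    by eventually_elim force
  then show ?thesis by (subst AE_restrict_space_iff) auto
qed

lemma holomorphic_several_mean_value_radial:
  fixes f :: "complex^'n \<Rightarrow> complex"
  assumes f: "holomorphic_several f \<Omega>" and B: "ball z r \<subseteq> \<Omega>"
    and \<phi>: "\<And>s. s \<ge> r \<Longrightarrow> \<phi> s = 0"
    and int: "integrable lborel (\<lambda>v. \<phi> (norm v) *\<^sub>R f (z + v))" "integrable lborel (\<lambda>v::complex^'n. \<phi> (norm v))"
  shows "(LINT v|lborel. \<phi> (norm v) *\<^sub>R f (z + v)) = (LINT v::complex^'n|lborel. \<phi> (norm v)) *\<^sub>R f z"
proof -
  have "(LINT t|unit_interval_measure. \<phi> (norm v) *\<^sub>R f (z + rot t v)) = \<phi> (norm v) *\<^sub>R f z" for v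
  proof (cases "norm v < r")
    case True
    have "z + c *s v \<in> \<Omega>" if "c \<in> cball 0 1" for c
    proof -
      have "norm (c *s v) \<le> norm v" using that by (simp add: norm_vector_smult mult_left_le_one_le)
      with True B show ?thesis by (auto simp: dist_norm)
    qed
    then have "(\<lambda>c. f (z + c *s v)) holomorphic_on cball 0 1"
      by (rule holomorphic_several_line[OF f])
    from circle_mean_value[OF this] show ?thesis
      by (simp add: rot_def)
  qed (simp add: \<phi>)
  then have "(LINT v|lborel. \<phi> (norm v) *\<^sub>R f (z + v)) = (LINT v::complex^'n|lborel. \<phi> (norm v) *\<^sub>R f z)"
    by (subst integral_circle_average[OF int(1)]) (simp del: integral_scaleR_right)
  also have "\<dots> = (LINT v::complex^'n|lborel. \<phi> (norm v)) *\<^sub>R f z"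
    using int(2) by (rule integral_scaleR_left)
  finally show ?thesis .
qed

lemma holomorphic_several_zeros_null_ball:
  assumes f: "holomorphic_several f \<Omega>" and B: "ball a r \<subseteq> \<Omega>" and fa: "f a \<noteq> 0"
  shows "{z \<in> ball a r. f z = 0} \<in> null_sets lborel"
proof -
  let ?Z = "{z \<in> ball a r. f z = 0}"
  have cont: "continuous_on (ball a r) f"
    using f B by (meson holomorphic_several_imp_continuous_on holomorphic_several_subset)
  have "open (ball a r \<inter> f -` (-{0}))"
    by (rule continuous_open_preimage[OF cont]) auto
  moreover have "?Z = ball a r - (ball a r \<inter> f -` (-{0}))" by auto
  ultimately have Z[measurable]: "?Z \<in> sets borel" by (metis borel_open open_ball sets.Diff)
  have F: "(\<lambda>v. indicator ?Z (a + v) :: ennreal) \<in> borel_measurable borel"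
    by (rule measurable_compose[OF _ borel_measurable_indicator[OF Z]]) simp
  have "(\<integral>\<^sup>+t. indicator ?Z (a + rot t v) \<partial>unit_interval_measure) = 0" for v
  proof (cases "norm v < r")
    case True
    let ?S = "{c. a + c *s v \<in> ball a r}"
    have "?S = (\<lambda>c. c *s v) -` ball 0 r" by (auto simp: dist_norm)
    moreover have "linear (\<lambda>c. c *s v)" by (rule linearI; auto simp: vec_eq_iff algebra_simps)
    ultimately have conn: "connected ?S"
      by (simp add: convex_linear_vimage convex_connected)
    have "open ?S"
      unfolding mem_ball by (intro open_Collect_less continuous_intros)
    have sub: "cball 0 1 \<subseteq> ?S"
    proof
      fix c :: complex assume "c \<in> cball 0 1"
      then have "norm (c *s v) \<le> norm v" by (simp add: norm_vector_smult mult_left_le_one_le)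
      with True show "c \<in> ?S" by (simp add: dist_norm)
    qed
    have "(\<lambda>c. f (a + c *s v)) holomorphic_on ?S"
      using B by (intro holomorphic_several_line[OF f]) auto
    from AE_circle_nonzero[OF this \<open>open ?S\<close> conn sub]
    have "AE t in unit_interval_measure. f (a + rot t v) \<noteq> 0"
      using fa by (simp add: rot_def)
    then have "AE t in unit_interval_measure. indicator ?Z (a + rot t v) = (0 :: ennreal)"
      by eventually_elim auto
    then have "(\<integral>\<^sup>+t. indicator ?Z (a + rot t v) \<partial>unit_interval_measure) = (\<integral>\<^sup>+t. 0 \<partial>unit_interval_measure)"
      by (rule nn_integral_cong_AE)
    then show ?thesis by simp
  qed (simp add: dist_norm)
  then have "(\<integral>\<^sup>+v. indicator ?Z (a + v) \<partial>lborel) = 0"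
    by (subst nn_integral_circle_average[OF F]) simp
  then have "(\<integral>\<^sup>+v. indicator ?Z v \<partial>lborel) = 0"
    by (subst (asm) nn_integral_lborel_translate[OF borel_measurable_indicator[OF Z]])
  then have "emeasure lborel ?Z = 0" using Z by simp
  then show ?thesis using Z by (intro null_setsI) simp_all
qed

proposition holomorphic_several_zeros_null:
  assumes f: "holomorphic_several f \<Omega>" and \<Omega>: "open \<Omega>" "connected \<Omega>" and a: "a \<in> \<Omega>" "f a \<noteq> 0"
  shows "{z \<in> \<Omega>. f z = 0} \<in> null_sets lborel"
proof -
  let ?N = "\<lambda>a r. {z \<in> ball a r. f z = 0} \<in> null_sets lborel"
  define U where "U = {a \<in> \<Omega>. \<exists>r>0. ?N a r}"
  have N: "?N b s" if "?N a r" "ball b s \<subseteq> ball a r" "ball b s \<subseteq> \<Omega>" for a b r s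
  proof (cases "\<exists>c\<in>ball b s. f c \<noteq> 0")
    case True
    have cont: "continuous_on (ball b s) f"
      using f that by (meson holomorphic_several_imp_continuous_on holomorphic_several_subset)
    have "open (ball b s \<inter> f -` (-{0}))"
      by (rule continuous_open_preimage[OF cont]) auto
    moreover have "{z \<in> ball b s. f z = 0} = ball b s - (ball b s \<inter> f -` (-{0}))" by auto
    ultimately have "{z \<in> ball b s. f z = 0} \<in> sets borel" by (metis borel_open open_ball sets.Diff)
    then show ?thesis using that by (intro null_sets_subset[OF that(1)]) auto
  next
    case False
    then have "{z \<in> ball b s. f z = 0} = ball b s" by auto
    then show ?thesis using that by (intro null_sets_subset[OF that(1)]) auto
  qed
  have ex: "\<exists>c\<in>ball b s. f c \<noteq> 0" if "?N b s" "s > 0" for b s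
  proof (rule ccontr)
    assume "\<not> ?thesis"
    then have "{z \<in> ball b s. f z = 0} = ball b s" by auto
    with that(1) have "negligible (ball b s)"
      by (simp add: negligible_iff_null_sets null_sets_completionI)
    then show False using that(2) open_not_negligible[of "ball b s"] by auto
  qed
  have near: "\<exists>s>0. ball b s \<subseteq> \<Omega> \<and> (\<forall>x\<in>ball b s. x \<in> U \<longrightarrow> (\<exists>t>0. ball b t \<subseteq> U))" if b: "b \<in> \<Omega>" for b
  proof -
    obtain r where r: "r > 0" "ball b r \<subseteq> \<Omega>" using b \<Omega> open_contains_ball by blast
    have step: "\<exists>t>0. ball b t \<subseteq> U" if x: "x \<in> ball b (r/3)" "x \<in> U" for x
    proof -
      obtain s where s: "s > 0" "?N x s" using x by (auto simp: U_def)
      define s' where "s' = min s (r/12)"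
      have s': "s' > 0" "s' \<le> r/12" "ball x s' \<subseteq> ball x s" using s r by (auto simp: s'_def)
      have "ball x s' \<subseteq> ball b r"
        using x(1) s'(1,2) r(1) by (simp add: ball_subset_ball_iff dist_commute)
      then have "?N x s'" using r(2) by (intro N[OF s(2) s'(3)]) (rule subset_trans)
      then obtain c where c: "c \<in> ball x s'" "f c \<noteq> 0" using ex s'(1) by blast
      have "dist b c < 5*r/12" using c(1) x(1) s'(2) dist_triangle[of b c x] by (simp add: dist_commute)
      then have 1: "ball c (r/2) \<subseteq> ball b r" "ball b (r/24) \<subseteq> ball c (r/2)"
        using r(1) by (simp_all add: ball_subset_ball_iff dist_commute)
      then have Nc: "?N c (r/2)"
        using holomorphic_several_zeros_null_ball[OF f _ c(2)] r(2) by blast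
      have "y \<in> U" if y: "y \<in> ball b (r/24)" for y
      proof -
        have yc: "y \<in> ball c (r/2)" using y 1(2) by blast
        then obtain e where e: "e > 0" "ball y e \<subseteq> ball c (r/2)"
          using open_contains_ball[of "ball c (r/2)"] by blast
        then have "?N y e" by (intro N[OF Nc]) (use 1(1) r(2) in \<open>blast+\<close>)
        then show ?thesis unfolding U_def using e(1) 1(1) r(2) yc by blast
      qed
      then show ?thesis using r(1) by (intro exI[of _ "r/24"] conjI subsetI) simp_all
    qed
    show ?thesis
    proof (rule exI[of _ "r/3"], intro conjI ballI impI)
      show "r/3 > 0" using r by simp
      show "ball b (r/3) \<subseteq> \<Omega>" using r by (auto simp: subset_iff)
    qed (fact step)
  qed
  have "open U"
    unfolding open_contains_ball
  proof
    fix b assume b: "b \<in> U"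
    then have "b \<in> \<Omega>" by (simp add: U_def)
    then obtain s where s: "s > 0" "\<forall>x\<in>ball b s. x \<in> U \<longrightarrow> (\<exists>t>0. ball b t \<subseteq> U)"
      using near by metis
    then show "\<exists>e>0. ball b e \<subseteq> U" using b s(2)[rule_format, of b] by simp
  qed
  moreover have "open (\<Omega> - U)"
    unfolding open_contains_ball
  proof
    fix b assume b: "b \<in> \<Omega> - U"
    then have "b \<in> \<Omega>" by simp
    then obtain s where s: "s > 0" "ball b s \<subseteq> \<Omega>" "\<forall>x\<in>ball b s. x \<in> U \<longrightarrow> (\<exists>t>0. ball b t \<subseteq> U)"
      using near by metis
    have "x \<notin> U" if x: "x \<in> ball b s" for x
    proof
      assume "x \<in> U"
      then obtain t where t: "t > 0" "ball b t \<subseteq> U" using s(3) x by metis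
      from t(1) have "b \<in> ball b t" by simp
      with t(2) b show False by blast
    qed
    then show "\<exists>e>0. ball b e \<subseteq> \<Omega> - U" using s(1,2) by (intro exI[of _ s]) auto
  qed
  moreover have "a \<in> U"
    unfolding U_def using a \<Omega> holomorphic_several_zeros_null_ball[OF f _ a(2)] open_contains_ball by blast
  ultimately have U: "\<Omega> \<subseteq> U"
    using connectedD[OF \<Omega>(2), of U "\<Omega> - U"] a(1) by blast
  have "negligible {z \<in> \<Omega>. f z = 0}"
    unfolding locally_negligible_alt[of "{z \<in> \<Omega>. f z = 0}"]
  proof
    fix b assume b: "b \<in> {z \<in> \<Omega>. f z = 0}"
    then obtain r where r: "r > 0" "?N b r" using U by (auto simp: U_def)
    let ?V = "{z \<in> \<Omega>. f z = 0} \<inter> ball b r"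
    have "negligible ?V"
      by (rule negligible_subset[of "{z \<in> ball b r. f z = 0}"])
        (use r in \<open>auto simp: negligible_iff_null_sets null_sets_completionI\<close>)
    moreover have "openin (top_of_set {z \<in> \<Omega>. f z = 0}) ?V" by auto
    ultimately show "\<exists>U. openin (top_of_set {z \<in> \<Omega>. f z = 0}) U \<and> b \<in> U \<and> negligible U"
      using b r by (intro exI[of _ ?V]) auto
  qed
  moreover have "{z \<in> \<Omega>. f z = 0} \<in> sets borel"
  proof -
    have "open (\<Omega> \<inter> f -` (-{0}))"
      by (rule continuous_open_preimage[OF holomorphic_several_imp_continuous_on[OF f]]) (use \<Omega> in auto)
    moreover have "{z \<in> \<Omega>. f z = 0} = \<Omega> - (\<Omega> \<inter> f -` (-{0}))" by auto
    ultimately show ?thesis using \<Omega> by (metis borel_open sets.Diff)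
  qed
  ultimately show ?thesis
    by (auto simp: negligible_iff_null_sets null_sets_completion_iff)
qed

corollary holomorphic_several_identity:
  assumes f: "holomorphic_several f \<Omega>" and \<Omega>: "open \<Omega>" "connected \<Omega>"
    and U: "open U" "U \<noteq> {}" "U \<subseteq> \<Omega>" "\<And>z. z \<in> U \<Longrightarrow> f z = 0" and z: "z \<in> \<Omega>"
  shows "f z = 0"
proof (rule ccontr)
  assume "f z \<noteq> 0"
  then have "negligible {z \<in> \<Omega>. f z = 0}"
    using holomorphic_several_zeros_null[OF f \<Omega> z]
    by (simp add: negligible_iff_null_sets null_sets_completionI)
  then have "negligible U" by (rule negligible_subset) (use U in auto)
  then show False using open_not_negligible U by blast
qed

subsection \<open>Square-integrable functions and the Riesz representation theorem\<close>

definition L2 :: "'a measure \<Rightarrow> ('a \<Rightarrow> complex) set" where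
  "L2 M = {f \<in> borel_measurable M. integrable M (\<lambda>x. (cmod (f x))\<^sup>2)}"

definition l2_norm :: "'a measure \<Rightarrow> ('a \<Rightarrow> complex) \<Rightarrow> real" where
  "l2_norm M f = sqrt (LINT x|M. (cmod (f x))\<^sup>2)"

definition l2_inner :: "'a measure \<Rightarrow> ('a \<Rightarrow> complex) \<Rightarrow> ('a \<Rightarrow> complex) \<Rightarrow> complex" where
  "l2_inner M f g = (LINT x|M. f x * cnj (g x))"

lemma L2_measurable: "f \<in> L2 M \<Longrightarrow> f \<in> borel_measurable M"
  and L2_integrable: "f \<in> L2 M \<Longrightarrow> integrable M (\<lambda>x. (cmod (f x))\<^sup>2)"
  by (auto simp: L2_def)

lemma L2_zero [simp]: "(\<lambda>_. 0) \<in> L2 M"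
  by (simp add: L2_def)

lemma L2_cmult: "f \<in> L2 M \<Longrightarrow> (\<lambda>x. c * f x) \<in> L2 M"
  by (auto simp: L2_def norm_mult power_mult_distrib)

lemma L2_cnj:
  assumes "f \<in> L2 M" shows "(\<lambda>x. cnj (f x)) \<in> L2 M"
proof -
  have "cnj \<in> borel_measurable borel"
    by (intro borel_measurable_continuous_onI continuous_intros)
  then have "(\<lambda>x. cnj (f x)) \<in> borel_measurable M"
    by (rule measurable_compose[OF L2_measurable[OF assms]])
  then show ?thesis using assms by (simp add: L2_def)
qed

lemma integrable_norm_mult_L2:
  assumes "f \<in> L2 M" "g \<in> L2 M"
  shows "integrable M (\<lambda>x. cmod (f x) * cmod (g x))"
proof (rule Bochner_Integration.integrable_bound)
  show "integrable M (\<lambda>x. (cmod (f x))\<^sup>2 + (cmod (g x))\<^sup>2)"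
    using assms by (simp add: L2_def)
  have [measurable]: "f \<in> borel_measurable M" "g \<in> borel_measurable M"
    using assms by (auto simp: L2_def)
  show "(\<lambda>x. cmod (f x) * cmod (g x)) \<in> borel_measurable M"
    by measurable
  have "a * b \<le> a\<^sup>2 + b\<^sup>2" for a b :: real
    using sum_squares_bound[of a b] zero_le_power2[of a] zero_le_power2[of b] by linarith
  then show "AE x in M. norm (cmod (f x) * cmod (g x)) \<le> norm ((cmod (f x))\<^sup>2 + (cmod (g x))\<^sup>2)"
    by simp
qed

lemma integrable_mult_L2:
  assumes "f \<in> L2 M" "g \<in> L2 M"
  shows "integrable M (\<lambda>x. f x * g x)"
  by (rule Bochner_Integration.integrable_bound[OF integrable_norm_mult_L2[OF assms]])
    (use assms in \<open>auto simp: L2_def norm_mult\<close>)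

lemma integrable_inner_L2:
  assumes "f \<in> L2 M" "g \<in> L2 M"
  shows "integrable M (\<lambda>x. f x * cnj (g x))"
  using integrable_mult_L2[OF assms(1) L2_cnj[OF assms(2)]] .

lemma L2_add:
  assumes "f \<in> L2 M" "g \<in> L2 M"
  shows "(\<lambda>x. f x + g x) \<in> L2 M"
proof -
  have "integrable M (\<lambda>x. 2 * (cmod (f x))\<^sup>2 + 2 * (cmod (g x))\<^sup>2)"
    using assms by (simp add: L2_def)
  then have "integrable M (\<lambda>x. (cmod (f x + g x))\<^sup>2)"
  proof (rule Bochner_Integration.integrable_bound)
    have [measurable]: "f \<in> borel_measurable M" "g \<in> borel_measurable M"
      using assms by (auto simp: L2_def)
    show "(\<lambda>x. (cmod (f x + g x))\<^sup>2) \<in> borel_measurable M"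
      by measurable
    have "(cmod (a + b))\<^sup>2 \<le> 2 * (cmod a)\<^sup>2 + 2 * (cmod b)\<^sup>2" for a b
    proof -
      have "(cmod (a + b))\<^sup>2 \<le> (cmod a + cmod b)\<^sup>2" by (intro power_mono norm_triangle_ineq) simp
      also have "\<dots> \<le> 2 * (cmod a)\<^sup>2 + 2 * (cmod b)\<^sup>2"
        using sum_squares_bound[of "cmod a" "cmod b"] by (simp add: power2_sum)
      finally show ?thesis .
    qed
    then show "AE x in M. norm ((cmod (f x + g x))\<^sup>2) \<le> norm (2 * (cmod (f x))\<^sup>2 + 2 * (cmod (g x))\<^sup>2)"
      by simp
  qed
  then show ?thesis using assms by (auto simp: L2_def)
qed

lemma L2_diff: "f \<in> L2 M \<Longrightarrow> g \<in> L2 M \<Longrightarrow> (\<lambda>x. f x - g x) \<in> L2 M"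
  using L2_add[of f M "\<lambda>x. -1 * g x"] L2_cmult[of g M "-1"] by simp

lemma l2_norm_nonneg [simp]: "l2_norm M f \<ge> 0"
  by (simp add: l2_norm_def)

lemma l2_norm_power2: "(l2_norm M f)\<^sup>2 = (LINT x|M. (cmod (f x))\<^sup>2)"
  by (simp add: l2_norm_def)

lemma l2_norm_cmult: "l2_norm M (\<lambda>x. c * f x) = cmod c * l2_norm M f"
  by (simp add: l2_norm_def norm_mult power_mult_distrib real_sqrt_mult)

lemma l2_norm_minus_commute: "l2_norm M (\<lambda>x. f x - g x) = l2_norm M (\<lambda>x. g x - f x)"
  by (simp add: l2_norm_def norm_minus_commute)

lemma l2_inner_cmult_left: "l2_inner M (\<lambda>x. c * f x) g = c * l2_inner M f g"
  by (simp add: l2_inner_def mult.assoc)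

lemma l2_inner_commute: "l2_inner M g f = cnj (l2_inner M f g)"
proof -
  have "g x * cnj (f x) = cnj (f x * cnj (g x))" for x by simp
  then show ?thesis unfolding l2_inner_def by (simp only: Bochner_Integration.integral_cnj)
qed

lemma l2_inner_diff_right:
  "f \<in> L2 M \<Longrightarrow> g \<in> L2 M \<Longrightarrow> h \<in> L2 M \<Longrightarrow>
    l2_inner M h (\<lambda>x. f x - g x) = l2_inner M h f - l2_inner M h g"
  by (simp add: l2_inner_def right_diff_distrib integrable_inner_L2)

lemma l2_inner_same: "l2_inner M f f = of_real ((l2_norm M f)\<^sup>2)"
  unfolding l2_inner_def l2_norm_power2 complex_norm_square[symmetric]
  by (subst integral_complex_of_real[symmetric]) simp

lemma integral_norm_mult_le_l2:
  assumes f: "f \<in> L2 M" and g: "g \<in> L2 M"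
  shows "(LINT x|M. cmod (f x) * cmod (g x)) \<le> l2_norm M f * l2_norm M g"
proof -
  define A B C where "A = (LINT x|M. (cmod (f x))\<^sup>2)" and "B = (LINT x|M. (cmod (g x))\<^sup>2)"
    and "C = (LINT x|M. cmod (f x) * cmod (g x))"
  have nn: "A \<ge> 0" "B \<ge> 0" "C \<ge> 0" by (auto simp: A_def B_def C_def)
  have q: "0 \<le> A - 2 * t * C + t\<^sup>2 * B" for t
  proof -
    have "0 \<le> (LINT x|M. (cmod (f x) - t * cmod (g x))\<^sup>2)" by simp
    also have "\<dots> = (LINT x|M. (cmod (f x))\<^sup>2 - 2 * t * (cmod (f x) * cmod (g x)) + t\<^sup>2 * (cmod (g x))\<^sup>2)"
      by (rule Bochner_Integration.integral_cong) (auto simp: power2_diff power_mult_distrib algebra_simps)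
    also have "\<dots> = A - 2 * t * C + t\<^sup>2 * B"
      using f g integrable_norm_mult_L2[OF f g] by (simp add: A_def B_def C_def L2_def)
    finally show ?thesis .
  qed
  have "C\<^sup>2 \<le> A * B"
  proof (cases "B = 0")
    case True
    have "C = 0"
    proof (rule ccontr)
      assume "C \<noteq> 0"
      then have "0 \<le> A - 2 * ((A + 1) / (2 * C)) * C" using q[of "(A + 1) / (2 * C)"] True by simp
      then show False using \<open>C \<noteq> 0\<close> by simp
    qed
    then show ?thesis using True by simp
  next
    case False
    have "0 \<le> A - 2 * (C / B) * C + (C / B)\<^sup>2 * B" by (rule q)
    also have "\<dots> = A - C\<^sup>2 / B" using False by (simp add: power2_eq_square field_simps)
    finally show ?thesis using False nn by (simp add: field_simps)
  qed
  then have "sqrt (C\<^sup>2) \<le> sqrt (A * B)" by (rule real_sqrt_le_mono)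
  then show ?thesis using nn by (simp add: real_sqrt_mult l2_norm_def A_def B_def C_def)
qed

lemma norm_l2_inner_le:
  assumes f: "f \<in> L2 M" and g: "g \<in> L2 M"
  shows "cmod (l2_inner M f g) \<le> l2_norm M f * l2_norm M g"
proof -
  have "cmod (l2_inner M f g) \<le> (LINT x|M. cmod (f x * cnj (g x)))"
    unfolding l2_inner_def by (rule integral_norm_bound)
  also have "\<dots> \<le> l2_norm M f * l2_norm M g"
    using integral_norm_mult_le_l2[OF f g] by (simp add: norm_mult)
  finally show ?thesis .
qed

lemma l2_norm_add_power2:
  assumes f: "f \<in> L2 M" and g: "g \<in> L2 M"
  shows "(l2_norm M (\<lambda>x. f x + g x))\<^sup>2 = (l2_norm M f)\<^sup>2 + 2 * Re (l2_inner M f g) + (l2_norm M g)\<^sup>2"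
proof -
  define h where "h x = Re (f x * cnj (g x))" for x
  have "(cmod (a + b))\<^sup>2 = (cmod a)\<^sup>2 + 2 * Re (a * cnj b) + (cmod b)\<^sup>2" for a b
    unfolding cmod_power2 plus_complex.sel times_complex.sel cnj.sel by algebra
  then have key: "(cmod (f x + g x))\<^sup>2 = (cmod (f x))\<^sup>2 + 2 * h x + (cmod (g x))\<^sup>2" for x
    unfolding h_def .
  have h: "integrable M h" "(LINT x|M. h x) = Re (l2_inner M f g)"
    using integrable_Re[OF integrable_inner_L2[OF f g]] Bochner_Integration.integral_Re[OF integrable_inner_L2[OF f g]]
    unfolding h_def[abs_def] l2_inner_def by blast+
  show ?thesis
    unfolding l2_norm_power2 key h(2)[symmetric] using h(1) f g by (simp add: L2_integrable)
qed

lemma l2_norm_add_le: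
  assumes f: "f \<in> L2 M" and g: "g \<in> L2 M"
  shows "l2_norm M (\<lambda>x. f x + g x) \<le> l2_norm M f + l2_norm M g"
proof (rule power2_le_imp_le)
  have "Re (l2_inner M f g) \<le> l2_norm M f * l2_norm M g"
    using complex_Re_le_cmod norm_l2_inner_le[OF f g] by (rule order_trans)
  then show "(l2_norm M (\<lambda>x. f x + g x))\<^sup>2 \<le> (l2_norm M f + l2_norm M g)\<^sup>2"
    by (simp add: l2_norm_add_power2[OF f g] power2_sum)
qed simp

lemma l2_norm_diff_le:
  assumes "f \<in> L2 M" "g \<in> L2 M"
  shows "l2_norm M f \<le> l2_norm M g + l2_norm M (\<lambda>x. f x - g x)"
  using l2_norm_add_le[OF assms(2) L2_diff[OF assms]] by simp

lemma l2_norm_parallelogram: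
  assumes f: "f \<in> L2 M" and g: "g \<in> L2 M"
  shows "(l2_norm M (\<lambda>x. f x + g x))\<^sup>2 + (l2_norm M (\<lambda>x. f x - g x))\<^sup>2 = 2 * (l2_norm M f)\<^sup>2 + 2 * (l2_norm M g)\<^sup>2"
proof -
  have "l2_inner M f (\<lambda>x. -1 * g x) = - l2_inner M f g"
    by (simp add: l2_inner_def)
  then show ?thesis
    using l2_norm_add_power2[OF f g] l2_norm_add_power2[OF f L2_cmult[OF g, of "-1"]] l2_norm_cmult[of M "-1" g]
    by simp
qed

lemma quadratic_nonneg_imp_linear_zero:
  fixes a b :: real
  assumes "a \<ge> 0" and q: "\<And>t. 0 \<le> t\<^sup>2 * a + 2 * t * b"
  shows "b = 0"
proof (rule ccontr)
  assume "b \<noteq> 0"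
  have "0 \<le> (- b / (a + 1))\<^sup>2 * a + 2 * (- b / (a + 1)) * b" by (rule q)
  also have "\<dots> = - (b\<^sup>2 * (a + 2)) / (a + 1)\<^sup>2"
  proof -
    have "a + 1 \<noteq> 0" using \<open>a \<ge> 0\<close> by simp
    then have "2 * (- b / (a + 1)) * b = - (2 * b\<^sup>2 * (a + 1)) / (a + 1)\<^sup>2"
      by (simp add: power2_eq_square)
    then show ?thesis by (simp add: power_divide add_divide_distrib[symmetric] ring_distribs)
  qed
  also have "\<dots> < 0" using \<open>a \<ge> 0\<close> \<open>b \<noteq> 0\<close> by simp
  finally show False by simp
qed

definition l2_Cauchy :: "'a measure \<Rightarrow> (nat \<Rightarrow> 'a \<Rightarrow> complex) \<Rightarrow> bool" where
  "l2_Cauchy M X \<longleftrightarrow> (\<forall>e>0. \<exists>N. \<forall>m\<ge>N. \<forall>n\<ge>N. l2_norm M (\<lambda>x. X m x - X n x) < e)"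

lemma l2_Cauchy_pointwise_limit:
  assumes X: "\<And>n. X n \<in> L2 M" "l2_Cauchy M X" and g: "\<And>x. x \<in> space M \<Longrightarrow> (\<lambda>n. X n x) \<longlonglongrightarrow> g x"
  shows "g \<in> L2 M" "(\<lambda>n. l2_norm M (\<lambda>x. X n x - g x)) \<longlonglongrightarrow> 0"
proof -
  have X_meas [measurable]: "X n \<in> borel_measurable M" for n using X(1) by (rule L2_measurable)
  have g_meas [measurable]: "g \<in> borel_measurable M"
    by (rule borel_measurable_LIMSEQ_metric[OF X_meas g])
  have fatou: "(\<integral>\<^sup>+x. ennreal ((cmod (X n x - g x))\<^sup>2) \<partial>M) \<le> ennreal (e\<^sup>2)"
    if e: "e > 0" and N: "\<And>m. m \<ge> N \<Longrightarrow> l2_norm M (\<lambda>x. X n x - X m x) < e" for n N e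
  proof -
    have "(\<integral>\<^sup>+x. ennreal ((cmod (X n x - X m x))\<^sup>2) \<partial>M) \<le> ennreal (e\<^sup>2)" if "m \<ge> N" for m
    proof -
      have "(\<integral>\<^sup>+x. ennreal ((cmod (X n x - X m x))\<^sup>2) \<partial>M) = ennreal ((l2_norm M (\<lambda>x. X n x - X m x))\<^sup>2)"
        unfolding l2_norm_power2 by (rule nn_integral_eq_integral[OF L2_integrable[OF L2_diff[OF X(1) X(1)]]]) simp
      also have "\<dots> \<le> ennreal (e\<^sup>2)"
        using N[OF that] by (intro ennreal_leI power_mono) simp_all
      finally show ?thesis .
    qed
    then have ev: "\<forall>\<^sub>F m in sequentially. (\<integral>\<^sup>+x. ennreal ((cmod (X n x - X m x))\<^sup>2) \<partial>M) \<le> ennreal (e\<^sup>2)"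
      unfolding eventually_sequentially by blast
    have "(\<integral>\<^sup>+x. ennreal ((cmod (X n x - g x))\<^sup>2) \<partial>M)
        = (\<integral>\<^sup>+x. liminf (\<lambda>m. ennreal ((cmod (X n x - X m x))\<^sup>2)) \<partial>M)"
    proof (rule nn_integral_cong)
      fix x assume "x \<in> space M"
      then have "(\<lambda>m. ennreal ((cmod (X n x - X m x))\<^sup>2)) \<longlonglongrightarrow> ennreal ((cmod (X n x - g x))\<^sup>2)"
        by (intro tendsto_intros tendsto_ennrealI g)
      then show "ennreal ((cmod (X n x - g x))\<^sup>2) = liminf (\<lambda>m. ennreal ((cmod (X n x - X m x))\<^sup>2))"
        by (metis lim_imp_Liminf sequentially_bot)
    qed
    also have "\<dots> \<le> liminf (\<lambda>m. \<integral>\<^sup>+x. ennreal ((cmod (X n x - X m x))\<^sup>2) \<partial>M)"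
      by (rule nn_integral_liminf) measurable
    also have "\<dots> \<le> liminf (\<lambda>m. ennreal (e\<^sup>2))"
      by (rule Liminf_mono[OF ev])
    also have "\<dots> = ennreal (e\<^sup>2)" by (simp add: Liminf_const)
    finally show ?thesis .
  qed
  have close: "(\<lambda>x. X n x - g x) \<in> L2 M \<and> l2_norm M (\<lambda>x. X n x - g x) \<le> e"
    if e: "e > 0" and N: "\<And>m. m \<ge> N \<Longrightarrow> l2_norm M (\<lambda>x. X n x - X m x) < e" for n N e
  proof
    have "integrable M (\<lambda>x. (cmod (X n x - g x))\<^sup>2)"
      by (rule integrableI_bounded) (use fatou[OF that] in \<open>auto simp: top_unique less_top[symmetric]\<close>)
    then show *: "(\<lambda>x. X n x - g x) \<in> L2 M" by (auto simp: L2_def)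
    show "l2_norm M (\<lambda>x. X n x - g x) \<le> e"
    proof (rule power2_le_imp_le)
      show "(l2_norm M (\<lambda>x. X n x - g x))\<^sup>2 \<le> e\<^sup>2"
        using fatou[OF that] nn_integral_eq_integral[OF L2_integrable[OF *]] unfolding l2_norm_power2 by simp
    qed (use e in simp)
  qed
  have ex: "\<exists>N. \<forall>n\<ge>N. (\<lambda>x. X n x - g x) \<in> L2 M \<and> l2_norm M (\<lambda>x. X n x - g x) \<le> e" if e: "e > 0" for e
  proof -
    obtain N where "\<forall>m\<ge>N. \<forall>n\<ge>N. l2_norm M (\<lambda>x. X m x - X n x) < e"
      using X(2) e unfolding l2_Cauchy_def by blast
    then show ?thesis using close[OF e] by blast
  qed
  from ex[of 1] obtain N where "(\<lambda>x. X N x - g x) \<in> L2 M" by auto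
  from L2_diff[OF X(1)[of N] this] show "g \<in> L2 M" by simp
  show "(\<lambda>n. l2_norm M (\<lambda>x. X n x - g x)) \<longlonglongrightarrow> 0"
  proof (rule LIMSEQ_I)
    fix e :: real assume "e > 0"
    with ex[of "e/2"] obtain N where "\<forall>n\<ge>N. l2_norm M (\<lambda>x. X n x - g x) \<le> e/2" by auto
    with \<open>e > 0\<close> show "\<exists>N. \<forall>n\<ge>N. norm (l2_norm M (\<lambda>x. X n x - g x) - 0) < e"
      by (intro exI[of _ N]) auto
  qed
qed

locale l2_subspace =
  fixes M :: "'a measure" and H :: "('a \<Rightarrow> complex) set"
  assumes subset_L2: "H \<subseteq> L2 M" and zero: "(\<lambda>_. 0) \<in> H"
    and add: "f \<in> H \<Longrightarrow> g \<in> H \<Longrightarrow> (\<lambda>x. f x + g x) \<in> H"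
    and cmult: "f \<in> H \<Longrightarrow> (\<lambda>x. c * f x) \<in> H"
    and complete: "(\<And>n. X n \<in> H) \<Longrightarrow> l2_Cauchy M X \<Longrightarrow> \<exists>g\<in>H. (\<lambda>n. l2_norm M (\<lambda>x. X n x - g x)) \<longlonglongrightarrow> 0"
begin

lemma diff: "f \<in> H \<Longrightarrow> g \<in> H \<Longrightarrow> (\<lambda>x. f x - g x) \<in> H"
  using add[of f "\<lambda>x. -1 * g x"] cmult[of g "-1"] by simp

lemma inL2: "f \<in> H \<Longrightarrow> f \<in> L2 M" using subset_L2 by blast

theorem riesz:
  assumes \<phi>_add: "\<And>f g. f \<in> H \<Longrightarrow> g \<in> H \<Longrightarrow> \<phi> (\<lambda>x. f x + g x) = \<phi> f + \<phi> g"
    and \<phi>_cmult: "\<And>c f. f \<in> H \<Longrightarrow> \<phi> (\<lambda>x. c * f x) = c * \<phi> f"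
    and \<phi>_bound: "\<And>f. f \<in> H \<Longrightarrow> cmod (\<phi> f) \<le> C * l2_norm M f"
  shows "\<exists>g\<in>H. \<forall>f\<in>H. \<phi> f = l2_inner M f g"
proof -
  define J where "J f = (l2_norm M f)\<^sup>2 - 2 * Re (\<phi> f)" for f
  have bdd: "J f \<ge> - C\<^sup>2" if "f \<in> H" for f
  proof -
    have "Re (\<phi> f) \<le> C * l2_norm M f" using complex_Re_le_cmod \<phi>_bound[OF that] by (rule order_trans)
    moreover have "(l2_norm M f)\<^sup>2 - 2 * (C * l2_norm M f) + C\<^sup>2 = (l2_norm M f - C)\<^sup>2"
      by (simp add: power2_diff)
    then have "0 \<le> (l2_norm M f)\<^sup>2 - 2 * (C * l2_norm M f) + C\<^sup>2" by simp
    ultimately show ?thesis by (simp add: J_def)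
  qed
  define m where "m = Inf (J ` H)"
  have bb: "bdd_below (J ` H)" using bdd by (intro bdd_belowI[of _ "- C\<^sup>2"]) auto
  have m: "m \<le> J f" if "f \<in> H" for f unfolding m_def using bb that by (intro cInf_lower) auto
  have "\<exists>f\<in>H. J f < m + 1 / real (Suc n)" for n
    using cInf_lessD[of "J ` H" "m + 1 / real (Suc n)"] zero by (auto simp: m_def)
  then obtain X where X: "\<And>n. X n \<in> H" "\<And>n. J (X n) < m + 1 / real (Suc n)" by metis
  have par: "(l2_norm M (\<lambda>x. f x - g x))\<^sup>2 \<le> 2 * (J f - m) + 2 * (J g - m)" if fg: "f \<in> H" "g \<in> H" for f g
  proof -
    define h where "h = (\<lambda>x. (1/2) * (f x + g x))"
    have h: "h \<in> H" unfolding h_def by (rule cmult[OF add[OF fg]])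
    have "\<phi> h = (1/2) * (\<phi> f + \<phi> g)"
      unfolding h_def \<phi>_cmult[OF add[OF fg]] \<phi>_add[OF fg] ..
    then have "Re (\<phi> h) = (Re (\<phi> f) + Re (\<phi> g)) / 2" by (simp only:) simp
    moreover have "l2_norm M h = (1/2) * l2_norm M (\<lambda>x. f x + g x)"
      unfolding h_def l2_norm_cmult by simp
    ultimately have "4 * J h = (l2_norm M (\<lambda>x. f x + g x))\<^sup>2 - 4 * Re (\<phi> f) - 4 * Re (\<phi> g)"
      unfolding J_def by (simp only: power_mult_distrib) (simp add: power_divide field_simps)
    with m[OF h] l2_norm_parallelogram[OF inL2[OF fg(1)] inL2[OF fg(2)]] show ?thesis
      by (simp add: J_def)
  qed
  have "l2_Cauchy M X"
    unfolding l2_Cauchy_def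
  proof (intro allI impI)
    fix e :: real assume "e > 0"
    then obtain N where N: "1 / real (Suc N) < e\<^sup>2 / 4"
      using nat_approx_posE[of "e\<^sup>2 / 4"] by (metis divide_pos_pos zero_less_numeral zero_less_power)
    have "l2_norm M (\<lambda>x. X k x - X n x) < e" if "k \<ge> N" "n \<ge> N" for k n
    proof (rule power2_less_imp_less)
      have "J (X j) - m < e\<^sup>2 / 4" if "j \<ge> N" for j
        using X(2)[of j] N that frac_le[of 1 1 "real (Suc N)" "real (Suc j)"] by simp
      from this[OF \<open>k \<ge> N\<close>] this[OF \<open>n \<ge> N\<close>] par[OF X(1)[of k] X(1)[of n]]
      show "(l2_norm M (\<lambda>x. X k x - X n x))\<^sup>2 < e\<^sup>2" by simp
    qed (use \<open>e > 0\<close> in simp)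
    then show "\<exists>N. \<forall>m\<ge>N. \<forall>n\<ge>N. l2_norm M (\<lambda>x. X m x - X n x) < e" by blast
  qed
  then obtain g where g: "g \<in> H" "(\<lambda>n. l2_norm M (\<lambda>x. X n x - g x)) \<longlonglongrightarrow> 0"
    using complete X(1) by metis
  have "(\<lambda>n. l2_norm M (X n)) \<longlonglongrightarrow> l2_norm M g"
  proof (rule LIM_zero_cancel, rule Lim_null_comparison[OF _ g(2)])
    show "\<forall>\<^sub>F n in sequentially. norm (l2_norm M (X n) - l2_norm M g) \<le> l2_norm M (\<lambda>x. X n x - g x)"
      using l2_norm_diff_le[OF inL2[OF X(1)] inL2[OF g(1)]] l2_norm_diff_le[OF inL2[OF g(1)] inL2[OF X(1)]]
      by (intro always_eventually allI) (simp add: abs_le_iff l2_norm_minus_commute[of M g] algebra_simps)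
  qed
  moreover have "(\<lambda>n. \<phi> (X n)) \<longlonglongrightarrow> \<phi> g"
  proof (rule LIM_zero_cancel, rule Lim_null_comparison)
    have "\<phi> (\<lambda>x. X n x - g x) = \<phi> (X n) - \<phi> g" for n
      using \<phi>_add[OF X(1)[of n] cmult[OF g(1), of "-1"]] \<phi>_cmult[OF g(1), of "-1"] by simp
    then show "\<forall>\<^sub>F n in sequentially. norm (\<phi> (X n) - \<phi> g) \<le> C * l2_norm M (\<lambda>x. X n x - g x)"
      using \<phi>_bound[OF diff[OF X(1) g(1)]] by (intro always_eventually allI) metis
    show "(\<lambda>n. C * l2_norm M (\<lambda>x. X n x - g x)) \<longlonglongrightarrow> 0"
      using tendsto_mult_right_zero[OF g(2)] .
  qed
  ultimately have "(\<lambda>n. J (X n)) \<longlonglongrightarrow> J g" unfolding J_def by (intro tendsto_intros)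
  moreover have "(\<lambda>n. m + 1 / real (Suc n)) \<longlonglongrightarrow> m + 0"
    by (intro tendsto_intros LIMSEQ_Suc lim_1_over_n)
  ultimately have "J g \<le> m"
    using X(2) by (intro LIMSEQ_le[of "\<lambda>n. J (X n)" "J g" "\<lambda>n. m + 1 / real (Suc n)"]) (auto intro: less_imp_le)
  then have min: "J g \<le> J f" if "f \<in> H" for f using m that by force
  have re: "Re (\<phi> h) = Re (l2_inner M h g)" if h: "h \<in> H" for h
  proof -
    have "Re (l2_inner M h g) - Re (\<phi> h) = 0"
    proof (rule quadratic_nonneg_imp_linear_zero)
      show "0 \<le> (l2_norm M h)\<^sup>2" by simp
      fix t :: real
      have th: "(\<lambda>x. of_real t * h x) \<in> H" using cmult[OF h] .
      have "J g \<le> J (\<lambda>x. of_real t * h x + g x)" using min[OF add[OF th g(1)]] .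
      also have "\<dots> = J g + (t\<^sup>2 * (l2_norm M h)\<^sup>2 + 2 * t * (Re (l2_inner M h g) - Re (\<phi> h)))"
        unfolding J_def l2_norm_add_power2[OF inL2[OF th] inL2[OF g(1)]] l2_norm_cmult l2_inner_cmult_left
          \<phi>_add[OF th g(1)] \<phi>_cmult[OF h]
        by (simp add: power_mult_distrib algebra_simps)
      finally show "0 \<le> t\<^sup>2 * (l2_norm M h)\<^sup>2 + 2 * t * (Re (l2_inner M h g) - Re (\<phi> h))" by simp
    qed
    then show ?thesis by simp
  qed
  have "\<phi> h = l2_inner M h g" if h: "h \<in> H" for h
  proof (rule complex_eqI)
    show "Re (\<phi> h) = Re (l2_inner M h g)" by (rule re[OF h])
    show "Im (\<phi> h) = Im (l2_inner M h g)"
      using re[OF cmult[OF h, of "\<i>"]] by (simp add: \<phi>_cmult[OF h] l2_inner_cmult_left)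
  qed
  with g(1) show ?thesis by blast
qed

lemma riesz_bound:
  assumes e: "e \<in> H" and "\<And>f. f \<in> H \<Longrightarrow> cmod (l2_inner M f e) \<le> C * l2_norm M f" "C \<ge> 0"
  shows "l2_norm M e \<le> C"
proof (cases "l2_norm M e = 0")
  case False
  then have "l2_norm M e > 0" using l2_norm_nonneg[of M e] by linarith
  moreover have "l2_norm M e * l2_norm M e \<le> C * l2_norm M e"
    using assms(2)[OF e] by (simp add: l2_inner_same power2_eq_square norm_mult)
  ultimately show ?thesis by simp
qed (use assms in simp)

end

lemma integrable_lborel_translate:
  fixes f :: "'a::euclidean_space \<Rightarrow> 'b::{banach, second_countable_topology}"
  assumes "integrable lborel f"
  shows "integrable lborel (\<lambda>x. f (c + x))" "(LINT x|lborel. f (c + x)) = integral\<^sup>L lborel f"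
proof -
  have [measurable]: "f \<in> borel_measurable borel" using assms by auto
  show "integrable lborel (\<lambda>x. f (c + x))"
    using assms by (subst (asm) lborel_distr_plus[of c, symmetric], subst (asm) integrable_distr_eq) simp_all
  show "(LINT x|lborel. f (c + x)) = integral\<^sup>L lborel f"
    by (subst (2) lborel_distr_plus[of c, symmetric], subst integral_distr) simp_all
qed

lemma has_derivative_quadratic_remainder:
  assumes f': "bounded_linear f'" and S: "open S" "x \<in> S"
    and le: "\<And>y. y \<in> S \<Longrightarrow> norm (f y - f x - f' (y - x)) \<le> C * (norm (y - x))\<^sup>2"
  shows "(f has_derivative f') (at x)"
  unfolding has_derivative_at_alt
proof (intro conjI allI impI)
  show "bounded_linear f'" by fact
  fix e :: real assume "e > 0"
  obtain d where d: "d > 0" "ball x d \<subseteq> S" using S open_contains_ball by blast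
  define d' where "d' = min d (e / (\<bar>C\<bar> + 1))"
  have "norm (f y - f x - f' (y - x)) \<le> e * norm (y - x)" if "norm (y - x) < d'" for y
  proof -
    have "y \<in> ball x d" using that by (simp add: d'_def dist_norm norm_minus_commute)
    then have "norm (f y - f x - f' (y - x)) \<le> C * norm (y - x) * norm (y - x)"
      using le d by (auto simp: power2_eq_square mult.assoc)
    also have "C * norm (y - x) \<le> (\<bar>C\<bar> + 1) * (e / (\<bar>C\<bar> + 1))"
      using that by (intro mult_mono) (auto simp: d'_def)
    then have "C * norm (y - x) * norm (y - x) \<le> e * norm (y - x)"
      by (intro mult_right_mono) auto
    finally show ?thesis .
  qed
  then show "\<exists>d>0. \<forall>y. norm (y - x) < d \<longrightarrow> norm (f y - f x - f' (y - x)) \<le> e * norm (y - x)"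
    using d(1) \<open>e > 0\<close> by (intro exI[of _ d']) (auto simp: d'_def)
qed

subsection \<open>A radial smoothing kernel\<close>

definition bump :: "real \<Rightarrow> 'a::euclidean_space \<Rightarrow> real" where
  "bump r u = (max 0 (r\<^sup>2 - (norm u)\<^sup>2))\<^sup>2"

definition bump_deriv :: "real \<Rightarrow> 'a::euclidean_space \<Rightarrow> 'a \<Rightarrow> real" where
  "bump_deriv r u v = - 4 * max 0 (r\<^sup>2 - (norm u)\<^sup>2) * (u \<bullet> v)"

lemma bump_nonneg: "bump r u \<ge> 0"
  by (simp add: bump_def)

lemma bump_le: "bump r u \<le> (r\<^sup>2)\<^sup>2"
  unfolding bump_def by (intro power_mono) auto

lemma abs_norm_power2_diff_le:
  fixes u u' :: "'a::euclidean_space"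
  assumes "norm u \<le> D" "norm u' \<le> D"
  shows "\<bar>(norm u')\<^sup>2 - (norm u)\<^sup>2\<bar> \<le> 2 * D * norm (u' - u)"
proof -
  have "\<bar>(norm u')\<^sup>2 - (norm u)\<^sup>2\<bar> = \<bar>norm u' - norm u\<bar> * (norm u' + norm u)"
    by (simp add: power2_eq_square square_diff_square_factored abs_mult)
  also have "\<dots> \<le> norm (u' - u) * (2 * D)"
    using assms norm_triangle_ineq3[of u' u] by (intro mult_mono) auto
  finally show ?thesis by (simp add: mult.commute)
qed

lemma bump_deriv_le:
  assumes "norm u \<le> D"
  shows "\<bar>bump_deriv r u v\<bar> \<le> 4 * r\<^sup>2 * D * norm v"
proof -
  have "\<bar>bump_deriv r u v\<bar> = 4 * (max 0 (r\<^sup>2 - (norm u)\<^sup>2) * \<bar>u \<bullet> v\<bar>)"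
    by (simp add: bump_deriv_def abs_mult)
  also have "max 0 (r\<^sup>2 - (norm u)\<^sup>2) * \<bar>u \<bullet> v\<bar> \<le> r\<^sup>2 * (D * norm v)"
    using assms Cauchy_Schwarz_ineq2[of u v] mult_right_mono[OF assms, of "norm v"]
    by (intro mult_mono) auto
  finally show ?thesis by (simp add: mult.assoc)
qed

lemma bump_taylor:
  assumes D: "norm u \<le> D" "norm u' \<le> D"
  shows "\<bar>bump r u' - bump r u - bump_deriv r u (u' - u)\<bar> \<le> (4 * D\<^sup>2 + 2 * r\<^sup>2) * (norm (u' - u))\<^sup>2"
proof -
  define x y where "x = r\<^sup>2 - (norm u')\<^sup>2" and "y = r\<^sup>2 - (norm u)\<^sup>2"
  have q: "\<bar>(max 0 x)\<^sup>2 - (max 0 y)\<^sup>2 - 2 * max 0 y * (x - y)\<bar> \<le> (x - y)\<^sup>2"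
  proof -
    consider "x \<ge> 0" "y \<ge> 0" | "y \<le> 0" "x \<ge> 0" | "y \<le> 0" "x \<le> 0" | "y \<ge> 0" "x \<le> 0" by linarith
    then show ?thesis
    proof cases
      case 1
      have "x\<^sup>2 - y\<^sup>2 - 2 * y * (x - y) = (x - y)\<^sup>2" by (simp add: power2_eq_square algebra_simps)
      with 1 show ?thesis by (simp add: max_def)
    next
      case 2
      then have "x\<^sup>2 \<le> (x - y)\<^sup>2" by (intro power_mono) auto
      with 2 show ?thesis by (simp add: max_def)
    next
      case 3
      then show ?thesis by (simp add: max_def)
    next
      case 4
      have "x * y \<le> 0" using 4 by (simp add: mult_nonpos_nonneg)
      have e: "0\<^sup>2 - y\<^sup>2 - 2 * y * (x - y) = y\<^sup>2 - 2 * (x * y)" "(x - y)\<^sup>2 = x\<^sup>2 + (y\<^sup>2 - 2 * (x * y))"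
        by (simp_all add: power2_eq_square algebra_simps)
      have mx: "max 0 x = 0" "max 0 y = y" using 4 by auto
      show ?thesis unfolding mx e
        using \<open>x * y \<le> 0\<close> zero_le_power2[of x] zero_le_power2[of y] by linarith
    qed
  qed
  define m where "m = max 0 y"
  have m: "0 \<le> m" "m \<le> r\<^sup>2" by (auto simp: m_def y_def)
  have xy: "x - y = - (2 * (u \<bullet> (u' - u)) + (norm (u' - u))\<^sup>2)"
    by (simp add: x_def y_def power2_norm_eq_inner inner_diff_left inner_diff_right inner_commute)
  have "bump r u' - bump r u - bump_deriv r u (u' - u)
      = ((max 0 x)\<^sup>2 - m\<^sup>2 - 2 * m * (x - y)) - 2 * m * (norm (u' - u))\<^sup>2"
    by (simp add: bump_def bump_deriv_def xy flip: x_def y_def m_def) (simp add: algebra_simps)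
  also have "\<bar>\<dots>\<bar> \<le> (x - y)\<^sup>2 + 2 * m * (norm (u' - u))\<^sup>2"
  proof -
    have "0 \<le> 2 * m * (norm (u' - u))\<^sup>2" using m by simp
    then show ?thesis using q[folded m_def] unfolding abs_le_iff by linarith
  qed
  also have "\<bar>x - y\<bar> \<le> 2 * D * norm (u' - u)"
    using abs_norm_power2_diff_le[OF D] by (simp add: x_def y_def abs_minus_commute)
  then have "\<bar>x - y\<bar>\<^sup>2 \<le> (2 * D * norm (u' - u))\<^sup>2" by (intro power_mono) auto
  then have "(x - y)\<^sup>2 + 2 * m * (norm (u' - u))\<^sup>2 \<le> (2 * D * norm (u' - u))\<^sup>2 + 2 * r\<^sup>2 * (norm (u' - u))\<^sup>2"
    using m by (intro add_mono mult_right_mono) auto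
  finally show ?thesis by (simp add: power_mult_distrib ring_distribs)
qed

lemma bump_deriv_lipschitz:
  assumes D: "norm u \<le> D" "norm u' \<le> D"
  shows "\<bar>bump_deriv r u' v - bump_deriv r u v\<bar> \<le> (8 * D\<^sup>2 + 4 * r\<^sup>2) * norm (u' - u) * norm v"
proof -
  define m m' where "m = max 0 (r\<^sup>2 - (norm u)\<^sup>2)" and "m' = max 0 (r\<^sup>2 - (norm u')\<^sup>2)"
  have D0: "D \<ge> 0" using D norm_ge_zero[of u] by linarith
  have mm: "\<bar>m' - m\<bar> \<le> 2 * D * norm (u' - u)"
  proof -
    have "\<bar>max 0 a - max 0 b\<bar> \<le> \<bar>b - a\<bar>" for a b :: real by linarith
    from this[of "r\<^sup>2 - (norm u')\<^sup>2" "r\<^sup>2 - (norm u)\<^sup>2"] show ?thesis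
      using abs_norm_power2_diff_le[OF D] by (simp add: m_def m'_def)
  qed
  have m: "0 \<le> m" "m \<le> r\<^sup>2" by (auto simp: m_def)
  have "bump_deriv r u' v - bump_deriv r u v = - (4 * ((m' - m) * (u' \<bullet> v))) - 4 * (m * ((u' - u) \<bullet> v))"
    by (simp add: bump_deriv_def inner_diff_left flip: m_def m'_def) (simp add: algebra_simps)
  also have "\<bar>\<dots>\<bar> \<le> 4 * (\<bar>m' - m\<bar> * \<bar>u' \<bullet> v\<bar>) + 4 * (m * \<bar>(u' - u) \<bullet> v\<bar>)"
    using m by (intro order_trans[OF abs_triangle_ineq4]) (simp add: abs_mult)
  also have "\<bar>m' - m\<bar> * \<bar>u' \<bullet> v\<bar> \<le> (2 * D * norm (u' - u)) * (D * norm v)"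
    using mm Cauchy_Schwarz_ineq2[of u' v] mult_right_mono[OF D(2), of "norm v"] D0
    by (intro mult_mono) auto
  also have "m * \<bar>(u' - u) \<bullet> v\<bar> \<le> r\<^sup>2 * (norm (u' - u) * norm v)"
    using m Cauchy_Schwarz_ineq2[of "u' - u" v] by (intro mult_mono) auto
  finally show ?thesis by (simp add: power2_eq_square algebra_simps)
qed

lemma continuous_on_bump [continuous_intros]: "continuous_on A f \<Longrightarrow> continuous_on A (\<lambda>x. bump r (f x))"
  unfolding bump_def by (intro continuous_intros)

lemma continuous_on_bump_deriv [continuous_intros]:
  "continuous_on A f \<Longrightarrow> continuous_on A (\<lambda>x. bump_deriv r (f x) v)"
  unfolding bump_deriv_def by (intro continuous_intros)

lemma integrable_bump: "integrable lborel (bump r :: 'a::euclidean_space \<Rightarrow> real)"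
proof -
  have "integrable lborel (\<lambda>u::'a. indicator (cball 0 \<bar>r\<bar>) u *\<^sub>R bump r u)"
    by (intro borel_integrable_compact compact_cball continuous_intros)
  also have "(\<lambda>u::'a. indicator (cball 0 \<bar>r\<bar>) u *\<^sub>R bump r u) = bump r"
  proof
    fix u :: 'a
    show "indicator (cball 0 \<bar>r\<bar>) u *\<^sub>R bump r u = bump r u"
      using power_mono[of "\<bar>r\<bar>" "norm u" 2] by (auto simp: bump_def indicator_def)
  qed
  finally show ?thesis .
qed

lemma integral_bump_pos:
  assumes "r > 0" shows "(LINT u|lborel. bump r (u::'a::euclidean_space)) > 0"
proof -
  have "(LINT u|lborel. bump r (u::'a)) \<noteq> 0"
  proof
    assume "(LINT u|lborel. bump r (u::'a)) = 0"
    then have "AE u in lborel. bump r (u::'a) = 0"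
      by (subst (asm) integral_nonneg_eq_0_iff_AE) (auto simp: integrable_bump bump_nonneg)
    then have "AE u in lborel. (u::'a) \<notin> ball 0 r"
    proof eventually_elim
      fix u :: 'a assume "bump r u = 0"
      then have "r\<^sup>2 \<le> (norm u)\<^sup>2" by (auto simp: bump_def max_def split: if_splits)
      then show "u \<notin> ball 0 r" using assms power2_le_imp_le[of r "norm u"] by simp
    qed
    then have "ball (0::'a) r \<in> null_sets lborel"
      by (subst (asm) AE_iff_null_sets[symmetric]) auto
    then have "negligible (ball (0::'a) r)"
      by (simp add: negligible_iff_null_sets null_sets_completionI)
    then show False using open_not_negligible[of "ball (0::'a) r"] assms by auto
  qed
  moreover have "(LINT u|lborel. bump r (u::'a)) \<ge> 0"
    by (intro integral_nonneg_AE) (simp add: bump_nonneg)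
  ultimately show ?thesis by linarith
qed

lemma L2_integral_mult_bounded:
  assumes M: "finite_measure M" and f: "f \<in> L2 M"
    and g: "g \<in> borel_measurable M" "\<And>x. x \<in> space M \<Longrightarrow> \<bar>g x\<bar> \<le> B" "B \<ge> 0"
  shows "integrable M (\<lambda>x. f x * of_real (g x))"
    and "cmod (LINT x|M. f x * of_real (g x)) \<le> B * sqrt (measure M (space M)) * l2_norm M f"
proof -
  have 1: "(\<lambda>_. 1) \<in> L2 M" using finite_measure.integrable_const[OF M, of "1::real"] by (simp add: L2_def)
  have n1: "l2_norm M (\<lambda>_. 1) = sqrt (measure M (space M))"
    using M by (simp add: l2_norm_def)
  have i: "integrable M (\<lambda>x. B * cmod (f x))"
    using integrable_norm_mult_L2[OF f 1] by simp
  have m: "(\<lambda>x. f x * of_real (g x)) \<in> borel_measurable M"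
    using L2_measurable[OF f] g(1) by measurable
  have le: "cmod (f x * of_real (g x)) \<le> B * cmod (f x)" if "x \<in> space M" for x
    using g(2)[OF that] by (simp add: norm_mult mult.commute mult_right_mono)
  show int: "integrable M (\<lambda>x. f x * of_real (g x))"
  proof (rule Bochner_Integration.integrable_bound[OF i m])
    show "AE x in M. cmod (f x * of_real (g x)) \<le> norm (B * cmod (f x))"
      using le g(3) by (intro AE_I2) simp
  qed
  have "cmod (LINT x|M. f x * of_real (g x)) \<le> (LINT x|M. cmod (f x * of_real (g x)))"
    by (rule integral_norm_bound)
  also have "\<dots> \<le> (LINT x|M. B * cmod (f x))"
    by (rule Bochner_Integration.integral_mono[OF integrable_norm[OF int] i le])
  also have "\<dots> = B * (LINT x|M. cmod (f x) * cmod 1)" by simp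
  also have "\<dots> \<le> B * (l2_norm M f * l2_norm M (\<lambda>_. 1))"
    by (intro mult_left_mono integral_norm_mult_le_l2 f 1 g(3))
  finally show "cmod (LINT x|M. f x * of_real (g x)) \<le> B * sqrt (measure M (space M)) * l2_norm M f"
    by (simp add: n1 mult_ac)
qed

locale bounded_open =
  fixes \<Omega> :: "(complex^'n) set"
  assumes open_dom: "open \<Omega>" and bounded_dom: "bounded \<Omega>"
begin

abbreviation \<mu> :: "(complex^'n) measure" where "\<mu> \<equiv> restrict_space lborel \<Omega>"
abbreviation A2 :: "(complex^'n \<Rightarrow> complex) set" where "A2 \<equiv> bergman_space \<Omega>"

lemma dom_borel [measurable]: "\<Omega> \<in> sets borel" "\<Omega> \<in> sets lborel"
  using open_dom by auto

lemma space_mu [simp]: "space \<mu> = \<Omega>"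
  by (simp add: space_restrict_space)

lemma finite_mu: "finite_measure \<mu>"
proof
  obtain r where "\<Omega> \<subseteq> ball 0 r" using bounded_dom bounded_subset_ballD by blast
  then have "emeasure lborel \<Omega> \<le> emeasure lborel (ball (0::complex^'n) r)"
    by (intro emeasure_mono) auto
  also have "\<dots> < \<infinity>" by (rule emeasure_lborel_ball_finite)
  finally show "emeasure \<mu> (space \<mu>) \<noteq> \<infinity>"
    by (simp add: emeasure_restrict_space)
qed

lemma mu_measurable_continuous: "continuous_on \<Omega> f \<Longrightarrow> f \<in> borel_measurable \<mu>"
  using borel_measurable_continuous_on_restrict[of \<Omega> f]
  by (simp add: measurable_cong_sets[OF sets_restrict_space_cong[OF sets_lborel] refl])

lemma integral_mu: "(LINT x|\<mu>. f x) = (LINT x:\<Omega>|lborel. f x)"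
  for f :: "_ \<Rightarrow> 'b::{banach, second_countable_topology}"
  by (simp add: integral_restrict_space set_lebesgue_integral_def)

lemma integrable_mu: "integrable \<mu> f \<longleftrightarrow> set_integrable lborel \<Omega> f"
  for f :: "_ \<Rightarrow> 'b::{banach, second_countable_topology}"
  by (simp add: integrable_restrict_space set_integrable_def)

lemma bergman_space_iff: "f \<in> A2 \<longleftrightarrow> holomorphic_several f \<Omega> \<and> f \<in> L2 \<mu>"
  using mu_measurable_continuous[OF holomorphic_several_imp_continuous_on]
  by (auto simp: bergman_space_def L2_def integrable_mu)

lemma A2_L2: "f \<in> A2 \<Longrightarrow> f \<in> L2 \<mu>" and A2_holomorphic: "f \<in> A2 \<Longrightarrow> holomorphic_several f \<Omega>"
  by (auto simp: bergman_space_iff)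

definition diam :: real where "diam = (SOME D. D > 0 \<and> (\<forall>x\<in>\<Omega>. \<forall>y\<in>\<Omega>. norm (x - y) \<le> D))"

lemma diam_pos: "diam > 0" and diam_le: "x \<in> \<Omega> \<Longrightarrow> y \<in> \<Omega> \<Longrightarrow> norm (x - y) \<le> diam"
proof -
  obtain b where b: "b > 0" "\<forall>x\<in>\<Omega>. norm x \<le> b" using bounded_dom bounded_pos by blast
  then have "\<forall>x\<in>\<Omega>. \<forall>y\<in>\<Omega>. norm (x - y) \<le> 2 * b"
    using norm_triangle_ineq4 by (smt (verit))
  with b(1) have "\<exists>D>0. \<forall>x\<in>\<Omega>. \<forall>y\<in>\<Omega>. norm (x - y) \<le> D" by (intro exI[of _ "2 * b"]) auto
  from someI_ex[OF this]
  have "diam > 0 \<and> (\<forall>x\<in>\<Omega>. \<forall>y\<in>\<Omega>. norm (x - y) \<le> diam)" unfolding diam_def .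
  then show "diam > 0" "x \<in> \<Omega> \<Longrightarrow> y \<in> \<Omega> \<Longrightarrow> norm (x - y) \<le> diam" by auto
qed

definition bump_mass :: "real \<Rightarrow> real" where
  "bump_mass r = (LINT u|lborel. bump r (u :: complex^'n))"

definition smooth :: "real \<Rightarrow> (complex^'n \<Rightarrow> complex) \<Rightarrow> complex^'n \<Rightarrow> complex" where
  "smooth r f w = (LINT \<zeta>|\<mu>. f \<zeta> * of_real (bump r (\<zeta> - w) / bump_mass r))"

definition smooth_deriv :: "real \<Rightarrow> (complex^'n \<Rightarrow> complex) \<Rightarrow> complex^'n \<Rightarrow> complex^'n \<Rightarrow> complex" where
  "smooth_deriv r f w v = (LINT \<zeta>|\<mu>. f \<zeta> * of_real (- bump_deriv r (\<zeta> - w) v / bump_mass r))"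

lemma bump_mass_pos: "r > 0 \<Longrightarrow> bump_mass r > 0"
  by (simp add: bump_mass_def integral_bump_pos)

lemma smooth_eq:
  assumes f: "f \<in> A2" and r: "r > 0" "ball z r \<subseteq> \<Omega>"
  shows "smooth r f z = f z"
proof -
  let ?g = "\<lambda>\<zeta>. indicator \<Omega> \<zeta> *\<^sub>R (f \<zeta> * of_real (bump r (\<zeta> - z)))"
  define \<phi> where "\<phi> s = (max 0 (r\<^sup>2 - s\<^sup>2))\<^sup>2" for s :: real
  have \<phi>: "\<phi> s = 0" if "s \<ge> r" for s
    using power_mono[OF that, of 2] r by (simp add: \<phi>_def)
  have bump: "bump r v = \<phi> (norm v)" for v :: "complex^'n" by (simp add: bump_def \<phi>_def)
  have shift: "?g (z + v) = \<phi> (norm v) *\<^sub>R f (z + v)" for v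
  proof (cases "norm v < r")
    case True
    then have "z + v \<in> \<Omega>" using r(2) by (auto simp: dist_norm)
    then show ?thesis by (simp add: bump scaleR_conv_of_real mult.commute)
  qed (simp add: bump \<phi>)
  have "integrable \<mu> (\<lambda>\<zeta>. f \<zeta> * of_real (bump r (\<zeta> - z)))"
  proof (rule L2_integral_mult_bounded(1)[OF finite_mu A2_L2[OF f]])
    show "(\<lambda>\<zeta>. bump r (\<zeta> - z)) \<in> borel_measurable \<mu>"
      by (intro mu_measurable_continuous continuous_intros)
    show "\<bar>bump r (x - z)\<bar> \<le> (r\<^sup>2)\<^sup>2" for x using bump_nonneg[of r "x - z"] bump_le[of r "x - z"] by simp
  qed simp
  then have "integrable lborel ?g" by (simp add: integrable_mu set_integrable_def)
  note g = integrable_lborel_translate[OF this, of z]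
  have "(LINT \<zeta>|\<mu>. f \<zeta> * of_real (bump r (\<zeta> - z))) = (LINT v|lborel. \<phi> (norm v) *\<^sub>R f (z + v))"
    using g(2) unfolding shift by (simp add: integral_mu set_lebesgue_integral_def)
  also have "\<dots> = (LINT v::complex^'n|lborel. \<phi> (norm v)) *\<^sub>R f z"
  proof (rule holomorphic_several_mean_value_radial[OF A2_holomorphic[OF f] r(2) \<phi>])
    show "integrable lborel (\<lambda>v. \<phi> (norm v) *\<^sub>R f (z + v))" using g(1) unfolding shift .
    show "integrable lborel (\<lambda>v::complex^'n. \<phi> (norm v))" using integrable_bump[of r]
      by (subst bump[symmetric]) simp
  qed
  also have "(LINT v::complex^'n|lborel. \<phi> (norm v)) = bump_mass r" by (simp add: bump_mass_def bump)
  finally show ?thesis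
    using bump_mass_pos[OF r(1)] by (simp add: smooth_def scaleR_conv_of_real)
qed

lemma bump_measurable:
  "(\<lambda>\<zeta>. bump r (\<zeta> - w)) \<in> borel_measurable \<mu>" "(\<lambda>\<zeta>. bump_deriv r (\<zeta> - w) v) \<in> borel_measurable \<mu>"
  by (intro mu_measurable_continuous continuous_intros)+

lemma integrable_smooth:
  assumes r: "r > 0" and f: "f \<in> L2 \<mu>"
  shows "integrable \<mu> (\<lambda>\<zeta>. f \<zeta> * of_real (bump r (\<zeta> - w) / bump_mass r))"
proof (rule L2_integral_mult_bounded(1)[OF finite_mu f])
  show "(\<lambda>\<zeta>. bump r (\<zeta> - w) / bump_mass r) \<in> borel_measurable \<mu>" using bump_measurable by measurable
  show "\<bar>bump r (x - w) / bump_mass r\<bar> \<le> (r\<^sup>2)\<^sup>2 / bump_mass r" for x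
    using bump_nonneg[of r "x - w"] bump_le[of r "x - w"] bump_mass_pos[OF r] by (simp add: divide_right_mono)
qed (use bump_mass_pos[OF r] in simp)

lemma integrable_smooth_deriv:
  assumes r: "r > 0" and f: "f \<in> L2 \<mu>" and w: "w \<in> \<Omega>"
  shows "integrable \<mu> (\<lambda>\<zeta>. f \<zeta> * of_real (- bump_deriv r (\<zeta> - w) v / bump_mass r))"
proof (rule L2_integral_mult_bounded(1)[OF finite_mu f])
  show "(\<lambda>\<zeta>. - bump_deriv r (\<zeta> - w) v / bump_mass r) \<in> borel_measurable \<mu>" using bump_measurable by measurable
  show "\<bar>- bump_deriv r (x - w) v / bump_mass r\<bar> \<le> 4 * r\<^sup>2 * diam * norm v / bump_mass r" if "x \<in> space \<mu>" for x
    using bump_deriv_le[OF diam_le[of x w], of r v] that w bump_mass_pos[OF r] by (simp add: divide_right_mono)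
  show "0 \<le> 4 * r\<^sup>2 * diam * norm v / bump_mass r" using diam_pos bump_mass_pos[OF r] by simp
qed

lemma smooth_estimates:
  assumes r: "r > 0"
  obtains C where "C \<ge> 0"
    "\<And>f w. f \<in> L2 \<mu> \<Longrightarrow> w \<in> \<Omega> \<Longrightarrow> cmod (smooth r f w) \<le> C * l2_norm \<mu> f"
    "\<And>f w v. f \<in> L2 \<mu> \<Longrightarrow> w \<in> \<Omega> \<Longrightarrow> cmod (smooth_deriv r f w v) \<le> C * norm v * l2_norm \<mu> f"
    "\<And>f w w'. f \<in> L2 \<mu> \<Longrightarrow> w \<in> \<Omega> \<Longrightarrow> w' \<in> \<Omega> \<Longrightarrow>
       cmod (smooth r f w' - smooth r f w - smooth_deriv r f w (w' - w)) \<le> C * (norm (w' - w))\<^sup>2 * l2_norm \<mu> f"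
    "\<And>f w w' v. f \<in> L2 \<mu> \<Longrightarrow> w \<in> \<Omega> \<Longrightarrow> w' \<in> \<Omega> \<Longrightarrow>
       cmod (smooth_deriv r f w' v - smooth_deriv r f w v) \<le> C * norm (w' - w) * norm v * l2_norm \<mu> f"
proof -
  define D where "D = diam"
  have D: "D > 0" "\<And>x y. x \<in> \<Omega> \<Longrightarrow> y \<in> \<Omega> \<Longrightarrow> norm (x - y) \<le> D"
    using diam_pos diam_le by (auto simp: D_def)
  define I where "I = bump_mass r"
  have I: "I > 0" using bump_mass_pos[OF r] by (simp add: I_def)
  define m where "m = sqrt (measure \<mu> (space \<mu>))"
  have m0: "m \<ge> 0" by (simp add: m_def)
  define E where "E = (r\<^sup>2)\<^sup>2 + 4 * r\<^sup>2 * D + (8 * D\<^sup>2 + 4 * r\<^sup>2)"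
  have E: "(r\<^sup>2)\<^sup>2 \<le> E" "4 * r\<^sup>2 * D \<le> E" "4 * D\<^sup>2 + 2 * r\<^sup>2 \<le> E" "8 * D\<^sup>2 + 4 * r\<^sup>2 \<le> E" "E \<ge> 0"
    using D(1) by (auto simp: E_def add_nonneg_nonneg)
  define C where "C = E / I * m"
  have C: "C \<ge> 0" using E I m0 by (simp add: C_def)
  have key: "cmod (LINT \<zeta>|\<mu>. f \<zeta> * of_real (k \<zeta> / I)) \<le> C * B * l2_norm \<mu> f"
    if f: "f \<in> L2 \<mu>" and k: "k \<in> borel_measurable \<mu>" "\<And>\<zeta>. \<zeta> \<in> \<Omega> \<Longrightarrow> \<bar>k \<zeta>\<bar> \<le> E * B" "B \<ge> 0" for f k B
  proof -
    have "cmod (LINT \<zeta>|\<mu>. f \<zeta> * of_real (k \<zeta> / I)) \<le> (E * B / I) * sqrt (measure \<mu> (space \<mu>)) * l2_norm \<mu> f"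
    proof (rule L2_integral_mult_bounded(2)[OF finite_mu f])
      show "(\<lambda>x. k x / I) \<in> borel_measurable \<mu>" using k(1) by measurable
      show "\<bar>k x / I\<bar> \<le> E * B / I" if "x \<in> space \<mu>" for x
        using k(2)[of x] that I by (simp add: divide_right_mono)
      show "0 \<le> E * B / I" using E k(3) I by simp
    qed
    then show ?thesis by (simp add: C_def m_def mult_ac)
  qed
  show ?thesis
  proof (rule that[OF C])
    fix f and w w' v :: "complex^'n" assume f: "f \<in> L2 \<mu>" and w: "w \<in> \<Omega>"
    have "\<bar>bump r (\<zeta> - w)\<bar> \<le> E * 1" for \<zeta>
      using bump_nonneg[of r "\<zeta> - w"] bump_le[of r "\<zeta> - w"] E(1) by linarith
    from key[OF f bump_measurable(1) this] show "cmod (smooth r f w) \<le> C * l2_norm \<mu> f"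
      unfolding smooth_def I_def[symmetric] by simp
    have "\<bar>- bump_deriv r (\<zeta> - w) v\<bar> \<le> E * norm v" if "\<zeta> \<in> \<Omega>" for \<zeta>
      using bump_deriv_le[OF D(2)[OF that w], of r v] mult_right_mono[OF E(2), of "norm v"] by simp
    then show "cmod (smooth_deriv r f w v) \<le> C * norm v * l2_norm \<mu> f"
      unfolding smooth_deriv_def I_def[symmetric] using bump_measurable by (intro key f) simp_all
    assume w': "w' \<in> \<Omega>"
    have "smooth r f w' - smooth r f w - smooth_deriv r f w (w' - w)
        = (LINT \<zeta>|\<mu>. f \<zeta> * of_real ((bump r (\<zeta> - w') - bump r (\<zeta> - w) - bump_deriv r (\<zeta> - w) (w - w')) / I))"
    proof -
      have "f \<zeta> * of_real ((bump r (\<zeta> - w') - bump r (\<zeta> - w) - bump_deriv r (\<zeta> - w) (w - w')) / I)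
         = f \<zeta> * of_real (bump r (\<zeta> - w') / I) - f \<zeta> * of_real (bump r (\<zeta> - w) / I)
           - f \<zeta> * of_real (- bump_deriv r (\<zeta> - w) (w' - w) / I)" for \<zeta>
      proof -
        have "bump_deriv r (\<zeta> - w) (w - w') = - bump_deriv r (\<zeta> - w) (w' - w)"
          by (simp add: bump_deriv_def inner_diff_right algebra_simps)
        then show ?thesis by (simp add: diff_divide_distrib add_divide_distrib ring_distribs)
      qed
      then show ?thesis
        unfolding smooth_def smooth_deriv_def I_def[symmetric]
        using integrable_smooth[OF r f] integrable_smooth_deriv[OF r f w] unfolding I_def[symmetric] by (simp only: Bochner_Integration.integral_diff Bochner_Integration.integrable_diff)
    qed
    also have "cmod \<dots> \<le> C * (norm (w' - w))\<^sup>2 * l2_norm \<mu> f"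
    proof (rule key[OF f])
      show "(\<lambda>\<zeta>. bump r (\<zeta> - w') - bump r (\<zeta> - w) - bump_deriv r (\<zeta> - w) (w - w')) \<in> borel_measurable \<mu>"
        using bump_measurable by measurable
      fix \<zeta> assume \<zeta>: "\<zeta> \<in> \<Omega>"
      have "\<bar>bump r (\<zeta> - w') - bump r (\<zeta> - w) - bump_deriv r (\<zeta> - w) (w - w')\<bar> \<le> (4 * D\<^sup>2 + 2 * r\<^sup>2) * (norm (w - w'))\<^sup>2"
        using bump_taylor[OF D(2)[OF \<zeta> w] D(2)[OF \<zeta> w'], of r] by simp
      also have "\<dots> \<le> E * (norm (w' - w))\<^sup>2"
        using E(3) by (simp add: norm_minus_commute mult_right_mono)
      finally show "\<bar>bump r (\<zeta> - w') - bump r (\<zeta> - w) - bump_deriv r (\<zeta> - w) (w - w')\<bar> \<le> E * (norm (w' - w))\<^sup>2" .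
    qed simp
    finally show "cmod (smooth r f w' - smooth r f w - smooth_deriv r f w (w' - w)) \<le> C * (norm (w' - w))\<^sup>2 * l2_norm \<mu> f" .
    have "smooth_deriv r f w' v - smooth_deriv r f w v
        = (LINT \<zeta>|\<mu>. f \<zeta> * of_real ((bump_deriv r (\<zeta> - w) v - bump_deriv r (\<zeta> - w') v) / I))"
    proof -
      have "f \<zeta> * of_real ((bump_deriv r (\<zeta> - w) v - bump_deriv r (\<zeta> - w') v) / I)
         = f \<zeta> * of_real (- bump_deriv r (\<zeta> - w') v / I) - f \<zeta> * of_real (- bump_deriv r (\<zeta> - w) v / I)" for \<zeta>
        by (simp add: diff_divide_distrib ring_distribs)
      then show ?thesis
        unfolding smooth_deriv_def I_def[symmetric]
        using integrable_smooth_deriv[OF r f w] integrable_smooth_deriv[OF r f w'] unfolding I_def[symmetric] by (simp only: Bochner_Integration.integral_diff Bochner_Integration.integrable_diff)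
    qed
    also have "cmod \<dots> \<le> C * (norm (w' - w) * norm v) * l2_norm \<mu> f"
    proof (rule key[OF f])
      show "(\<lambda>\<zeta>. bump_deriv r (\<zeta> - w) v - bump_deriv r (\<zeta> - w') v) \<in> borel_measurable \<mu>"
        using bump_measurable by measurable
      fix \<zeta> assume \<zeta>: "\<zeta> \<in> \<Omega>"
      have "\<bar>bump_deriv r (\<zeta> - w) v - bump_deriv r (\<zeta> - w') v\<bar> \<le> (8 * D\<^sup>2 + 4 * r\<^sup>2) * norm (w' - w) * norm v"
        using bump_deriv_lipschitz[OF D(2)[OF \<zeta> w'] D(2)[OF \<zeta> w], of r v] by simp
      also have "\<dots> \<le> E * (norm (w' - w) * norm v)"
        using mult_right_mono[OF E(4), of "norm (w' - w) * norm v"] by (simp add: mult.assoc)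
      finally show "\<bar>bump_deriv r (\<zeta> - w) v - bump_deriv r (\<zeta> - w') v\<bar> \<le> E * (norm (w' - w) * norm v)" .
    qed simp
    finally show "cmod (smooth_deriv r f w' v - smooth_deriv r f w v) \<le> C * norm (w' - w) * norm v * l2_norm \<mu> f"
      by (simp add: mult.assoc)
  qed
qed

end

subsection \<open>The Bergman space and its kernel\<close>

lemma holomorphic_several_add:
  assumes "holomorphic_several f \<Omega>" "holomorphic_several g \<Omega>"
  shows "holomorphic_several (\<lambda>z. f z + g z) \<Omega>"
  unfolding holomorphic_several_def
proof
  fix z assume "z \<in> \<Omega>"
  with assms obtain D E where "(f has_derivative D) (at z)" "\<And>c v. D (c *s v) = c * D v"
    "(g has_derivative E) (at z)" "\<And>c v. E (c *s v) = c * E v"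
    by (metis holomorphic_severalD)
  then show "\<exists>D. ((\<lambda>z. f z + g z) has_derivative D) (at z) \<and> (\<forall>c v. D (c *s v) = c * D v)"
    by (intro exI[of _ "\<lambda>v. D v + E v"]) (auto intro!: derivative_intros simp: ring_distribs)
qed

lemma holomorphic_several_cmult:
  assumes "holomorphic_several f \<Omega>"
  shows "holomorphic_several (\<lambda>z. c * f z) \<Omega>"
  unfolding holomorphic_several_def
proof
  fix z assume "z \<in> \<Omega>"
  with assms obtain D where "(f has_derivative D) (at z)" "\<And>c v. D (c *s v) = c * D v"
    by (metis holomorphic_severalD)
  then show "\<exists>D. ((\<lambda>z. c * f z) has_derivative D) (at z) \<and> (\<forall>c v. D (c *s v) = c * D v)"
    by (intro exI[of _ "\<lambda>v. c * D v"]) (auto intro!: derivative_intros)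
qed

lemma holomorphic_several_const: "holomorphic_several (\<lambda>_. c) \<Omega>"
  unfolding holomorphic_several_def by (auto intro!: exI[of _ "\<lambda>_. 0"])

lemma has_derivative_component: "((\<lambda>z :: complex^'n. z $ i) has_derivative (\<lambda>v. v $ i)) F"
  by (intro bounded_linear_imp_has_derivative bounded_linear_vec_nth)

lemma holomorphic_several_component: "holomorphic_several (\<lambda>z. z $ i) \<Omega>"
  unfolding holomorphic_several_def
  by (intro ballI exI[of _ "\<lambda>v. v $ i"] conjI has_derivative_component) simp

abbreviation fderiv :: "(complex^'n \<Rightarrow> complex) \<Rightarrow> complex^'n \<Rightarrow> complex^'n \<Rightarrow> complex" where
  "fderiv f z \<equiv> frechet_derivative f (at z)"

lemma holomorphic_several_fderiv:
  assumes "holomorphic_several f \<Omega>" "z \<in> \<Omega>"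
  shows "(f has_derivative fderiv f z) (at z)" "fderiv f z (c *s v) = c * fderiv f z v"
proof -
  obtain D where D: "(f has_derivative D) (at z)" "\<And>c v. D (c *s v) = c * D v"
    using assms by (metis holomorphic_severalD)
  then have e: "fderiv f z = D" by (metis frechet_derivative_at)
  show "(f has_derivative fderiv f z) (at z)" "fderiv f z (c *s v) = c * fderiv f z v"
    unfolding e using D by auto
qed

lemma fderiv_eq: "(f has_derivative D) (at z) \<Longrightarrow> fderiv f z = D"
  using frechet_derivative_at by metis

context bounded_open
begin

lemma smooth_diff:
  assumes r: "r > 0" and f: "f \<in> L2 \<mu>" and g: "g \<in> L2 \<mu>"
  shows "smooth r (\<lambda>x. f x - g x) w = smooth r f w - smooth r g w"
  using integrable_smooth[OF r f, of w] integrable_smooth[OF r g, of w]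
  unfolding smooth_def left_diff_distrib by (rule Bochner_Integration.integral_diff)

lemma smooth_deriv_diff:
  assumes r: "r > 0" and f: "f \<in> L2 \<mu>" and g: "g \<in> L2 \<mu>" and w: "w \<in> \<Omega>"
  shows "smooth_deriv r (\<lambda>x. f x - g x) w v = smooth_deriv r f w v - smooth_deriv r g w v"
  using integrable_smooth_deriv[OF r f w, of v] integrable_smooth_deriv[OF r g w, of v]
  unfolding smooth_deriv_def left_diff_distrib by (rule Bochner_Integration.integral_diff)

lemma bounded_linear_smooth_deriv:
  assumes r: "r > 0" and f: "f \<in> L2 \<mu>" and w: "w \<in> \<Omega>"
  shows "bounded_linear (smooth_deriv r f w)"
proof -
  obtain C where C: "\<And>v. cmod (smooth_deriv r f w v) \<le> C * norm v * l2_norm \<mu> f"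
    using smooth_estimates[OF r] f w by metis
  show ?thesis
  proof (rule bounded_linear_intro[of _ "C * l2_norm \<mu> f"])
    fix u v :: "complex^'n"
    have "f \<zeta> * of_real (- bump_deriv r (\<zeta> - w) (u + v) / bump_mass r)
       = f \<zeta> * of_real (- bump_deriv r (\<zeta> - w) u / bump_mass r) + f \<zeta> * of_real (- bump_deriv r (\<zeta> - w) v / bump_mass r)" for \<zeta>
    proof -
      have "bump_deriv r (\<zeta> - w) (u + v) = bump_deriv r (\<zeta> - w) u + bump_deriv r (\<zeta> - w) v"
        by (simp add: bump_deriv_def inner_add_right ring_distribs)
      then show ?thesis by (simp add: diff_divide_distrib ring_distribs)
    qed
    then show "smooth_deriv r f w (u + v) = smooth_deriv r f w u + smooth_deriv r f w v"
      unfolding smooth_deriv_def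
      using integrable_smooth_deriv[OF r f w] by (simp only: Bochner_Integration.integral_add)
  next
    fix c :: real and v :: "complex^'n"
    have "f \<zeta> * of_real (- bump_deriv r (\<zeta> - w) (c *\<^sub>R v) / bump_mass r)
       = c *\<^sub>R (f \<zeta> * of_real (- bump_deriv r (\<zeta> - w) v / bump_mass r))" for \<zeta>
    proof -
      have "bump_deriv r (\<zeta> - w) (c *\<^sub>R v) = c * bump_deriv r (\<zeta> - w) v" by (simp add: bump_deriv_def)
      then show ?thesis by (simp add: scaleR_conv_of_real)
    qed
    then show "smooth_deriv r f w (c *\<^sub>R v) = c *\<^sub>R smooth_deriv r f w v"
      unfolding smooth_deriv_def
      using integrable_smooth_deriv[OF r f w] by (simp only: integral_scaleR_right)
  next
    show "cmod (smooth_deriv r f w v) \<le> norm v * (C * l2_norm \<mu> f)" for v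
      using C[of v] by (simp add: mult_ac)
  qed
qed

lemma smooth_has_derivative:
  assumes r: "r > 0" and f: "f \<in> L2 \<mu>" and w: "w \<in> \<Omega>"
  shows "(smooth r f has_derivative smooth_deriv r f w) (at w)"
proof -
  obtain C where C: "\<And>w'. w' \<in> \<Omega> \<Longrightarrow>
      cmod (smooth r f w' - smooth r f w - smooth_deriv r f w (w' - w)) \<le> C * (norm (w' - w))\<^sup>2 * l2_norm \<mu> f"
    using smooth_estimates[OF r] f w by metis
  show ?thesis
    by (rule has_derivative_quadratic_remainder[OF bounded_linear_smooth_deriv[OF assms] open_dom w, of _ "C * l2_norm \<mu> f"])
      (use C in \<open>simp add: mult_ac\<close>)
qed

lemma half_ball:
  assumes "z \<in> \<Omega>"
  obtains r where "r > 0" "ball z r \<subseteq> \<Omega>" "\<forall>w\<in>ball z r. ball w r \<subseteq> \<Omega>"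
proof -
  obtain s where s: "s > 0" "ball z s \<subseteq> \<Omega>" using assms open_dom open_contains_ball by blast
  have "ball w (s/2) \<subseteq> \<Omega>" if "w \<in> ball z (s/2)" for w
  proof -
    have "ball w (s/2) \<subseteq> ball z s" using that s(1) by (simp add: ball_subset_ball_iff dist_commute)
    with s(2) show ?thesis by blast
  qed
  with s show thesis by (intro that[of "s/2"]) (auto simp: subset_iff)
qed

lemma fderiv_smooth:
  assumes f: "f \<in> A2" and r: "r > 0" and B: "ball z r \<subseteq> \<Omega>" "\<forall>w\<in>ball z r. ball w r \<subseteq> \<Omega>" and w: "w \<in> ball z r"
  shows "fderiv f w = smooth_deriv r f w"
proof (rule fderiv_eq)
  have "w \<in> \<Omega>" using B(1) w by blast
  then have "(smooth r f has_derivative smooth_deriv r f w) (at w)"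
    by (rule smooth_has_derivative[OF r A2_L2[OF f]])
  then show "(f has_derivative smooth_deriv r f w) (at w)"
    by (rule has_derivative_transform_within_open[OF _ open_ball w]) (simp only: smooth_eq[OF f r B(2)[rule_format]])
qed

lemma A2_local_estimates:
  assumes z: "z \<in> \<Omega>"
  obtains r C where "r > 0" "C \<ge> 0" "ball z r \<subseteq> \<Omega>"
    "\<And>f w. f \<in> A2 \<Longrightarrow> w \<in> ball z r \<Longrightarrow> cmod (f w) \<le> C * l2_norm \<mu> f"
    "\<And>f w v. f \<in> A2 \<Longrightarrow> w \<in> ball z r \<Longrightarrow> cmod (fderiv f w v) \<le> C * norm v * l2_norm \<mu> f"
    "\<And>f w w'. f \<in> A2 \<Longrightarrow> w \<in> ball z r \<Longrightarrow> w' \<in> ball z r \<Longrightarrow>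
       cmod (f w' - f w - fderiv f w (w' - w)) \<le> C * (norm (w' - w))\<^sup>2 * l2_norm \<mu> f"
    "\<And>f w w' v. f \<in> A2 \<Longrightarrow> w \<in> ball z r \<Longrightarrow> w' \<in> ball z r \<Longrightarrow>
       cmod (fderiv f w' v - fderiv f w v) \<le> C * norm (w' - w) * norm v * l2_norm \<mu> f"
proof -
  obtain r where r: "r > 0" "ball z r \<subseteq> \<Omega>" "\<forall>w\<in>ball z r. ball w r \<subseteq> \<Omega>"
    using half_ball[OF z] by metis
  obtain C where C: "C \<ge> 0"
    "\<And>f w. f \<in> L2 \<mu> \<Longrightarrow> w \<in> \<Omega> \<Longrightarrow> cmod (smooth r f w) \<le> C * l2_norm \<mu> f"
    "\<And>f w v. f \<in> L2 \<mu> \<Longrightarrow> w \<in> \<Omega> \<Longrightarrow> cmod (smooth_deriv r f w v) \<le> C * norm v * l2_norm \<mu> f"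
    "\<And>f w w'. f \<in> L2 \<mu> \<Longrightarrow> w \<in> \<Omega> \<Longrightarrow> w' \<in> \<Omega> \<Longrightarrow>
       cmod (smooth r f w' - smooth r f w - smooth_deriv r f w (w' - w)) \<le> C * (norm (w' - w))\<^sup>2 * l2_norm \<mu> f"
    "\<And>f w w' v. f \<in> L2 \<mu> \<Longrightarrow> w \<in> \<Omega> \<Longrightarrow> w' \<in> \<Omega> \<Longrightarrow>
       cmod (smooth_deriv r f w' v - smooth_deriv r f w v) \<le> C * norm (w' - w) * norm v * l2_norm \<mu> f"
    by (rule smooth_estimates[OF r(1)]) (rule that)
  have in_dom: "w \<in> \<Omega>" if "w \<in> ball z r" for w using r(2) that by blast
  note eq = smooth_eq[OF _ r(1) r(3)[rule_format]] fderiv_smooth[OF _ r]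
  show thesis
  proof (rule that[OF r(1) C(1) r(2)])
    fix f w w' v assume f: "f \<in> A2" and w: "w \<in> ball z r"
    note f' = A2_L2[OF f]
    show "cmod (f w) \<le> C * l2_norm \<mu> f"
      using C(2)[OF f' in_dom[OF w]] by (simp only: eq[OF f w])
    show "cmod (fderiv f w v) \<le> C * norm v * l2_norm \<mu> f"
      using C(3)[OF f' in_dom[OF w]] by (simp only: eq[OF f w])
    assume w': "w' \<in> ball z r"
    show "cmod (f w' - f w - fderiv f w (w' - w)) \<le> C * (norm (w' - w))\<^sup>2 * l2_norm \<mu> f"
      using C(4)[OF f' in_dom[OF w] in_dom[OF w']] by (simp only: eq[OF f w] eq[OF f w'])
    show "cmod (fderiv f w' v - fderiv f w v) \<le> C * norm (w' - w) * norm v * l2_norm \<mu> f"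
      using C(5)[OF f' in_dom[OF w] in_dom[OF w']] by (simp only: eq[OF f w] eq[OF f w'])
  qed
qed

lemma A2_diff: "f \<in> A2 \<Longrightarrow> g \<in> A2 \<Longrightarrow> (\<lambda>x. f x - g x) \<in> A2"
  using holomorphic_several_add[of f \<Omega> "\<lambda>x. -1 * g x"] holomorphic_several_cmult[of g \<Omega> "-1"]
  by (simp add: bergman_space_iff L2_diff)

text \<open>The smoothing formula survives \<open>L\<^sup>2\<close> limits and can be differentiated.\<close>

lemma A2_complete:
  assumes X: "\<And>n. X n \<in> A2" "l2_Cauchy \<mu> X"
  shows "\<exists>g\<in>A2. (\<lambda>n. l2_norm \<mu> (\<lambda>x. X n x - g x)) \<longlonglongrightarrow> 0"
proof -
  have "Cauchy (\<lambda>n. X n z)" if z: "z \<in> \<Omega>" for z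
  proof (rule CauchyI)
    fix e :: real assume e: "e > 0"
    obtain r C where rC: "r > 0" "C \<ge> 0" "\<And>f w. f \<in> A2 \<Longrightarrow> w \<in> ball z r \<Longrightarrow> cmod (f w) \<le> C * l2_norm \<mu> f"
      using A2_local_estimates[OF z] by metis
    have "e / (C + 1) > 0" using e rC(2) by simp
    then obtain N where N: "\<And>m n. m \<ge> N \<Longrightarrow> n \<ge> N \<Longrightarrow> l2_norm \<mu> (\<lambda>x. X m x - X n x) < e / (C + 1)"
      using X(2) unfolding l2_Cauchy_def by metis
    have "cmod (X m z - X n z) < e" if "m \<ge> N" "n \<ge> N" for m n
    proof -
      have "cmod (X m z - X n z) \<le> C * l2_norm \<mu> (\<lambda>x. X m x - X n x)"
        using rC(3)[OF A2_diff[OF X(1) X(1)], of z] rC(1) by simp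
      also have "\<dots> \<le> C * (e / (C + 1))" using N[OF that] rC(2) by (intro mult_left_mono) auto
      also have "\<dots> < e" using rC(2) e by (simp add: field_simps)
      finally show ?thesis .
    qed
    then show "\<exists>N. \<forall>m\<ge>N. \<forall>n\<ge>N. norm (X m z - X n z) < e" by blast
  qed
  then have "\<exists>l. (\<lambda>n. X n z) \<longlonglongrightarrow> l" if "z \<in> \<Omega>" for z
    using that by (simp add: convergent_def[symmetric] Cauchy_convergent_iff)
  then obtain g where g: "\<And>z. z \<in> \<Omega> \<Longrightarrow> (\<lambda>n. X n z) \<longlonglongrightarrow> g z" by metis
  note XL2 = A2_L2[OF X(1)]
  have gL2: "g \<in> L2 \<mu>" and lim: "(\<lambda>n. l2_norm \<mu> (\<lambda>x. X n x - g x)) \<longlonglongrightarrow> 0"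
    using l2_Cauchy_pointwise_limit[OF XL2 X(2), of g] g by simp_all
  have "holomorphic_several g \<Omega>"
    unfolding holomorphic_several_def
  proof
    fix z assume z: "z \<in> \<Omega>"
    obtain r where r: "r > 0" "ball z r \<subseteq> \<Omega>" "\<forall>w\<in>ball z r. ball w r \<subseteq> \<Omega>"
      using half_ball[OF z] by metis
    obtain C where C: "\<And>f w. f \<in> L2 \<mu> \<Longrightarrow> w \<in> \<Omega> \<Longrightarrow> cmod (smooth r f w) \<le> C * l2_norm \<mu> f"
      "\<And>f w v. f \<in> L2 \<mu> \<Longrightarrow> w \<in> \<Omega> \<Longrightarrow> cmod (smooth_deriv r f w v) \<le> C * norm v * l2_norm \<mu> f"
      using smooth_estimates[OF r(1)] by metis
    have eq: "smooth r g w = g w" if w: "w \<in> ball z r" for w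
    proof -
      have w': "w \<in> \<Omega>" using w r(2) by blast
      have "(\<lambda>n. smooth r (X n) w) \<longlonglongrightarrow> smooth r g w"
      proof (rule LIM_zero_cancel, rule Lim_null_comparison)
        show "\<forall>\<^sub>F n in sequentially. cmod (smooth r (X n) w - smooth r g w) \<le> C * l2_norm \<mu> (\<lambda>x. X n x - g x)"
          using C(1)[OF L2_diff[OF XL2 gL2] w'] by (simp add: smooth_diff[OF r(1) XL2 gL2])
      qed (rule tendsto_mult_right_zero[OF lim])
      then have "(\<lambda>n. X n w) \<longlonglongrightarrow> smooth r g w" by (simp only: smooth_eq[OF X(1) r(1) r(3)[rule_format, OF w]])
      then show ?thesis using g[OF w'] LIMSEQ_unique by blast
    qed
    have "(smooth r g has_derivative smooth_deriv r g z) (at z)"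
      by (rule smooth_has_derivative[OF r(1) gL2 z])
    then have "(g has_derivative smooth_deriv r g z) (at z)"
      by (rule has_derivative_transform_within_open[OF _ open_ball]) (use r(1) eq in auto)
    moreover have dlim: "(\<lambda>n. fderiv (X n) z v) \<longlonglongrightarrow> smooth_deriv r g z v" for v
    proof (rule LIM_zero_cancel, rule Lim_null_comparison)
      show "\<forall>\<^sub>F n in sequentially. cmod (fderiv (X n) z v - smooth_deriv r g z v) \<le> C * norm v * l2_norm \<mu> (\<lambda>x. X n x - g x)"
        using C(2)[OF L2_diff[OF XL2 gL2] z]
        by (simp add: smooth_deriv_diff[OF r(1) XL2 gL2 z] fderiv_smooth[OF X(1) r] r(1))
    qed (rule tendsto_mult_right_zero[OF lim])
    have "smooth_deriv r g z (c *s v) = c * smooth_deriv r g z v" for c v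
    proof (rule LIMSEQ_unique[OF dlim])
      show "(\<lambda>n. fderiv (X n) z (c *s v)) \<longlonglongrightarrow> c * smooth_deriv r g z v"
        using holomorphic_several_fderiv(2)[OF A2_holomorphic[OF X(1)] z] dlim[of v]
        by (simp add: tendsto_mult_left)
    qed
    ultimately show "\<exists>D. (g has_derivative D) (at z) \<and> (\<forall>c v. D (c *s v) = c * D v)" by blast
  qed
  with gL2 lim show ?thesis by (auto simp: bergman_space_iff)
qed

sublocale l2_subspace \<mu> A2
proof
  show "A2 \<subseteq> L2 \<mu>" by (auto simp: bergman_space_iff)
  show "(\<lambda>_. 0) \<in> A2" by (simp add: bergman_space_iff holomorphic_several_const)
  show "f \<in> A2 \<Longrightarrow> g \<in> A2 \<Longrightarrow> (\<lambda>x. f x + g x) \<in> A2" for f g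
    by (simp add: bergman_space_iff holomorphic_several_add L2_add)
  show "f \<in> A2 \<Longrightarrow> (\<lambda>x. c * f x) \<in> A2" for f c
    by (simp add: bergman_space_iff holomorphic_several_cmult L2_cmult)
qed (rule A2_complete)

lemma A2_cong:
  assumes f: "f \<in> A2" and eq: "\<And>x. x \<in> \<Omega> \<Longrightarrow> f x = g x"
  shows "g \<in> A2"
proof -
  have "holomorphic_several g \<Omega>"
    unfolding holomorphic_several_def
  proof
    fix z assume z: "z \<in> \<Omega>"
    have "(g has_derivative fderiv f z) (at z)"
      by (rule has_derivative_transform_within_open[OF holomorphic_several_fderiv(1)[OF A2_holomorphic[OF f] z] open_dom z eq])
    then show "\<exists>D. (g has_derivative D) (at z) \<and> (\<forall>c v. D (c *s v) = c * D v)"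
      using holomorphic_several_fderiv(2)[OF A2_holomorphic[OF f] z] by blast
  qed
  moreover have "set_integrable lborel \<Omega> (\<lambda>\<zeta>. (cmod (g \<zeta>))\<^sup>2)"
  proof -
    have "(\<lambda>\<zeta>. indicator \<Omega> \<zeta> *\<^sub>R (cmod (g \<zeta>))\<^sup>2) = (\<lambda>\<zeta>. indicator \<Omega> \<zeta> *\<^sub>R (cmod (f \<zeta>))\<^sup>2)"
      using eq by (auto simp: fun_eq_iff indicator_def)
    then show ?thesis using f by (simp add: bergman_space_def set_integrable_def)
  qed
  ultimately show ?thesis by (simp add: bergman_space_def)
qed

lemma l2_inner_mu_cong: "(\<And>x. x \<in> \<Omega> \<Longrightarrow> g x = h x) \<Longrightarrow> l2_inner \<mu> f g = l2_inner \<mu> f h"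
  unfolding l2_inner_def by (rule Bochner_Integration.integral_cong) auto

lemma A2_const: "(\<lambda>_. c) \<in> A2"
  unfolding bergman_space_iff L2_def
  by (simp add: holomorphic_several_const finite_measure.integrable_const[OF finite_mu])

lemma A2_component: "(\<lambda>z. z $ i) \<in> A2"
proof -
  obtain b where b: "\<forall>x\<in>\<Omega>. norm x \<le> b" using bounded_dom bounded_pos by blast
  have m: "(\<lambda>z. z $ i) \<in> borel_measurable \<mu>"
    by (intro mu_measurable_continuous continuous_intros)
  have "integrable \<mu> (\<lambda>z. (cmod (z $ i))\<^sup>2)"
  proof (rule Bochner_Integration.integrable_bound[OF finite_measure.integrable_const[OF finite_mu, of "b\<^sup>2"]])
    show "(\<lambda>z. (cmod (z $ i))\<^sup>2) \<in> borel_measurable \<mu>" using m by measurable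
    have "(cmod (x $ i))\<^sup>2 \<le> b\<^sup>2" if "x \<in> \<Omega>" for x
      using b that Finite_Cartesian_Product.norm_nth_le[of x i] by (intro power_mono) (auto intro: order_trans)
    then show "AE x in \<mu>. norm ((cmod (x $ i))\<^sup>2) \<le> norm (b\<^sup>2)" by (intro AE_I2) simp
  qed
  then show ?thesis using m by (simp add: bergman_space_iff holomorphic_several_component L2_def)
qed

theorem is_bergman_kernel_bergman_kernel: "is_bergman_kernel \<Omega> (bergman_kernel \<Omega>)"
proof -
  have "\<exists>k\<in>A2. \<forall>f\<in>A2. f w = l2_inner \<mu> f k" if w: "w \<in> \<Omega>" for w
  proof -
    obtain r C where "r > 0" "\<And>f w'. f \<in> A2 \<Longrightarrow> w' \<in> ball w r \<Longrightarrow> cmod (f w') \<le> C * l2_norm \<mu> f"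
      using A2_local_estimates[OF w] by metis
    then have "cmod (f w) \<le> C * l2_norm \<mu> f" if "f \<in> A2" for f using that by simp
    then show ?thesis by (intro riesz[of "\<lambda>f. f w" C]) simp_all
  qed
  then obtain k where "\<And>w. w \<in> \<Omega> \<Longrightarrow> k w \<in> A2 \<and> (\<forall>f\<in>A2. f w = l2_inner \<mu> f (k w))" by metis
  then have "is_bergman_kernel \<Omega> (\<lambda>\<zeta> w. k w \<zeta>)"
    by (auto simp: is_bergman_kernel_def l2_inner_def integral_mu)
  then show ?thesis unfolding bergman_kernel_def by (rule someI[of "is_bergman_kernel \<Omega>"])
qed

definition k :: "complex^'n \<Rightarrow> complex^'n \<Rightarrow> complex" where
  "k w \<zeta> = bergman_kernel \<Omega> \<zeta> w"

text \<open>The function \<open>k' w v\<close> represents \<open>f \<mapsto> \<partial>\<^sub>v f w\<close> and is the derivative of \<open>w \<mapsto> k w\<close> in direction \<open>v\<close>.\<close>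

definition k' :: "complex^'n \<Rightarrow> complex^'n \<Rightarrow> complex^'n \<Rightarrow> complex" where
  "k' w v \<xi> = cnj (fderiv (k \<xi>) w v)"

lemma
  assumes w: "w \<in> \<Omega>"
  shows k_A2: "k w \<in> A2" and k_reproducing: "f \<in> A2 \<Longrightarrow> l2_inner \<mu> f (k w) = f w"
proof -
  have K: "(\<lambda>\<zeta>. bergman_kernel \<Omega> \<zeta> w) \<in> A2"
    "\<forall>f\<in>A2. f w = (LINT \<zeta>:\<Omega>|lborel. f \<zeta> * cnj (bergman_kernel \<Omega> \<zeta> w))"
    using is_bergman_kernel_bergman_kernel w unfolding is_bergman_kernel_def by blast+
  have k: "k w = (\<lambda>\<zeta>. bergman_kernel \<Omega> \<zeta> w)" by (rule ext) (rule k_def)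
  show "k w \<in> A2" unfolding k by (rule K(1))
  show "f \<in> A2 \<Longrightarrow> l2_inner \<mu> f (k w) = f w"
    unfolding k l2_inner_def integral_mu by (rule K(2)[rule_format, symmetric])
qed

lemma k_commute:
  assumes z: "z \<in> \<Omega>" and w: "w \<in> \<Omega>"
  shows "k z w = cnj (k w z)"
proof -
  have "k z w = l2_inner \<mu> (k z) (k w)" by (rule k_reproducing[OF w k_A2[OF z], symmetric])
  also have "\<dots> = cnj (l2_inner \<mu> (k w) (k z))" by (rule l2_inner_commute)
  also have "l2_inner \<mu> (k w) (k z) = k w z" by (rule k_reproducing[OF z k_A2[OF w]])
  finally show ?thesis .
qed

lemma k'_A2: "w \<in> \<Omega> \<Longrightarrow> k' w v \<in> A2"
  and k'_reproducing: "w \<in> \<Omega> \<Longrightarrow> f \<in> A2 \<Longrightarrow> l2_inner \<mu> f (k' w v) = fderiv f w v"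
proof -
  assume w: "w \<in> \<Omega>"
  note D = holomorphic_several_fderiv(1)[OF A2_holomorphic w]
  obtain r C where "r > 0" "\<And>f w' v. f \<in> A2 \<Longrightarrow> w' \<in> ball w r \<Longrightarrow> cmod (fderiv f w' v) \<le> C * norm v * l2_norm \<mu> f"
    using A2_local_estimates[OF w] by metis
  then have bd: "cmod (fderiv f w v) \<le> C * norm v * l2_norm \<mu> f" if "f \<in> A2" for f using that by simp
  have "\<exists>g\<in>A2. \<forall>f\<in>A2. fderiv f w v = l2_inner \<mu> f g"
  proof (rule riesz[OF _ _ bd])
    show "fderiv (\<lambda>x. f x + g x) w v = fderiv f w v + fderiv g w v" if "f \<in> A2" "g \<in> A2" for f g
      using fderiv_eq[OF has_derivative_add[OF D[OF that(1)] D[OF that(2)]]] by simp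
    show "fderiv (\<lambda>x. c * f x) w v = c * fderiv f w v" if "f \<in> A2" for f c
      using fderiv_eq[OF has_derivative_mult_right[OF D[OF that]]] by simp
  qed
  then obtain g where g: "g \<in> A2" "\<And>f. f \<in> A2 \<Longrightarrow> fderiv f w v = l2_inner \<mu> f g" by blast
  have eq: "g \<xi> = k' w v \<xi>" if "\<xi> \<in> \<Omega>" for \<xi>
    unfolding k'_def g(2)[OF k_A2[OF that]] by (metis k_reproducing[OF that g(1)] l2_inner_commute)
  show "k' w v \<in> A2" using A2_cong[OF g(1) eq] .
  assume f: "f \<in> A2"
  have "l2_inner \<mu> f (k' w v) = l2_inner \<mu> f g" by (rule l2_inner_mu_cong[OF eq, symmetric])
  then show "l2_inner \<mu> f (k' w v) = fderiv f w v" using g(2)[OF f] by simp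
qed

lemma k_local_estimates:
  assumes z: "z \<in> \<Omega>"
  obtains r C where "r > 0" "C \<ge> 0" "ball z r \<subseteq> \<Omega>"
    "\<And>w. w \<in> ball z r \<Longrightarrow> l2_norm \<mu> (k w) \<le> C"
    "\<And>w v. w \<in> ball z r \<Longrightarrow> l2_norm \<mu> (k' w v) \<le> C * norm v"
    "\<And>w w'. w \<in> ball z r \<Longrightarrow> w' \<in> ball z r \<Longrightarrow>
       l2_norm \<mu> (\<lambda>\<xi>. k w' \<xi> - k w \<xi> - k' w (w' - w) \<xi>) \<le> C * (norm (w' - w))\<^sup>2"
    "\<And>w w'. w \<in> ball z r \<Longrightarrow> w' \<in> ball z r \<Longrightarrow>
       l2_norm \<mu> (\<lambda>\<xi>. k w' \<xi> - k w \<xi>) \<le> C * norm (w' - w)"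
    "\<And>w w' v. w \<in> ball z r \<Longrightarrow> w' \<in> ball z r \<Longrightarrow>
       l2_norm \<mu> (\<lambda>\<xi>. k' w' v \<xi> - k' w v \<xi>) \<le> C * norm (w' - w) * norm v"
proof -
  obtain r C where rC: "r > 0" "C \<ge> 0" "ball z r \<subseteq> \<Omega>"
    "\<And>f w. f \<in> A2 \<Longrightarrow> w \<in> ball z r \<Longrightarrow> cmod (f w) \<le> C * l2_norm \<mu> f"
    "\<And>f w v. f \<in> A2 \<Longrightarrow> w \<in> ball z r \<Longrightarrow> cmod (fderiv f w v) \<le> C * norm v * l2_norm \<mu> f"
    "\<And>f w w'. f \<in> A2 \<Longrightarrow> w \<in> ball z r \<Longrightarrow> w' \<in> ball z r \<Longrightarrow>
       cmod (f w' - f w - fderiv f w (w' - w)) \<le> C * (norm (w' - w))\<^sup>2 * l2_norm \<mu> f"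
    "\<And>f w w' v. f \<in> A2 \<Longrightarrow> w \<in> ball z r \<Longrightarrow> w' \<in> ball z r \<Longrightarrow>
       cmod (fderiv f w' v - fderiv f w v) \<le> C * norm (w' - w) * norm v * l2_norm \<mu> f"
    by (rule A2_local_estimates[OF z]) (rule that)
  have in_dom: "w \<in> \<Omega>" if "w \<in> ball z r" for w using rC(3) that by blast
  define C' where "C' = C * diam + C"
  have C': "C' \<ge> 0" "C \<le> C'" using rC(2) diam_pos by (auto simp: C'_def)
  have e1: "l2_norm \<mu> (k w) \<le> C" if w: "w \<in> ball z r" for w
    by (rule riesz_bound[OF k_A2[OF in_dom[OF w]] _ rC(2)])
      (simp only: k_reproducing[OF in_dom[OF w]] rC(4)[OF _ w])
  have e2: "l2_norm \<mu> (k' w v) \<le> C * norm v" if w: "w \<in> ball z r" for w v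
    by (rule riesz_bound[OF k'_A2[OF in_dom[OF w]]])
      (use rC(2) in \<open>simp_all only: k'_reproducing[OF in_dom[OF w]] rC(5)[OF _ w] mult_nonneg_nonneg norm_ge_zero\<close>)
  have e3: "l2_norm \<mu> (\<lambda>\<xi>. k w' \<xi> - k w \<xi> - k' w (w' - w) \<xi>) \<le> C * (norm (w' - w))\<^sup>2"
    if w: "w \<in> ball z r" and w': "w' \<in> ball z r" for w w'
  proof -
    note A = k_A2[OF in_dom[OF w]] k_A2[OF in_dom[OF w']] k'_A2[OF in_dom[OF w], of "w' - w"]
    have "l2_inner \<mu> f (\<lambda>\<xi>. k w' \<xi> - k w \<xi> - k' w (w' - w) \<xi>) = f w' - f w - fderiv f w (w' - w)"
      if f: "f \<in> A2" for f
      using A f by (simp only: l2_inner_diff_right inL2 L2_diff k_reproducing[OF in_dom[OF w] f] k_reproducing[OF in_dom[OF w'] f] k'_reproducing[OF in_dom[OF w] f])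
    then show ?thesis
      using A rC(2) by (intro riesz_bound diff) (simp_all only: rC(6)[OF _ w w'] mult_nonneg_nonneg zero_le_power2)
  qed
  have e5: "l2_norm \<mu> (\<lambda>\<xi>. k' w' v \<xi> - k' w v \<xi>) \<le> C * norm (w' - w) * norm v"
    if w: "w \<in> ball z r" and w': "w' \<in> ball z r" for w w' v
  proof -
    note A = k'_A2[OF in_dom[OF w], of v] k'_A2[OF in_dom[OF w'], of v]
    have "l2_inner \<mu> f (\<lambda>\<xi>. k' w' v \<xi> - k' w v \<xi>) = fderiv f w' v - fderiv f w v"
      if f: "f \<in> A2" for f
      using A f by (simp only: l2_inner_diff_right inL2 L2_diff k'_reproducing[OF in_dom[OF w] f] k'_reproducing[OF in_dom[OF w'] f])
    then show ?thesis
      using A rC(2) by (intro riesz_bound diff) (simp_all only: rC(7)[OF _ w w'] mult_nonneg_nonneg norm_ge_zero)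
  qed
  have e4: "l2_norm \<mu> (\<lambda>\<xi>. k w' \<xi> - k w \<xi>) \<le> C' * norm (w' - w)"
    if w: "w \<in> ball z r" and w': "w' \<in> ball z r" for w w'
  proof -
    let ?n = "norm (w' - w)"
    have "l2_norm \<mu> (\<lambda>\<xi>. k w' \<xi> - k w \<xi>) \<le> l2_norm \<mu> (k' w (w' - w)) + l2_norm \<mu> (\<lambda>\<xi>. k w' \<xi> - k w \<xi> - k' w (w' - w) \<xi>)"
      by (intro l2_norm_diff_le inL2 diff k_A2 k'_A2 in_dom w w')
    also have "\<dots> \<le> C * ?n + C * ?n\<^sup>2" using e2[OF w] e3[OF w w'] by (rule add_mono)
    also have "?n\<^sup>2 \<le> diam * ?n"
      using diam_le[OF in_dom[OF w'] in_dom[OF w]] by (simp add: power2_eq_square mult_right_mono)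
    then have "C * ?n + C * ?n\<^sup>2 \<le> C * ?n + C * (diam * ?n)" using rC(2) by (intro add_left_mono mult_left_mono)
    also have "\<dots> = C' * ?n" by (simp add: C'_def algebra_simps)
    finally show ?thesis .
  qed
  show thesis
  proof (rule that[OF rC(1) C'(1) rC(3)])
    fix w w' v assume w: "w \<in> ball z r"
    show "l2_norm \<mu> (k w) \<le> C'" using e1[OF w] C'(2) by linarith
    show "l2_norm \<mu> (k' w v) \<le> C' * norm v"
      by (rule order_trans[OF e2[OF w]]) (intro mult_right_mono C' norm_ge_zero)
    assume w': "w' \<in> ball z r"
    show "l2_norm \<mu> (\<lambda>\<xi>. k w' \<xi> - k w \<xi> - k' w (w' - w) \<xi>) \<le> C' * (norm (w' - w))\<^sup>2"
      by (rule order_trans[OF e3[OF w w']]) (intro mult_right_mono C' zero_le_power2)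
    show "l2_norm \<mu> (\<lambda>\<xi>. k w' \<xi> - k w \<xi>) \<le> C' * norm (w' - w)" by (rule e4[OF w w'])
    show "l2_norm \<mu> (\<lambda>\<xi>. k' w' v \<xi> - k' w v \<xi>) \<le> C' * norm (w' - w) * norm v"
      by (rule order_trans[OF e5[OF w w']]) (intro mult_right_mono C' norm_ge_zero)
  qed
qed

end

subsection \<open>Calculus of densities\<close>

lemma density_measure_cong:
  assumes "\<And>x. x \<in> \<Omega> \<Longrightarrow> \<phi> x = \<psi> x"
  shows "density_measure \<Omega> \<phi> = density_measure \<Omega> \<psi>"
proof -
  have "(\<lambda>x. indicator \<Omega> x *\<^sub>R \<phi> x) = (\<lambda>x. indicator \<Omega> x *\<^sub>R \<psi> x)"
    using assms by (auto simp: fun_eq_iff indicator_def)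
  then show ?thesis unfolding density_measure_def by simp
qed

lemma density_measure_add:
  assumes "set_integrable lborel \<Omega> \<phi>" "set_integrable lborel \<Omega> \<psi>"
  shows "density_measure \<Omega> (\<lambda>x. \<phi> x + \<psi> x) = density_measure \<Omega> \<phi> + density_measure \<Omega> \<psi>"
  using assms by (simp add: density_measure_def set_integrable_def plus_Abs ring_distribs)

lemma density_measure_cmult:
  assumes "set_integrable lborel \<Omega> \<phi>"
  shows "density_measure \<Omega> (\<lambda>x. c * \<phi> x) = c *\<^sub>R density_measure \<Omega> \<phi>"
  using assms by (simp add: density_measure_def set_integrable_def scaleR_Abs mult.left_commute)

lemma density_measure_diff:
  assumes "set_integrable lborel \<Omega> \<phi>" "set_integrable lborel \<Omega> \<psi>"
  shows "density_measure \<Omega> (\<lambda>x. \<phi> x - \<psi> x) = density_measure \<Omega> \<phi> - density_measure \<Omega> \<psi>"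
proof -
  have "set_integrable lborel \<Omega> (\<lambda>x. -1 * \<psi> x)" by (intro set_integrable_mult_right assms)
  from density_measure_add[OF assms(1) this] density_measure_cmult[OF assms(2), of "-1"]
  show ?thesis by simp
qed

lemma density_measure_eq_imp_AE:
  assumes "set_integrable lborel \<Omega> \<phi>" "set_integrable lborel \<Omega> \<psi>"
    and eq: "density_measure \<Omega> \<phi> = density_measure \<Omega> \<psi>"
  shows "AE x in lborel. x \<in> \<Omega> \<longrightarrow> \<phi> x = \<psi> x"
proof -
  have i: "set_integrable lborel \<Omega> (\<lambda>x. \<phi> x - \<psi> x)" using assms by (intro set_integral_diff)
  have "density_measure \<Omega> (\<lambda>x. \<phi> x - \<psi> x) = 0"
    using density_measure_diff[OF assms(1,2)] eq by simp
  then have "(LINT x:\<Omega>|lborel. \<bar>\<phi> x - \<psi> x\<bar>) = 0"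
    using norm_density_measure[OF i] by simp
  then have "(LINT x|lborel. \<bar>indicator \<Omega> x *\<^sub>R (\<phi> x - \<psi> x)\<bar>) = 0"
    by (simp add: set_lebesgue_integral_def abs_mult)
  then have "AE x in lborel. \<bar>indicator \<Omega> x *\<^sub>R (\<phi> x - \<psi> x)\<bar> = 0"
    using i by (subst (asm) integral_nonneg_eq_0_iff_AE) (auto simp: set_integrable_def intro!: integrable_abs)
  then show ?thesis by eventually_elim auto
qed

lemma continuous_AE_eq_imp_eq:
  fixes f g :: "'a::euclidean_space \<Rightarrow> real"
  assumes S: "open S" and f: "continuous_on S f" "continuous_on S g"
    and ae: "AE x in lborel. x \<in> S \<longrightarrow> f x = g x" and x: "x \<in> S"
  shows "f x = g x"
proof (rule ccontr)
  assume ne: "f x \<noteq> g x"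
  let ?T = "S \<inter> (\<lambda>x. f x - g x) -` (-{0})"
  have o: "open ?T" by (rule continuous_open_preimage) (use S f in \<open>auto intro: continuous_intros\<close>)
  have "AE x in lborel. x \<notin> ?T" using ae by eventually_elim auto
  then have "?T \<in> null_sets lborel" using o by (subst (asm) AE_iff_null_sets[symmetric]) auto
  then have "negligible ?T" by (simp add: negligible_iff_null_sets null_sets_completionI)
  moreover have "x \<in> ?T" using x ne by simp
  ultimately show False using open_not_negligible[OF o] by blast
qed

definition mass :: "'a::euclidean_space ac_measure \<Rightarrow> real" where
  "mass \<nu> = Rep_ac_measure \<nu> UNIV"

lemma bounded_linear_mass: "bounded_linear mass"
proof (rule bounded_linear_intro[of _ 1])
  fix \<nu> :: "'a ac_measure"
  obtain \<phi> where \<phi>: "integrable lborel \<phi>" "\<nu> = Abs_ac_measure (indef_integral \<phi>)" by (rule ac_measure_cases)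
  have "\<bar>LINT x|lborel. \<phi> x\<bar> \<le> (LINT x|lborel. \<bar>\<phi> x\<bar>)" by (rule integral_abs_bound)
  then show "norm (mass \<nu>) \<le> norm \<nu> * 1"
    using \<phi>(1) unfolding \<phi>(2) by (simp add: mass_def norm_Abs) (simp add: indef_integral_def set_lebesgue_integral_def)
qed (simp_all add: mass_def Rep_plus Rep_scaleR)

lemma mass_density_measure:
  "set_integrable lborel \<Omega> \<phi> \<Longrightarrow> mass (density_measure \<Omega> \<phi>) = (LINT x:\<Omega>|lborel. \<phi> x)"
  by (simp add: mass_def Rep_density_measure)

lemma continuous_on_locally_lipschitz:
  fixes f :: "'a::real_normed_vector \<Rightarrow> 'b::real_normed_vector"
  assumes "\<And>x. x \<in> S \<Longrightarrow> \<exists>r>0. \<exists>L. \<forall>y\<in>ball x r. norm (f y - f x) \<le> L * norm (y - x)"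
  shows "continuous_on S f"
proof (rule continuous_at_imp_continuous_on, rule ballI)
  fix x assume "x \<in> S"
  then obtain r L where r: "r > 0" "\<And>y. y \<in> ball x r \<Longrightarrow> norm (f y - f x) \<le> L * norm (y - x)" using assms by blast
  have "((\<lambda>y. f y - f x) \<longlongrightarrow> 0) (at x)"
  proof (rule Lim_null_comparison)
    show "\<forall>\<^sub>F y in at x. norm (f y - f x) \<le> L * norm (y - x)"
      using r unfolding eventually_at by (intro exI[of _ r]) (auto simp: dist_commute)
    have "((\<lambda>y. L * norm (y - x)) \<longlongrightarrow> L * norm (x - x)) (at x)" by (intro tendsto_intros)
    then show "((\<lambda>y. L * norm (y - x)) \<longlongrightarrow> 0) (at x)" by simp
  qed
  then show "isCont f x" unfolding isCont_def by (rule LIM_zero_cancel)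
qed

subsection \<open>Proportional holomorphic functions\<close>

text \<open>Near \<open>a\<close> the quotient \<open>f / g\<close> has constant real part or constant modulus; by the Cauchy-Riemann
  equations its derivative vanishes.\<close>

lemma proportional_on_domain:
  assumes f: "holomorphic_several f \<Omega>" and g: "holomorphic_several g \<Omega>"
    and \<Omega>: "open \<Omega>" "connected \<Omega>" and a: "a \<in> \<Omega>" "g a \<noteq> 0"
    and rel: "(\<forall>x\<in>\<Omega>. Re (f x * cnj (g x)) = \<alpha> * (cmod (g x))\<^sup>2) \<or> (\<alpha> > 0 \<and> (\<forall>x\<in>\<Omega>. (cmod (f x))\<^sup>2 = \<alpha> * (cmod (g x))\<^sup>2))"
  shows "\<exists>c. \<forall>x\<in>\<Omega>. f x = c * g x"
proof -
  have "open (\<Omega> \<inter> g -` (-{0}))"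
    by (rule continuous_open_preimage[OF holomorphic_several_imp_continuous_on[OF g]]) (use \<Omega> in auto)
  moreover have "a \<in> \<Omega> \<inter> g -` (-{0})" using a by simp
  ultimately obtain r where r: "r > 0" "ball a r \<subseteq> \<Omega> \<inter> g -` (-{0})" using open_contains_ball by blast
  then have in_dom: "x \<in> \<Omega>" "g x \<noteq> 0" if "x \<in> ball a r" for x using that by auto
  define h where "h x = f x / g x" for x
  have "(h has_derivative (\<lambda>_. 0)) (at x within ball a r)" if x: "x \<in> ball a r" for x
  proof -
    define D where "D v = (fderiv f x v * g x - f x * fderiv g x v) / (g x * g x)" for v
    have "(h has_derivative D) (at x)"
      unfolding h_def[abs_def] D_def[abs_def]
      by (rule has_derivative_divide'[OF holomorphic_several_fderiv(1)[OF f] holomorphic_several_fderiv(1)[OF g]])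
        (use in_dom[OF x] in auto)
    then have hD: "(h has_derivative D) (at x)" .
    have D_lin: "D (c *s v) = c * D v" for c v
      unfolding D_def holomorphic_several_fderiv(2)[OF f in_dom(1)[OF x]] holomorphic_several_fderiv(2)[OF g in_dom(1)[OF x]]
      by (simp add: algebra_simps)
    have "D v = 0" for v
      using rel
    proof
      assume rel: "\<forall>x\<in>\<Omega>. Re (f x * cnj (g x)) = \<alpha> * (cmod (g x))\<^sup>2"
      have "Re (h y) = \<alpha>" if y: "y \<in> ball a r" for y
      proof -
        have "h y = (f y * cnj (g y)) / (g y * cnj (g y))"
          using in_dom[OF y] by (simp add: h_def)
        then have "Re (h y) = Re (f y * cnj (g y)) / (cmod (g y))\<^sup>2"
          by (simp only: complex_norm_square[symmetric] Re_divide_of_real)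
        then show ?thesis using rel in_dom[OF y] by simp
      qed
      then have "((\<lambda>y. Re (h y)) has_derivative (\<lambda>_. 0)) (at x)"
        by (intro has_derivative_transform_within_open[OF has_derivative_const open_ball x]) auto
      moreover have "((\<lambda>y. Re (h y)) has_derivative (\<lambda>v. Re (D v))) (at x)"
        by (intro has_derivative_Re hD)
      ultimately have "(\<lambda>v. Re (D v)) = (\<lambda>_. 0)" by (metis has_derivative_unique)
      then have Re0: "Re (D v) = 0" for v by metis
      show "D v = 0" using Re0[of v] Re0[of "\<i> *s v"] by (simp add: D_lin complex_eq_iff)
    next
      assume rel: "\<alpha> > 0 \<and> (\<forall>x\<in>\<Omega>. (cmod (f x))\<^sup>2 = \<alpha> * (cmod (g x))\<^sup>2)"
      have mod: "h y \<bullet> h y = \<alpha>" if y: "y \<in> ball a r" for y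
      proof -
        have "(cmod (h y))\<^sup>2 = (cmod (f y))\<^sup>2 / (cmod (g y))\<^sup>2" by (simp add: h_def norm_divide power_divide)
        then show ?thesis using rel in_dom[OF y] by (simp add: power2_norm_eq_inner)
      qed
      then have "((\<lambda>y. h y \<bullet> h y) has_derivative (\<lambda>_. 0)) (at x)"
        by (intro has_derivative_transform_within_open[OF has_derivative_const open_ball x]) auto
      moreover have "((\<lambda>y. h y \<bullet> h y) has_derivative (\<lambda>v. h x \<bullet> D v + D v \<bullet> h x)) (at x)"
        by (intro has_derivative_inner hD)
      ultimately have "(\<lambda>v. h x \<bullet> D v + D v \<bullet> h x) = (\<lambda>_. 0)" by (metis has_derivative_unique)
      then have "h x \<bullet> D v + D v \<bullet> h x = 0" for v by metis
      then have i0: "h x \<bullet> D v = 0" for v by (simp add: inner_commute)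
      have "Re (h x) * Re (D v) + Im (h x) * Im (D v) = 0" "Im (h x) * Re (D v) - Re (h x) * Im (D v) = 0"
        using i0[of v] i0[of "\<i> *s v"] by (simp_all add: D_lin inner_complex_def algebra_simps)
      then have "cnj (h x) * D v = 0" by (simp add: complex_eq_iff algebra_simps)
      moreover have "h x \<noteq> 0" using mod[OF x] rel by auto
      ultimately show "D v = 0" by simp
    qed
    then have "D = (\<lambda>_. 0)" by (rule ext)
    then show ?thesis using has_derivative_at_withinI[OF hD] by simp
  qed
  then have "\<exists>c. \<forall>x\<in>ball a r. h x = c"
    by (intro has_derivative_zero_constant convex_ball)
  then obtain c where c: "\<And>x. x \<in> ball a r \<Longrightarrow> h x = c" by blast
  have hol: "holomorphic_several (\<lambda>x. f x + - c * g x) \<Omega>"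
    by (intro holomorphic_several_add holomorphic_several_cmult f g)
  have "f x + - c * g x = 0" if "x \<in> \<Omega>" for x
  proof (rule holomorphic_several_identity[OF hol \<Omega> open_ball _ _ _ that])
    show "ball a r \<noteq> {}" "ball a r \<subseteq> \<Omega>" using r by auto
    show "f z + - c * g z = 0" if "z \<in> ball a r" for z
      using c[OF that] in_dom[OF that] by (simp add: h_def field_simps)
  qed
  then show ?thesis by (intro exI[of _ c]) (simp add: algebra_simps)
qed

subsection \<open>The Bergman map\<close>

context bounded_open
begin

definition re_product :: "(complex^'n \<Rightarrow> complex) \<Rightarrow> (complex^'n \<Rightarrow> complex) \<Rightarrow> (complex^'n) ac_measure" where
  "re_product f g = density_measure \<Omega> (\<lambda>\<xi>. Re (f \<xi> * cnj (g \<xi>)))"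

lemma re_product_integrable:
  assumes "f \<in> L2 \<mu>" "g \<in> L2 \<mu>"
  shows "set_integrable lborel \<Omega> (\<lambda>\<xi>. Re (f \<xi> * cnj (g \<xi>)))"
  using integrable_Re[OF integrable_inner_L2[OF assms]] by (simp only: integrable_mu)

lemma norm_re_product_le:
  assumes f: "f \<in> L2 \<mu>" and g: "g \<in> L2 \<mu>"
  shows "norm (re_product f g) \<le> l2_norm \<mu> f * l2_norm \<mu> g"
proof -
  have "norm (re_product f g) = (LINT \<xi>|\<mu>. \<bar>Re (f \<xi> * cnj (g \<xi>))\<bar>)"
    unfolding re_product_def norm_density_measure[OF re_product_integrable[OF f g]] integral_mu ..
  also have "\<dots> \<le> (LINT \<xi>|\<mu>. cmod (f \<xi>) * cmod (g \<xi>))"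
  proof (rule Bochner_Integration.integral_mono)
    show "integrable \<mu> (\<lambda>\<xi>. \<bar>Re (f \<xi> * cnj (g \<xi>))\<bar>)"
      by (intro integrable_abs integrable_Re integrable_inner_L2 f g)
    show "\<bar>Re (f \<xi> * cnj (g \<xi>))\<bar> \<le> cmod (f \<xi>) * cmod (g \<xi>)" for \<xi>
      using abs_Re_le_cmod[of "f \<xi> * cnj (g \<xi>)"] by (simp only: norm_mult complex_mod_cnj)
  qed (rule integrable_norm_mult_L2[OF f g])
  also have "\<dots> \<le> l2_norm \<mu> f * l2_norm \<mu> g" by (rule integral_norm_mult_le_l2[OF f g])
  finally show ?thesis .
qed

lemma re_product_commute: "re_product f g = re_product g f"
  unfolding re_product_def by (rule density_measure_cong) (simp add: algebra_simps)

lemma re_product_add_right: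
  assumes "f \<in> L2 \<mu>" "g \<in> L2 \<mu>" "h \<in> L2 \<mu>"
  shows "re_product f (\<lambda>\<xi>. g \<xi> + h \<xi>) = re_product f g + re_product f h"
proof -
  have "re_product f (\<lambda>\<xi>. g \<xi> + h \<xi>) = density_measure \<Omega> (\<lambda>\<xi>. Re (f \<xi> * cnj (g \<xi>)) + Re (f \<xi> * cnj (h \<xi>)))"
    unfolding re_product_def by (rule density_measure_cong) (simp add: algebra_simps)
  then show ?thesis using assms by (simp only: density_measure_add re_product_integrable re_product_def)
qed

lemma re_product_diff_right:
  assumes "f \<in> L2 \<mu>" "g \<in> L2 \<mu>" "h \<in> L2 \<mu>"
  shows "re_product f (\<lambda>\<xi>. g \<xi> - h \<xi>) = re_product f g - re_product f h"
proof -
  have "re_product f (\<lambda>\<xi>. g \<xi> - h \<xi>) = density_measure \<Omega> (\<lambda>\<xi>. Re (f \<xi> * cnj (g \<xi>)) - Re (f \<xi> * cnj (h \<xi>)))"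
    unfolding re_product_def by (rule density_measure_cong) (simp add: algebra_simps)
  then show ?thesis using assms by (simp only: density_measure_diff re_product_integrable re_product_def)
qed

lemma mass_re_product: "f \<in> L2 \<mu> \<Longrightarrow> g \<in> L2 \<mu> \<Longrightarrow> mass (re_product f g) = Re (l2_inner \<mu> f g)"
  unfolding re_product_def l2_inner_def
  by (simp only: mass_density_measure re_product_integrable integral_mu[symmetric] Bochner_Integration.integral_Re integrable_inner_L2)

definition kernel_measure :: "complex^'n \<Rightarrow> (complex^'n) ac_measure" where
  "kernel_measure z = re_product (k z) (k z)"

definition kernel_measure_deriv :: "complex^'n \<Rightarrow> complex^'n \<Rightarrow> (complex^'n) ac_measure" where
  "kernel_measure_deriv z v = 2 *\<^sub>R re_product (k z) (k' z v)"

lemma k_L2: "z \<in> \<Omega> \<Longrightarrow> k z \<in> L2 \<mu>" and k'_L2: "z \<in> \<Omega> \<Longrightarrow> k' z v \<in> L2 \<mu>"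
  by (auto intro: A2_L2 k_A2 k'_A2)

lemma mass_kernel_measure: "z \<in> \<Omega> \<Longrightarrow> mass (kernel_measure z) = (l2_norm \<mu> (k z))\<^sup>2"
  unfolding kernel_measure_def by (simp add: mass_re_product k_L2 l2_inner_same)

lemma k_diag: "z \<in> \<Omega> \<Longrightarrow> k z z = of_real (mass (kernel_measure z))"
  using k_reproducing[OF _ k_A2, of z z] by (simp add: mass_kernel_measure l2_inner_same)

lemma mass_kernel_measure_pos:
  assumes z: "z \<in> \<Omega>" shows "mass (kernel_measure z) > 0"
proof -
  have "cmod (l2_inner \<mu> (\<lambda>_. 1) (k z)) \<le> l2_norm \<mu> (\<lambda>_. 1) * l2_norm \<mu> (k z)"
    by (intro norm_l2_inner_le A2_L2 A2_const k_A2 z)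
  then have "l2_norm \<mu> (k z) \<noteq> 0" by (auto simp: k_reproducing[OF z A2_const])
  then show ?thesis by (simp add: mass_kernel_measure[OF z])
qed

lemma k_diag_nonzero: "z \<in> \<Omega> \<Longrightarrow> k z z \<noteq> 0"
  using mass_kernel_measure_pos[of z] by (simp add: k_diag)

lemma bounded_linear_kernel_measure_deriv:
  assumes z: "z \<in> \<Omega>" shows "bounded_linear (kernel_measure_deriv z)"
proof -
  obtain r C where "r > 0" "\<And>w v. w \<in> ball z r \<Longrightarrow> l2_norm \<mu> (k' w v) \<le> C * norm v"
    using k_local_estimates[OF z] by metis
  then have C: "l2_norm \<mu> (k' z v) \<le> C * norm v" for v by simp
  have lin: "linear (fderiv (k \<xi>) z)" if "\<xi> \<in> \<Omega>" for \<xi>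
    using holomorphic_several_fderiv(1)[OF A2_holomorphic[OF k_A2[OF that]] z] has_derivative_linear by blast
  show ?thesis
  proof (rule bounded_linear_intro[of _ "2 * l2_norm \<mu> (k z) * C"])
    fix u v :: "complex^'n" and c :: real
    have "re_product (k z) (k' z (u + v)) = re_product (k z) (\<lambda>\<xi>. k' z u \<xi> + k' z v \<xi>)"
      unfolding re_product_def by (rule density_measure_cong) (simp add: k'_def linear_add[OF lin])
    then show "kernel_measure_deriv z (u + v) = kernel_measure_deriv z u + kernel_measure_deriv z v"
      by (simp add: kernel_measure_deriv_def re_product_add_right k_L2 k'_L2 z scaleR_add_right)
    have "re_product (k z) (k' z (c *\<^sub>R v)) = density_measure \<Omega> (\<lambda>\<xi>. c * Re (k z \<xi> * cnj (k' z v \<xi>)))"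
      unfolding re_product_def
    proof (rule density_measure_cong)
      fix \<xi> assume "\<xi> \<in> \<Omega>"
      then have "k' z (c *\<^sub>R v) \<xi> = of_real c * k' z v \<xi>"
        unfolding k'_def linear_scale[OF lin[OF \<open>\<xi> \<in> \<Omega>\<close>]] by (simp add: scaleR_conv_of_real)
      then show "Re (k z \<xi> * cnj (k' z (c *\<^sub>R v) \<xi>)) = c * Re (k z \<xi> * cnj (k' z v \<xi>))"
        by (simp add: algebra_simps)
    qed
    also have "\<dots> = c *\<^sub>R re_product (k z) (k' z v)"
      unfolding re_product_def by (rule density_measure_cmult[OF re_product_integrable[OF k_L2[OF z] k'_L2[OF z]]])
    finally show "kernel_measure_deriv z (c *\<^sub>R v) = c *\<^sub>R kernel_measure_deriv z v" by (simp add: kernel_measure_deriv_def)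
    have "norm (kernel_measure_deriv z v) = 2 * norm (re_product (k z) (k' z v))" by (simp add: kernel_measure_deriv_def)
    also have "norm (re_product (k z) (k' z v)) \<le> l2_norm \<mu> (k z) * (C * norm v)"
      by (rule order_trans[OF norm_re_product_le[OF k_L2[OF z] k'_L2[OF z]]]) (intro mult_left_mono C l2_norm_nonneg)
    finally show "norm (kernel_measure_deriv z v) \<le> norm v * (2 * l2_norm \<mu> (k z) * C)" by (simp add: mult_ac)
  qed
qed

lemma kernel_measure_has_derivative:
  assumes z: "z \<in> \<Omega>" shows "(kernel_measure has_derivative kernel_measure_deriv z) (at z)"
proof -
  obtain r C where rC: "r > 0" "C \<ge> 0" "ball z r \<subseteq> \<Omega>"
    "\<And>w. w \<in> ball z r \<Longrightarrow> l2_norm \<mu> (k w) \<le> C"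
    "\<And>w v. w \<in> ball z r \<Longrightarrow> l2_norm \<mu> (k' w v) \<le> C * norm v"
    "\<And>w w'. w \<in> ball z r \<Longrightarrow> w' \<in> ball z r \<Longrightarrow>
       l2_norm \<mu> (\<lambda>\<xi>. k w' \<xi> - k w \<xi> - k' w (w' - w) \<xi>) \<le> C * (norm (w' - w))\<^sup>2"
    "\<And>w w'. w \<in> ball z r \<Longrightarrow> w' \<in> ball z r \<Longrightarrow>
       l2_norm \<mu> (\<lambda>\<xi>. k w' \<xi> - k w \<xi>) \<le> C * norm (w' - w)"
    by (rule k_local_estimates[OF z]) (rule that)
  have zb: "z \<in> ball z r" using rC(1) by simp
  show ?thesis
  proof (rule has_derivative_quadratic_remainder[OF bounded_linear_kernel_measure_deriv[OF z] open_ball zb])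
    fix w assume w: "w \<in> ball z r"
    have wd: "w \<in> \<Omega>" using w rC(3) by blast
    define a b c where "a = k z" and "b = k w" and "c = k' z (w - z)"
    have L2s: "a \<in> L2 \<mu>" "b \<in> L2 \<mu>" "c \<in> L2 \<mu>"
      using k_L2[OF z] k_L2[OF wd] k'_L2[OF z] by (auto simp: a_def b_def c_def)
    let ?e = "\<lambda>\<xi>. b \<xi> - a \<xi> - c \<xi>" and ?n = "norm (w - z)"
    have e: "?e \<in> L2 \<mu>" "(\<lambda>\<xi>. b \<xi> + a \<xi>) \<in> L2 \<mu>" "(\<lambda>\<xi>. b \<xi> - a \<xi>) \<in> L2 \<mu>"
      by (intro L2_diff L2_add L2s)+
    have "re_product ?e g = re_product b g - re_product a g - re_product c g" if "g \<in> L2 \<mu>" for g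
      using that L2s e by (simp only: re_product_commute[of _ g] re_product_diff_right)
    then have "re_product ?e (\<lambda>\<xi>. b \<xi> + a \<xi>) = (re_product b b - re_product a b - re_product c b) + (re_product b a - re_product a a - re_product c a)"
      using L2s e by (simp only: re_product_add_right)
    moreover have "re_product c (\<lambda>\<xi>. b \<xi> - a \<xi>) = re_product c b - re_product c a"
      using L2s by (simp only: re_product_diff_right)
    ultimately have "kernel_measure w - kernel_measure z - kernel_measure_deriv z (w - z) = re_product ?e (\<lambda>\<xi>. b \<xi> + a \<xi>) + re_product c (\<lambda>\<xi>. b \<xi> - a \<xi>)"
      using re_product_commute[of a b] re_product_commute[of a c]
      by (simp add: kernel_measure_def kernel_measure_deriv_def a_def[symmetric] b_def[symmetric] c_def[symmetric] scaleR_2)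
    also have "norm \<dots> \<le> l2_norm \<mu> ?e * l2_norm \<mu> (\<lambda>\<xi>. b \<xi> + a \<xi>) + l2_norm \<mu> c * l2_norm \<mu> (\<lambda>\<xi>. b \<xi> - a \<xi>)"
      by (intro order_trans[OF norm_triangle_ineq] add_mono norm_re_product_le L2s e)
    also have "\<dots> \<le> (C * ?n\<^sup>2) * (C + C) + (C * ?n) * (C * ?n)"
    proof (intro add_mono mult_mono)
      show "l2_norm \<mu> ?e \<le> C * ?n\<^sup>2" unfolding a_def b_def c_def by (rule rC(6)[OF zb w])
      show "l2_norm \<mu> (\<lambda>\<xi>. b \<xi> + a \<xi>) \<le> C + C"
        by (rule order_trans[OF l2_norm_add_le[OF L2s(2,1)]]) (unfold a_def b_def, intro add_mono rC(4) zb w)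
      show "l2_norm \<mu> c \<le> C * ?n" unfolding c_def by (rule rC(5)[OF zb])
      show "l2_norm \<mu> (\<lambda>\<xi>. b \<xi> - a \<xi>) \<le> C * ?n" unfolding a_def b_def by (rule rC(7)[OF zb w])
    qed (use rC(2) in simp_all)
    also have "\<dots> = (3 * C\<^sup>2) * ?n\<^sup>2" by (simp add: power2_eq_square algebra_simps)
    finally show "norm (kernel_measure w - kernel_measure z - kernel_measure_deriv z (w - z)) \<le> (3 * C\<^sup>2) * (norm (w - z))\<^sup>2" .
  qed
qed

definition kernel_measure_blinfun :: "complex^'n \<Rightarrow> (complex^'n) \<Rightarrow>\<^sub>L (complex^'n) ac_measure" where
  "kernel_measure_blinfun z = Blinfun (kernel_measure_deriv z)"

lemma kernel_measure_blinfun_apply: "z \<in> \<Omega> \<Longrightarrow> blinfun_apply (kernel_measure_blinfun z) = kernel_measure_deriv z"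
  unfolding kernel_measure_blinfun_def by (rule bounded_linear_Blinfun_apply[OF bounded_linear_kernel_measure_deriv])

lemma continuous_on_kernel_measure_blinfun: "continuous_on \<Omega> kernel_measure_blinfun"
proof (rule continuous_on_locally_lipschitz)
  fix z assume z: "z \<in> \<Omega>"
  obtain r C where rC: "r > 0" "C \<ge> 0" "ball z r \<subseteq> \<Omega>"
    "\<And>w. w \<in> ball z r \<Longrightarrow> l2_norm \<mu> (k w) \<le> C"
    "\<And>w v. w \<in> ball z r \<Longrightarrow> l2_norm \<mu> (k' w v) \<le> C * norm v"
    "\<And>w w'. w \<in> ball z r \<Longrightarrow> w' \<in> ball z r \<Longrightarrow>
       l2_norm \<mu> (\<lambda>\<xi>. k w' \<xi> - k w \<xi>) \<le> C * norm (w' - w)"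
    "\<And>w w' v. w \<in> ball z r \<Longrightarrow> w' \<in> ball z r \<Longrightarrow>
       l2_norm \<mu> (\<lambda>\<xi>. k' w' v \<xi> - k' w v \<xi>) \<le> C * norm (w' - w) * norm v"
    by (rule k_local_estimates[OF z]) (rule that)
  have zb: "z \<in> ball z r" using rC(1) by simp
  have "norm (kernel_measure_blinfun w - kernel_measure_blinfun z) \<le> 4 * C\<^sup>2 * norm (w - z)" if w: "w \<in> ball z r" for w
  proof (rule norm_blinfun_bound)
    show "0 \<le> 4 * C\<^sup>2 * norm (w - z)" by simp
    fix v :: "complex^'n"
    have wd: "w \<in> \<Omega>" using w rC(3) by blast
    let ?n = "norm (w - z)"
    note L2s = k_L2[OF z] k_L2[OF wd] k'_L2[OF z, of v] k'_L2[OF wd, of v]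
    have eq: "kernel_measure_deriv w v - kernel_measure_deriv z v = 2 *\<^sub>R (re_product (k' w v) (\<lambda>\<xi>. k w \<xi> - k z \<xi>) + re_product (k z) (\<lambda>\<xi>. k' w v \<xi> - k' z v \<xi>))"
      unfolding kernel_measure_deriv_def re_product_diff_right[OF L2s(4,2,1)] re_product_diff_right[OF L2s(1,4,3)]
        re_product_commute[of "k' w v" "k w"] re_product_commute[of "k' w v" "k z"]
      by (simp add: algebra_simps)
    have "norm (kernel_measure_deriv w v - kernel_measure_deriv z v) = 2 * norm (re_product (k' w v) (\<lambda>\<xi>. k w \<xi> - k z \<xi>) + re_product (k z) (\<lambda>\<xi>. k' w v \<xi> - k' z v \<xi>))"
      unfolding eq by simp
    also have "\<dots> \<le> 2 * ((C * norm v) * (C * ?n) + C * (C * ?n * norm v))"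
    proof -
      have "norm (re_product (k' w v) (\<lambda>\<xi>. k w \<xi> - k z \<xi>)) \<le> l2_norm \<mu> (k' w v) * l2_norm \<mu> (\<lambda>\<xi>. k w \<xi> - k z \<xi>)"
        by (rule norm_re_product_le[OF L2s(4) L2_diff[OF L2s(2,1)]])
      also have "\<dots> \<le> (C * norm v) * (C * ?n)"
        by (rule mult_mono[OF rC(5)[OF w] rC(6)[OF zb w]]) (simp_all add: rC(2))
      finally have 1: "norm (re_product (k' w v) (\<lambda>\<xi>. k w \<xi> - k z \<xi>)) \<le> (C * norm v) * (C * ?n)" .
      have "norm (re_product (k z) (\<lambda>\<xi>. k' w v \<xi> - k' z v \<xi>)) \<le> l2_norm \<mu> (k z) * l2_norm \<mu> (\<lambda>\<xi>. k' w v \<xi> - k' z v \<xi>)"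
        by (rule norm_re_product_le[OF L2s(1) L2_diff[OF L2s(4,3)]])
      also have "\<dots> \<le> C * (C * ?n * norm v)"
        by (rule mult_mono[OF rC(4)[OF zb] rC(7)[OF zb w]]) (simp_all add: rC(2))
      finally have 2: "norm (re_product (k z) (\<lambda>\<xi>. k' w v \<xi> - k' z v \<xi>)) \<le> C * (C * ?n * norm v)" .
      show ?thesis
        by (rule mult_left_mono[OF order_trans[OF norm_triangle_ineq add_mono[OF 1 2]]]) simp
    qed
    finally show "norm (blinfun_apply (kernel_measure_blinfun w - kernel_measure_blinfun z) v) \<le> 4 * C\<^sup>2 * norm (w - z) * norm v"
      by (simp add: blinfun.diff_left kernel_measure_blinfun_apply z wd power2_eq_square mult_ac)
  qed
  then show "\<exists>r>0. \<exists>L. \<forall>w\<in>ball z r. norm (kernel_measure_blinfun w - kernel_measure_blinfun z) \<le> L * norm (w - z)" using rC(1) by blast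
qed

definition mass_blinfun :: "(complex^'n) ac_measure \<Rightarrow>\<^sub>L real" where
  "mass_blinfun = Blinfun mass"

lemma mass_blinfun_apply [simp]: "blinfun_apply mass_blinfun = mass"
  unfolding mass_blinfun_def by (rule bounded_linear_Blinfun_apply[OF bounded_linear_mass])

definition bergman_map_deriv :: "complex^'n \<Rightarrow> (complex^'n) \<Rightarrow>\<^sub>L (complex^'n) ac_measure" where
  "bergman_map_deriv z = inverse (mass (kernel_measure z)) *\<^sub>R kernel_measure_blinfun z
     - (blinfun_scaleR_left (kernel_measure z) o\<^sub>L ((inverse (mass (kernel_measure z)))\<^sup>2 *\<^sub>R (mass_blinfun o\<^sub>L kernel_measure_blinfun z)))"

lemma bergman_map_deriv_apply:
  "z \<in> \<Omega> \<Longrightarrow> blinfun_apply (bergman_map_deriv z) v = inverse (mass (kernel_measure z)) *\<^sub>R kernel_measure_deriv z v - ((inverse (mass (kernel_measure z)))\<^sup>2 * mass (kernel_measure_deriv z v)) *\<^sub>R kernel_measure z"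
  by (simp add: bergman_map_deriv_def blinfun.diff_left blinfun.scaleR_left kernel_measure_blinfun_apply)

lemma bergman_density_eq:
  assumes z: "z \<in> \<Omega>" and \<xi>: "\<xi> \<in> \<Omega>"
  shows "bergman_density \<Omega> z \<xi> = inverse (mass (kernel_measure z)) * Re (k z \<xi> * cnj (k z \<xi>))"
proof -
  have "bergman_kernel \<Omega> z \<xi> = cnj (k z \<xi>)" "bergman_kernel \<Omega> z z = of_real (mass (kernel_measure z))"
    using k_commute[OF \<xi> z] k_diag[OF z] by (simp_all add: k_def)
  moreover have "k z \<xi> * cnj (k z \<xi>) = of_real ((cmod (k z \<xi>))\<^sup>2)" by (rule complex_norm_square[symmetric])
  ultimately show ?thesis by (simp add: bergman_density_def divide_inverse)
qed

lemma bergman_density_integrable: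
  assumes z: "z \<in> \<Omega>" shows "set_integrable lborel \<Omega> (bergman_density \<Omega> z)"
proof -
  have "set_integrable lborel \<Omega> (\<lambda>\<xi>. inverse (mass (kernel_measure z)) * Re (k z \<xi> * cnj (k z \<xi>)))"
    by (rule set_integrable_mult_right) (rule re_product_integrable[OF k_L2[OF z] k_L2[OF z]])
  also have "?this \<longleftrightarrow> ?thesis"
    using z by (intro set_integrable_cong refl) (simp add: bergman_density_eq)
  finally show ?thesis .
qed

lemma bergman_map_eq:
  assumes z: "z \<in> \<Omega>" shows "bergman_map \<Omega> z = inverse (mass (kernel_measure z)) *\<^sub>R kernel_measure z"
proof -
  have "bergman_map \<Omega> z = density_measure \<Omega> (\<lambda>\<xi>. inverse (mass (kernel_measure z)) * Re (k z \<xi> * cnj (k z \<xi>)))"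
    unfolding bergman_map_def by (rule density_measure_cong) (rule bergman_density_eq[OF z])
  also have "\<dots> = inverse (mass (kernel_measure z)) *\<^sub>R kernel_measure z"
    unfolding kernel_measure_def re_product_def by (rule density_measure_cmult[OF re_product_integrable[OF k_L2[OF z] k_L2[OF z]]])
  finally show ?thesis .
qed

lemma bergman_map_has_derivative:
  assumes z: "z \<in> \<Omega>"
  shows "(bergman_map \<Omega> has_derivative blinfun_apply (bergman_map_deriv z)) (at z)"
proof -
  have d: "((\<lambda>w. mass (kernel_measure w)) has_derivative (\<lambda>v. mass (kernel_measure_deriv z v))) (at z)"
    by (rule bounded_linear.has_derivative[OF bounded_linear_mass kernel_measure_has_derivative[OF z]])
  have "mass (kernel_measure z) \<noteq> 0" using mass_kernel_measure_pos[OF z] by simp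
  then have "((\<lambda>w. inverse (mass (kernel_measure w))) has_derivative
      (\<lambda>v. - (inverse (mass (kernel_measure z)) * mass (kernel_measure_deriv z v) * inverse (mass (kernel_measure z))))) (at z)"
    by (rule Deriv.has_derivative_inverse[where f = "\<lambda>w. mass (kernel_measure w)", OF _ d])
  from has_derivative_scaleR[OF this kernel_measure_has_derivative[OF z]]
  have "((\<lambda>w. inverse (mass (kernel_measure w)) *\<^sub>R kernel_measure w) has_derivative blinfun_apply (bergman_map_deriv z)) (at z)"
    by (rule has_derivative_eq_rhs) (simp add: fun_eq_iff bergman_map_deriv_apply[OF z] power2_eq_square mult_ac)
  then show ?thesis
    by (rule has_derivative_transform_within_open[OF _ open_dom z]) (simp add: bergman_map_eq)
qed

lemma continuous_on_bergman_map_deriv: "continuous_on \<Omega> bergman_map_deriv"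
proof -
  have kernel_measure: "continuous_on \<Omega> kernel_measure"
    using kernel_measure_has_derivative by (meson continuous_at_imp_continuous_on has_derivative_continuous)
  then have "continuous_on \<Omega> (\<lambda>z. mass (kernel_measure z))"
    by (rule bounded_linear.continuous_on[OF bounded_linear_mass])
  moreover have "\<forall>z\<in>\<Omega>. mass (kernel_measure z) \<noteq> 0" using mass_kernel_measure_pos by force
  ultimately show ?thesis
    unfolding bergman_map_deriv_def
    by (intro continuous_intros continuous_on_kernel_measure_blinfun bounded_linear.continuous_on[OF bounded_linear_blinfun_scaleR_left] kernel_measure)
qed

end

locale bounded_domain = bounded_open \<Omega> for \<Omega> :: "(complex^'n) set" +
  assumes connected_dom: "connected \<Omega>"
begin

lemma k_continuous: "z \<in> \<Omega> \<Longrightarrow> continuous_on \<Omega> (k z)" and k'_continuous: "z \<in> \<Omega> \<Longrightarrow> continuous_on \<Omega> (k' z v)"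
  by (auto intro: holomorphic_several_imp_continuous_on A2_holomorphic k_A2 k'_A2)

lemma bergman_map_in_prob_densities:
  assumes z: "z \<in> \<Omega>" shows "bergman_map \<Omega> z \<in> prob_densities \<Omega>"
proof -
  have "{\<xi> \<in> \<Omega>. k z \<xi> = 0} \<in> null_sets lborel"
    by (rule holomorphic_several_zeros_null[OF A2_holomorphic[OF k_A2[OF z]] open_dom connected_dom z k_diag_nonzero[OF z]])
  then have "AE \<xi> in lborel. \<xi> \<notin> {\<xi> \<in> \<Omega>. k z \<xi> = 0}" by (rule AE_not_in)
  then have pos: "AE \<xi> in lborel. \<xi> \<in> \<Omega> \<longrightarrow> bergman_density \<Omega> z \<xi> > 0"
  proof eventually_elim
    fix \<xi> assume *: "\<xi> \<notin> {\<xi> \<in> \<Omega>. k z \<xi> = 0}"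
    show "\<xi> \<in> \<Omega> \<longrightarrow> bergman_density \<Omega> z \<xi> > 0"
    proof
      assume \<xi>: "\<xi> \<in> \<Omega>"
      with * have "k z \<xi> \<noteq> 0" by simp
      then have "Re (k z \<xi> * cnj (k z \<xi>)) > 0"
        unfolding complex_norm_square[symmetric] by simp
      then show "bergman_density \<Omega> z \<xi> > 0"
        unfolding bergman_density_eq[OF z \<xi>] using mass_kernel_measure_pos[OF z] by (intro mult_pos_pos) simp_all
    qed
  qed
  have "(LINT \<xi>:\<Omega>|lborel. bergman_density \<Omega> z \<xi>) = mass (bergman_map \<Omega> z)"
    unfolding bergman_map_def by (rule mass_density_measure[OF bergman_density_integrable[OF z], symmetric])
  also have "\<dots> = 1"
    using mass_kernel_measure_pos[OF z] by (simp add: bergman_map_eq[OF z] linear_scale[OF bounded_linear.linear[OF bounded_linear_mass]])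
  finally show ?thesis
    using pos bergman_density_integrable[OF z] unfolding prob_densities_def bergman_map_def by blast
qed

lemma inj_on_bergman_map: "inj_on (bergman_map \<Omega>) \<Omega>"
proof (rule inj_onI)
  fix z w assume z: "z \<in> \<Omega>" and w: "w \<in> \<Omega>" and eq: "bergman_map \<Omega> z = bergman_map \<Omega> w"
  let ?N = "\<lambda>z. mass (kernel_measure z)"
  have ae: "AE \<xi> in lborel. \<xi> \<in> \<Omega> \<longrightarrow> bergman_density \<Omega> z \<xi> = bergman_density \<Omega> w \<xi>"
    using eq unfolding bergman_map_def
    by (rule density_measure_eq_imp_AE[OF bergman_density_integrable[OF z] bergman_density_integrable[OF w]])
  have cont: "continuous_on \<Omega> (bergman_density \<Omega> z)" if "z \<in> \<Omega>" for z
  proof -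
    have "continuous_on \<Omega> (\<lambda>\<xi>. inverse (mass (kernel_measure z)) * Re (k z \<xi> * cnj (k z \<xi>)))"
      by (intro continuous_intros k_continuous that)
    then show ?thesis
      by (rule continuous_on_eq) (simp only: bergman_density_eq[OF that])
  qed
  have "(cmod (k z \<xi>))\<^sup>2 = (?N z / ?N w) * (cmod (k w \<xi>))\<^sup>2" if \<xi>: "\<xi> \<in> \<Omega>" for \<xi>
  proof -
    have "bergman_density \<Omega> z \<xi> = bergman_density \<Omega> w \<xi>"
      by (rule continuous_AE_eq_imp_eq[OF open_dom cont[OF z] cont[OF w] ae \<xi>])
    then have "inverse (?N z) * (cmod (k z \<xi>))\<^sup>2 = inverse (?N w) * (cmod (k w \<xi>))\<^sup>2"
      unfolding bergman_density_eq[OF z \<xi>] bergman_density_eq[OF w \<xi>] complex_norm_square[symmetric] by simp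
    then show ?thesis using mass_kernel_measure_pos[OF z] mass_kernel_measure_pos[OF w] by (simp add: field_simps)
  qed
  then have "\<exists>c. \<forall>\<xi>\<in>\<Omega>. k z \<xi> = c * k w \<xi>"
    using mass_kernel_measure_pos[OF z] mass_kernel_measure_pos[OF w]
    by (intro proportional_on_domain[OF A2_holomorphic[OF k_A2[OF z]] A2_holomorphic[OF k_A2[OF w]]
          open_dom connected_dom w k_diag_nonzero[OF w], of "?N z / ?N w"]) simp
  then obtain c where c: "\<And>\<xi>. \<xi> \<in> \<Omega> \<Longrightarrow> k z \<xi> = c * k w \<xi>" by blast
  have eval: "f z = cnj c * f w" if f: "f \<in> A2" for f
  proof -
    have "f z = l2_inner \<mu> f (k z)" by (rule k_reproducing[OF z f, symmetric])
    also have "\<dots> = l2_inner \<mu> f (\<lambda>\<xi>. c * k w \<xi>)" by (rule l2_inner_mu_cong) (rule c)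
    also have "\<dots> = cnj c * l2_inner \<mu> f (k w)"
      using l2_inner_commute[of \<mu> f "\<lambda>\<xi>. c * k w \<xi>"] l2_inner_commute[of \<mu> f "k w"]
      by (simp add: l2_inner_cmult_left)
    finally show ?thesis using k_reproducing[OF w f] by simp
  qed
  have "cnj c = 1" using eval[OF A2_const[of 1]] by simp
  then show "z = w" using eval[OF A2_component] by (simp add: vec_eq_iff)
qed

lemma inj_bergman_map_deriv:
  assumes z: "z \<in> \<Omega>" shows "inj (blinfun_apply (bergman_map_deriv z))"
proof -
  have "v = 0" if v: "blinfun_apply (bergman_map_deriv z) v = 0" for v
  proof -
    let ?N = "mass (kernel_measure z)"
    define m where "m = mass (kernel_measure_deriv z v)"
    define \<phi> \<psi> where "\<phi> \<xi> = 2 * inverse ?N * Re (k z \<xi> * cnj (k' z v \<xi>))"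
      and "\<psi> \<xi> = ((inverse ?N)\<^sup>2 * m) * Re (k z \<xi> * cnj (k z \<xi>))" for \<xi>
    note i1 = re_product_integrable[OF k_L2[OF z] k'_L2[OF z, of v]] and i2 = re_product_integrable[OF k_L2[OF z] k_L2[OF z]]
    have int: "set_integrable lborel \<Omega> \<phi>" "set_integrable lborel \<Omega> \<psi>"
      unfolding \<phi>_def[abs_def] \<psi>_def[abs_def] by (intro set_integrable_mult_right i1 i2)+
    have "density_measure \<Omega> \<phi> = inverse ?N *\<^sub>R kernel_measure_deriv z v"
      unfolding \<phi>_def[abs_def] kernel_measure_deriv_def re_product_def by (subst density_measure_cmult[OF i1]) simp
    moreover have "density_measure \<Omega> \<psi> = ((inverse ?N)\<^sup>2 * m) *\<^sub>R kernel_measure z"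
      unfolding \<psi>_def[abs_def] kernel_measure_def re_product_def by (rule density_measure_cmult[OF i2])
    ultimately have "density_measure \<Omega> \<phi> = density_measure \<Omega> \<psi>"
      using v by (simp add: bergman_map_deriv_apply[OF z] m_def)
    then have ae: "AE \<xi> in lborel. \<xi> \<in> \<Omega> \<longrightarrow> \<phi> \<xi> = \<psi> \<xi>"
      by (rule density_measure_eq_imp_AE[OF int])
    have cont: "continuous_on \<Omega> \<phi>" "continuous_on \<Omega> \<psi>"
      unfolding \<phi>_def[abs_def] \<psi>_def[abs_def] by (intro continuous_intros k_continuous k'_continuous z)+
    have re: "Re (k' z v \<xi> * cnj (k z \<xi>)) = (inverse ?N * m / 2) * (cmod (k z \<xi>))\<^sup>2" if \<xi>: "\<xi> \<in> \<Omega>" for \<xi>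
    proof -
      have "\<phi> \<xi> = \<psi> \<xi>" by (rule continuous_AE_eq_imp_eq[OF open_dom cont ae \<xi>])
      then have "2 * inverse ?N * Re (k z \<xi> * cnj (k' z v \<xi>)) = ((inverse ?N)\<^sup>2 * m) * (cmod (k z \<xi>))\<^sup>2"
        unfolding \<phi>_def \<psi>_def complex_norm_square[symmetric] by simp
      moreover have "R = i * m / 2 * q" if "2 * i * R = i\<^sup>2 * m * q" "i \<noteq> 0" for R i q :: real
      proof -
        have "i * (2 * R) = i * (i * m * q)" using that(1) by (simp add: power2_eq_square mult_ac)
        then show ?thesis using that(2) by (simp only: mult_cancel_left) simp
      qed
      moreover have "inverse ?N \<noteq> 0" using mass_kernel_measure_pos[OF z] by simp
      ultimately have "Re (k z \<xi> * cnj (k' z v \<xi>)) = (inverse ?N * m / 2) * (cmod (k z \<xi>))\<^sup>2" by blast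
      moreover have "Re (k z \<xi> * cnj (k' z v \<xi>)) = Re (k' z v \<xi> * cnj (k z \<xi>))" by simp
      ultimately show ?thesis by metis
    qed
    have "\<exists>c. \<forall>\<xi>\<in>\<Omega>. k' z v \<xi> = c * k z \<xi>"
      by (rule proportional_on_domain[OF A2_holomorphic[OF k'_A2[OF z]] A2_holomorphic[OF k_A2[OF z]]
            open_dom connected_dom z k_diag_nonzero[OF z], OF disjI1[OF ballI[OF re]]])
    then obtain c where c: "\<And>\<xi>. \<xi> \<in> \<Omega> \<Longrightarrow> k' z v \<xi> = c * k z \<xi>" by blast
    have eval: "fderiv f z v = cnj c * f z" if f: "f \<in> A2" for f
    proof -
      have "fderiv f z v = l2_inner \<mu> f (k' z v)" by (rule k'_reproducing[OF z f, symmetric])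
      also have "\<dots> = l2_inner \<mu> f (\<lambda>\<xi>. c * k z \<xi>)" by (rule l2_inner_mu_cong) (rule c)
      also have "\<dots> = cnj c * l2_inner \<mu> f (k z)"
        using l2_inner_commute[of \<mu> f "\<lambda>\<xi>. c * k z \<xi>"] l2_inner_commute[of \<mu> f "k z"]
        by (simp add: l2_inner_cmult_left)
      finally show ?thesis using k_reproducing[OF z f] by simp
    qed
    have "cnj c = 0" using eval[OF A2_const[of 1]] fderiv_eq[OF has_derivative_const] by simp
    then have "v $ i = 0" for i
      using eval[OF A2_component[of i]] fderiv_eq[OF has_derivative_component[of i]] by simp
    then show "v = 0" by (simp add: vec_eq_iff)
  qed
  then show ?thesis
    by (simp add: linear_injective_0 blinfun.bounded_linear_right bounded_linear.linear)
qed

end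

theorem theorem3p12:
  fixes \<Omega> :: "(complex^'n) set"
  assumes "open \<Omega>" "connected \<Omega>" "\<Omega> \<noteq> {}" "bounded \<Omega>"
  shows "bergman_map \<Omega> ` \<Omega> \<subseteq> prob_densities \<Omega> \<and>
         inj_on (bergman_map \<Omega>) \<Omega> \<and>
         immersion_on (bergman_map \<Omega>) \<Omega>"
proof -
  interpret bounded_domain \<Omega> using assms by unfold_locales
  have "immersion_on (bergman_map \<Omega>) \<Omega>"
    unfolding immersion_on_def
    by (intro exI[of _ bergman_map_deriv] conjI ballI bergman_map_has_derivative continuous_on_bergman_map_deriv inj_bergman_map_deriv)
  then show ?thesis using bergman_map_in_prob_densities inj_on_bergman_map by blast
qed

end
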